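(* If $r\in[0,\mu_D)$, then for all $x\ge 0$, $$v_r(x)=b(r)\left(\bigl(x-\tilde\xi(r)\bigr)^2-\tilde\xi^2(r)+2\mu_+\int_0^x g_r(y)\,dy\right),$$ with $$b(r):=\frac{h}{2(\mu_D-r)},\qquad \tilde\xi(r):=(\mu_D-r)\left(\frac{p}{h}+1\right)-\kappa,$$ where $g_r:\mathbb{R}_+\to\mathbb{R}$ is the function for which $U_+(x)=\frac{1}{\mu_+}x+\kappa+g_r(x)$, and which satisfies $|g_r(x)|\le\kappa$ for all $x\ge0$ and $g_r(x)=o(1)$ (i.e. $g_r(x)\to0$ as $x\to\infty$).
   Context: $D$ is a non-negative random variable (demand per period) with distribution function $F_D$ supported on $[0,\infty)$, $F_D(0)=0$, finite mean $\mu_D$ and variance $\sigma_D^2\in(0,\infty)$; $\{D_t\}$ are i.i.d. copies of $D$. $h\ge 0$ is the unit holding cost and $p\ge 0$ the unit lost sales penalty cost; $(x)^+=\max(x,0)$. For $r\in[0,\mu_D)$ let $Y=D-r$, with distribution function $F_Y$ and mean $\mu_Y=\mu_D-r>0$. Relative value function: $v_r:\mathbb{R}_+\to\mathbb{R}$ is the relative value function of the constant order policy (which orders $r$ every period) in the periodic review lost sales inventory system, characterized by $$v_r(x)=a_r(x)+\int_{-r}^{x}v_r(x-y)\,F_Y(dy),\qquad v_r(0)=0,\ x\ge 0,$$ $$a_r(x)=h\,\mathbb{E}[(x-Y)^+]+p\,\mathbb{E}[(Y-x)^+]-p\mu_Y-h\,\mathbb{E}[J_\infty],$$ where $J_\infty$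 is the steady-state inventory level under this policy: $\mathbb{P}\{J_\infty\le x\}=\lim_{t\to\infty}\mathbb{P}\{J_t\le x\}$, with $J_{t+1}=(J_t+r-D_t)^+$. Ladder quantities: let $Y_t=D_t-r$, $S_0=0$, $S_t=\sum_{i=1}^tY_i$, $\tau_+=\inf\{t>0:S_t\ge0\}$ (weak ascending ladder period), $G_+(x)=\mathbb{P}\{S_{\tau_+}\le x\}$, $\mu_+=\mathbb{E}[S_{\tau_+}]$, $\sigma_+^2=\mathrm{Var}[S_{\tau_+}]$. The ascending ladder height renewal measure is $U_+(x)=\sum_{t=0}^\infty G_+^{*t}(x)$, where $G_+^{*t}$ is the $t$-fold convolution of $G_+$ and $G_+^{*0}$ is the distribution function of the unit mass at $0$. The constant $\kappa$ (depending on $r$) is $\kappa=\frac{\sigma_+^2+\mu_+^2}{2\mu_+^2}$ if $D$ is non-lattice and $\kappa=\frac{\sigma_+^2+\mu_+^2+\mu_+}{2\mu_+^2}$ if $D$ is lattice.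
   Formalization: The last term of ξ̃ is μ₊κ instead of κ; h>0 is assumed; v_r is the measurable solution of polynomial growth; g_r(x)→0 is claimed for D non-lattice (lattice: carried by a+dℤ), and along integers x when D−r is integer-valued with span 1. *)

theory Defs
  imports "HOL-Probability.Probability"
begin

subsection \<open>The constant order policy\<close>

text \<open>Inventory under the policy that orders \<open>r\<close> in every period, started from zero; the
  limiting distribution does not depend on the starting level.\<close>

fun inventory :: "real \<Rightarrow> (nat \<Rightarrow> 'a \<Rightarrow> real) \<Rightarrow> nat \<Rightarrow> 'a \<Rightarrow> real" where
  "inventory r Ds 0 w = 0"
| "inventory r Ds (Suc t) w = max (inventory r Ds t w + r - Ds t w) 0"

text \<open>The law of \<open>J\<^sub>\<infinity>\<close>, i.e. the Borel measure whose distribution function is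
  the pointwise limit of the distribution functions of the inventory levels.\<close>

definition steady_state :: "'a measure \<Rightarrow> (nat \<Rightarrow> 'a \<Rightarrow> real) \<Rightarrow> real \<Rightarrow> real measure" where
  "steady_state M Ds r =
     interval_measure (\<lambda>x. lim (\<lambda>t. measure M {w \<in> space M. inventory r Ds t w \<le> x}))"

definition cost_term ::
    "'a measure \<Rightarrow> ('a \<Rightarrow> real) \<Rightarrow> (nat \<Rightarrow> 'a \<Rightarrow> real) \<Rightarrow> real \<Rightarrow> real \<Rightarrow> real \<Rightarrow> real \<Rightarrow> real" where
  "cost_term M D Ds h p r x =
     h * prob_space.expectation M (\<lambda>w. max (x - (D w - r)) 0)
   + p * prob_space.expectation M (\<lambda>w. max ((D w - r) - x) 0)
   - p * prob_space.expectation M (\<lambda>w. D w - r)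
   - h * (\<integral>j. j \<partial>(steady_state M Ds r))"

text \<open>The integral equation with \<open>v 0 = 0\<close> alone does not determine \<open>v\<close>: for \<open>r > 0\<close> its
  homogeneous version can have nonzero solutions (e.g. exponentially growing ones, and
  non-measurable ones, for which the Bochner integral is meaningless). The relative value function
  is the unique measurable solution of polynomial growth; it grows quadratically. Only the values
  of \<open>v\<close> on \<open>[0, \<infinity>)\<close> matter.\<close>

definition relative_value_function ::
    "'a measure \<Rightarrow> ('a \<Rightarrow> real) \<Rightarrow> (nat \<Rightarrow> 'a \<Rightarrow> real) \<Rightarrow> real \<Rightarrow> real \<Rightarrow> real \<Rightarrow> (real \<Rightarrow> real) \<Rightarrow> bool" where
  "relative_value_function M D Ds h p r v \<longleftrightarrow>
     v 0 = 0 \<and>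
     (\<forall>x\<ge>0. v x = cost_term M D Ds h p r x
              + (LINT y:{-r..x}|distr M borel (\<lambda>w. D w - r). v (x - y))) \<and>
     v \<in> borel_measurable (restrict_space borel {0..}) \<and>
     (\<exists>C k. \<forall>x\<ge>0. \<bar>v x\<bar> \<le> C * (1 + x) ^ k)"

subsection \<open>Weak ascending ladder heights\<close>

text \<open>Time starts at \<open>1\<close>: the increments are \<open>Ds 1 - r, Ds 2 - r, \<dots>\<close>\<close>

definition walk :: "(nat \<Rightarrow> 'a \<Rightarrow> real) \<Rightarrow> real \<Rightarrow> nat \<Rightarrow> 'a \<Rightarrow> real" where
  "walk Ds r t w = (\<Sum>i=1..t. Ds i w - r)"

text \<open>The set below is empty only on a null event when the increments have positive mean.\<close>

definition ladder_period :: "(nat \<Rightarrow> 'a \<Rightarrow> real) \<Rightarrow> real \<Rightarrow> 'a \<Rightarrow> nat" where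
  "ladder_period Ds r w = Inf {t. 0 < t \<and> 0 \<le> walk Ds r t w}"

definition ladder_height :: "(nat \<Rightarrow> 'a \<Rightarrow> real) \<Rightarrow> real \<Rightarrow> 'a \<Rightarrow> real" where
  "ladder_height Ds r w = walk Ds r (ladder_period Ds r w) w"

definition mu_plus :: "'a measure \<Rightarrow> (nat \<Rightarrow> 'a \<Rightarrow> real) \<Rightarrow> real \<Rightarrow> real" where
  "mu_plus M Ds r = prob_space.expectation M (ladder_height Ds r)"

definition var_plus :: "'a measure \<Rightarrow> (nat \<Rightarrow> 'a \<Rightarrow> real) \<Rightarrow> real \<Rightarrow> real" where
  "var_plus M Ds r = prob_space.variance M (ladder_height Ds r)"

fun conv_power :: "real measure \<Rightarrow> nat \<Rightarrow> real measure" where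
  "conv_power G 0 = return borel 0"
| "conv_power G (Suc t) = convolution G (conv_power G t)"

definition renewal_plus :: "'a measure \<Rightarrow> (nat \<Rightarrow> 'a \<Rightarrow> real) \<Rightarrow> real \<Rightarrow> real \<Rightarrow> real" where
  "renewal_plus M Ds r x = (\<Sum>t. cdf (conv_power (distr M borel (ladder_height Ds r)) t) x)"

text \<open>Concentrated on a shifted lattice \<open>a + d\<int>\<close>. Allowing the shift \<open>a\<close> makes the notion
  invariant under passing from \<open>D\<close> to \<open>D - r\<close>.\<close>

definition lattice_rv :: "'a measure \<Rightarrow> ('a \<Rightarrow> real) \<Rightarrow> bool" where
  "lattice_rv M X \<longleftrightarrow> (\<exists>a d. 0 < d \<and> (AE w in M. \<exists>k::int. X w = a + d * of_int k))"

text \<open>\<open>\<int>\<close> is the smallest group \<open>d\<int>\<close> carrying the law. The summand \<open>\<mu>\<^sub>+\<close> in the lattice form of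
  \<open>\<kappa>\<close> presupposes that \<open>D - r\<close> has this span, and the lattice renewal theorem then controls the
  renewal function at integer arguments only.\<close>

definition unit_span :: "'a measure \<Rightarrow> ('a \<Rightarrow> real) \<Rightarrow> bool" where
  "unit_span M X \<longleftrightarrow> (AE w in M. X w \<in> \<int>) \<and>
     (\<forall>d>0. (AE w in M. \<exists>k::int. X w = d * of_int k) \<longrightarrow> d \<le> 1)"

definition kappa :: "'a measure \<Rightarrow> ('a \<Rightarrow> real) \<Rightarrow> (nat \<Rightarrow> 'a \<Rightarrow> real) \<Rightarrow> real \<Rightarrow> real" where
  "kappa M D Ds r =
     (if lattice_rv M D
      then (var_plus M Ds r + (mu_plus M Ds r)\<^sup>2 + mu_plus M Ds r) / (2 * (mu_plus M Ds r)\<^sup>2)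
      else (var_plus M Ds r + (mu_plus M Ds r)\<^sup>2) / (2 * (mu_plus M Ds r)\<^sup>2))"

subsection \<open>The coefficients\<close>

definition b_coeff :: "'a measure \<Rightarrow> ('a \<Rightarrow> real) \<Rightarrow> real \<Rightarrow> real \<Rightarrow> real" where
  "b_coeff M D h r = h / (2 * (prob_space.expectation M D - r))"

text \<open>The last term is \<open>\<mu>\<^sub>+ \<kappa>\<close>, not \<open>\<kappa>\<close> as sometimes printed: \<open>\<kappa>\<close> is the constant term of
  \<open>U\<^sub>+ x = x / \<mu>\<^sub>+ + \<kappa> + g x\<close>, hence dimensionless, while \<open>\<xi>\<close> is a quantity of inventory. With
  \<open>\<kappa>\<close> alone the formula for \<open>v\<close> fails whenever \<open>h > 0\<close> and \<open>\<mu>\<^sub>+ \<noteq> 1\<close>. For instance, if \<open>r = 0\<close>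
  and \<open>D \<ge> 2\<close>, the integral equation gives \<open>v x = - p x\<close> on \<open>[0, 2)\<close>, where \<open>U\<^sub>+ = 1\<close>; the
  formula for \<open>v\<close> with \<open>\<kappa>\<close> alone gives \<open>- p x + h \<kappa> x (1 - \<mu>\<^sub>+) / \<mu>\<^sub>+\<close> there.\<close>

definition xi_tilde ::
    "'a measure \<Rightarrow> ('a \<Rightarrow> real) \<Rightarrow> (nat \<Rightarrow> 'a \<Rightarrow> real) \<Rightarrow> real \<Rightarrow> real \<Rightarrow> real \<Rightarrow> real" where
  "xi_tilde M D Ds h p r =
     (prob_space.expectation M D - r) * (p / h + 1) - mu_plus M Ds r * kappa M D Ds r"

end

theory Submission
  imports Defs
begin

text \<open>Let \<open>Y = D - r\<close> and let \<open>P f x = E (f (x - Y))\<close> for functions vanishing on the negative half-line.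
  As \<open>Y\<close> is bounded below and has positive drift, \<open>E (exp (- \<theta> Y)) < 1\<close> for some \<open>\<theta> > 0\<close>, so \<open>w = P w\<close> on
  \<open>[0, \<infinity>)\<close> has no nonzero solution of polynomial growth. The mean passage time \<open>V\<close> satisfies \<open>V = 1 + P V\<close>;
  decomposing at the first ladder epoch \<open>\<tau>\<close> it also solves the renewal equation for the ladder heights, so
  \<open>V = E \<tau> * U\<close>. Integrating gives \<open>W = x + P W + const\<close> for \<open>W x = E \<tau> * \<integral>\<^sub>0\<^sup>x U\<close>, and with Wald's identity
  \<open>\<mu>\<^sub>+ = (\<mu>\<^sub>D - r) * E \<tau>\<close> the function \<open>h W - (p + h) x\<close>, which is the right-hand side of the claim, solves the
  equation for \<open>v\<close> up to a constant. The bounds on \<open>g\<close> amount to \<open>x / \<mu>\<^sub>+ \<le> U x\<close> and Lorden's inequality.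
  For the limit of \<open>g\<close>, a Choquet--Deny argument shows that increments of \<open>Z x = U x - x / \<mu>\<^sub>+\<close> vanish at infinity,
  and the constant is read off from \<open>\<integral> Z (x - y) P(H > y) dy\<close>, which converges to \<open>E H\<^sup>2 / (2 \<mu>\<^sub>+)\<close>.\<close>

subsection \<open>Renewal functions of nonnegative laws\<close>

text \<open>The mean passage time links the two walks of the statement: the equation for
  \<open>v\<close> involves D - r, which may be negative, while U belongs to the nonnegative ladder
  heights. Most identities are first proved for extended nonnegative integrals, where sums and
  integrals may be exchanged freely. The price is that a term can be cancelled only once it is known
  to be finite, and exponential bounds supply this finiteness. Two obstacles shape the limit of g.
  First, U may jump, so its excess over the line need not be uniformly continuous and the
  Choquet--Deny argument does not apply to it directly; it is applied to averages over short
  windows, and the monotonicity of U leads back. Second, \<open>kappa\<close> distinguishes cases by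
  the law of D, while the renewal theorem depends on the lattice of the ladder heights, which might
  be coarser than that of D - r; \<open>increment_lattice\<close> excludes this. In the lattice case
  the excess is a sawtooth between integers, and averaging its teeth against the tail law produces
  the additional \<open>1 / (2 * mean)\<close> in the constant.\<close>

locale nonneg_law = prob_space G for G :: "real measure" +
  assumes sets_law [measurable_cong, simp]: "sets G = sets borel"
    and nonneg: "AE s in G. 0 \<le> s"
begin

lemma space_law [simp]: "space G = UNIV"
  using sets_eq_imp_space_eq[OF sets_law] by simp

lemma conv_power_prob: "prob_space (conv_power G k)"
  and conv_power_sets: "sets (conv_power G k) = sets borel"
proof (induction k)
  case 0
  { case 1 show ?case by (simp add: prob_space_return) }
  { case 2 show ?case by simp }
next
  case (Suc k)
  interpret N: prob_space "conv_power G k" by (fact Suc.IH)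
  interpret pair_prob_space G "conv_power G k" ..
  { case 1
    show ?case
      unfolding conv_power.simps convolution_def
      using Suc.IH(2) by (intro prob_space_distr) (auto cong: measurable_cong_sets sets_pair_measure_cong) }
  { case 2 show ?case by simp }
qed

text \<open>Truncation turns statements about \<open>renewal\<close> into inductions on the number
  of renewals; subadditivity and uniqueness then pass to the supremum.\<close>

definition partial_renewal :: "nat \<Rightarrow> real \<Rightarrow> ennreal" where
  "partial_renewal n x = (\<Sum>k<n. emeasure (conv_power G k) {..x})"

definition renewal :: "real \<Rightarrow> ennreal" where
  "renewal x = (\<Sum>k. emeasure (conv_power G k) {..x})"

lemma mono_conv_power: "x \<le> y \<Longrightarrow> emeasure (conv_power G k) {..x} \<le> emeasure (conv_power G k) {..y}"
  by (intro emeasure_mono) (auto simp: conv_power_sets)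

lemma mono_partial_renewal: "x \<le> y \<Longrightarrow> partial_renewal n x \<le> partial_renewal n y"
  unfolding partial_renewal_def by (intro sum_mono mono_conv_power)

lemma mono_renewal: "x \<le> y \<Longrightarrow> renewal x \<le> renewal y"
  unfolding renewal_def by (intro suminf_le mono_conv_power) auto

lemma renewal_eq_SUP: "renewal x = (SUP n. partial_renewal n x)"
  unfolding renewal_def partial_renewal_def by (rule suminf_eq_SUP)

lemma measurable_conv_power [measurable]:
  "(\<lambda>x. emeasure (conv_power G k) {..x}) \<in> borel_measurable borel"
proof -
  have "mono (\<lambda>x. measure (conv_power G k) {..x})"
    using mono_conv_power by (auto intro!: monoI simp: finite_measure.finite_measure_mono
        prob_space.finite_measure[OF conv_power_prob] conv_power_sets)
  then have "(\<lambda>x. ennreal (measure (conv_power G k) {..x})) \<in> borel_measurable borel"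
    by (intro measurable_compose[OF borel_measurable_mono measurable_ennreal])
  then show ?thesis
    by (simp add: finite_measure.emeasure_eq_measure prob_space.finite_measure[OF conv_power_prob])
qed

lemma measurable_renewal [measurable]: "renewal \<in> borel_measurable borel"
  unfolding renewal_def by measurable

lemma measurable_partial_renewal [measurable]: "partial_renewal n \<in> borel_measurable borel"
  unfolding partial_renewal_def by measurable

lemma conv_power_0: "emeasure (conv_power G 0) {..x} = indicator {0..} x"
  by (simp add: indicator_def)

lemma conv_power_Suc:
  "emeasure (conv_power G (Suc k)) {..x} = (\<integral>\<^sup>+s. emeasure (conv_power G k) {..x - s} \<partial>G)"
proof -
  interpret N: prob_space "conv_power G k" by (fact conv_power_prob)
  have "space (conv_power G k) = UNIV"
    using sets_eq_imp_space_eq[OF conv_power_sets] by simp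
  then have "emeasure (conv_power G (Suc k)) {..x} = (\<integral>\<^sup>+s. emeasure (conv_power G k) {a. a + s \<in> {..x}} \<partial>G)"
    unfolding conv_power.simps
    by (intro convolution_emeasure) (auto simp: conv_power_sets N.finite_measure_axioms finite_measure_axioms)
  moreover have "{a. a + s \<in> {..x}} = {..x - s}" for s :: real by auto
  ultimately show ?thesis by simp
qed

lemma partial_renewal_Suc:
  "partial_renewal (Suc n) x = indicator {0..} x + (\<integral>\<^sup>+s. partial_renewal n (x - s) \<partial>G)"
  unfolding partial_renewal_def
  by (subst sum.lessThan_Suc_shift) (simp add: conv_power_0 conv_power_Suc nn_integral_sum del: conv_power.simps)

lemma renewal_equation: "renewal x = indicator {0..} x + (\<integral>\<^sup>+s. renewal (x - s) \<partial>G)"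
proof -
  have "renewal x = (\<Sum>k. emeasure (conv_power G (Suc k)) {..x}) + emeasure (conv_power G 0) {..x}"
    unfolding renewal_def
    using suminf_offset[OF summableI, of "\<lambda>k. emeasure (conv_power G k) {..x}" 1] by (simp del: conv_power.simps add: add.commute)
  also have "(\<Sum>k. emeasure (conv_power G (Suc k)) {..x}) = (\<integral>\<^sup>+s. renewal (x - s) \<partial>G)"
    unfolding conv_power_Suc renewal_def by (rule nn_integral_suminf[symmetric]) measurable
  finally show ?thesis by (simp only: conv_power_0 add.commute)
qed

lemma conv_power_neg: "x < 0 \<Longrightarrow> emeasure (conv_power G k) {..x} = 0"
proof (induction k arbitrary: x)
  case 0
  then show ?case by (simp only: conv_power_0) simp
next
  case (Suc k)
  have "(\<integral>\<^sup>+s. emeasure (conv_power G k) {..x - s} \<partial>G) = (\<integral>\<^sup>+s. 0 \<partial>G)"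
    using nonneg Suc by (intro nn_integral_cong_AE) auto
  then show ?case by (simp only: conv_power_Suc) simp
qed

lemma renewal_neg: "x < 0 \<Longrightarrow> renewal x = 0"
  unfolding renewal_def by (simp add: conv_power_neg)

lemma renewal_ge_1: "0 \<le> x \<Longrightarrow> 1 \<le> renewal x"
  by (subst renewal_equation) simp

text \<open>The first renewal beyond x starts a fresh process there, with at most the length y left
  to fill. Formally, jumps are subtracted from x until it is negative; then x + y < y and
  monotonicity finishes.\<close>

lemma partial_renewal_subadd: "partial_renewal n (x + y) \<le> partial_renewal n x + partial_renewal n y"
proof (induction n arbitrary: x)
  case 0
  then show ?case by (simp add: partial_renewal_def)
next
  case (Suc n)
  show ?case
  proof (cases "0 \<le> x")
    case True
    have "partial_renewal (Suc n) (x + y) \<le> 1 + (\<integral>\<^sup>+s. partial_renewal n ((x - s) + y) \<partial>G)"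
      unfolding partial_renewal_Suc by (intro add_mono) (auto simp: indicator_def algebra_simps)
    also have "\<dots> \<le> 1 + (\<integral>\<^sup>+s. partial_renewal n (x - s) + partial_renewal n y \<partial>G)"
      by (intro add_mono nn_integral_mono Suc.IH) auto
    also have "\<dots> = partial_renewal (Suc n) x + partial_renewal n y"
      unfolding partial_renewal_Suc using True
      by (subst nn_integral_add) (auto simp: emeasure_space_1[simplified] add.assoc)
    also have "\<dots> \<le> partial_renewal (Suc n) x + partial_renewal (Suc n) y"
      by (intro add_mono) (auto simp: partial_renewal_def)
    finally show ?thesis .
  next
    case False
    then have "partial_renewal (Suc n) (x + y) \<le> partial_renewal (Suc n) y"
      by (intro mono_partial_renewal) auto
    then show ?thesis by (simp add: add_increasing)
  qed
qed

lemma renewal_subadd: "renewal (x + y) \<le> renewal x + renewal y"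
  unfolding renewal_eq_SUP
proof (rule SUP_least)
  fix n
  have "partial_renewal n (x + y) \<le> partial_renewal n x + partial_renewal n y"
    by (rule partial_renewal_subadd)
  also have "\<dots> \<le> (SUP n. partial_renewal n x) + (SUP n. partial_renewal n y)"
    by (intro add_mono SUP_upper) auto
  finally show "partial_renewal n (x + y) \<le> (SUP n. partial_renewal n x) + (SUP n. partial_renewal n y)" .
qed

end

section \<open>Finiteness and uniqueness for laws not concentrated at zero\<close>

locale positive_law = nonneg_law +
  assumes not_zero: "\<not> (AE s in G. s = 0)"
begin

definition laplace :: real where "laplace = (\<integral>s. exp (- s) \<partial>G)"

lemma laplace_integrable: "integrable G (\<lambda>s. exp (- s))"
  using nonneg by (intro integrable_const_bound[where B = 1]) auto

lemma laplace_nonneg: "0 \<le> laplace"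
  unfolding laplace_def by simp

lemma laplace_less_1: "laplace < 1"
proof -
  have "0 \<le> (\<integral>s. 1 - exp (- s) \<partial>G)"
    using nonneg by (intro integral_nonneg_AE) auto
  moreover have "(\<integral>s. 1 - exp (- s) \<partial>G) = 1 - laplace"
    using laplace_integrable by (simp add: laplace_def prob_space[simplified])
  moreover have "(\<integral>s. 1 - exp (- s) \<partial>G) \<noteq> 0"
  proof
    assume "(\<integral>s. 1 - exp (- s) \<partial>G) = 0"
    then have "AE s in G. 1 - exp (- s) = 0"
      using nonneg laplace_integrable
      by (subst (asm) integral_nonneg_eq_0_iff_AE) auto
    then show False using not_zero by simp
  qed
  ultimately show ?thesis by linarith
qed

text \<open>Chernoff bound with exponent 1: the jumps are independent, so each contributes one
  factor \<open>laplace\<close>. As this factor is below 1, the bounds are summable over k and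
  \<open>renewal\<close> is finite.\<close>

lemma conv_power_le: "emeasure (conv_power G k) {..x} \<le> ennreal (exp x * laplace ^ k)"
proof (induction k arbitrary: x)
  case 0
  show ?case by (simp only: conv_power_0) (auto simp: indicator_def simp flip: ennreal_1)
next
  case (Suc k)
  have "(\<integral>\<^sup>+s. emeasure (conv_power G k) {..x - s} \<partial>G) \<le> (\<integral>\<^sup>+s. ennreal (exp x * laplace ^ k * exp (- s)) \<partial>G)"
    by (intro nn_integral_mono order_trans[OF Suc.IH]) (auto simp: exp_diff exp_minus field_simps)
  also have "\<dots> = ennreal (\<integral>s. exp x * laplace ^ k * exp (- s) \<partial>G)"
    using laplace_integrable laplace_nonneg by (intro nn_integral_eq_integral) auto
  also have "\<dots> = ennreal (exp x * laplace ^ Suc k)"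
    by (simp add: laplace_def)
  finally show ?case by (simp only: conv_power_Suc)
qed

lemma conv_power_tendsto_0: "(\<lambda>k. emeasure (conv_power G k) {..x}) \<longlonglongrightarrow> 0"
proof (rule tendsto_sandwich[where f = "\<lambda>_. 0" and h = "\<lambda>k. ennreal (exp x * laplace ^ k)"])
  show "(\<lambda>k. ennreal (exp x * laplace ^ k)) \<longlonglongrightarrow> 0"
    using laplace_nonneg laplace_less_1
    by (auto intro!: tendsto_eq_intros tendsto_ennrealI LIMSEQ_realpow_zero simp flip: ennreal_0)
qed (auto simp: conv_power_le)

lemma renewal_finite: "renewal x < \<infinity>"
proof -
  have "renewal x \<le> (\<Sum>k. ennreal (exp x * laplace ^ k))"
    unfolding renewal_def by (intro suminf_le conv_power_le) auto
  also have "\<dots> < \<infinity>"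
    using laplace_nonneg laplace_less_1
    by (subst suminf_ennreal2) (auto intro!: summable_mult summable_geometric)
  finally show ?thesis .
qed

text \<open>Iterating the equation n times produces \<open>c * partial_renewal n\<close> and a
  remainder. The remainder is at most a fixed value of V times the probability that n jumps add up
  to at most x, which tends to 0.\<close>

lemma renewal_unique:
  fixes V :: "real \<Rightarrow> ennreal"
  assumes V [measurable]: "V \<in> borel_measurable borel"
    and neg: "\<And>x. x < 0 \<Longrightarrow> V x = 0"
    and mono: "\<And>x y. x \<le> y \<Longrightarrow> V x \<le> V y"
    and fin: "\<And>x. V x < \<infinity>"
    and c: "c < \<infinity>"
    and eq: "\<And>x. 0 \<le> x \<Longrightarrow> V x = c + (\<integral>\<^sup>+s. V (x - s) \<partial>G)"
  shows "V x = c * renewal x"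
proof -
  have [measurable]: "(\<lambda>s. V (y - s)) \<in> borel_measurable borel" for y
    by measurable
  have eq': "V x = c * indicator {0..} x + (\<integral>\<^sup>+s. V (x - s) \<partial>G)" for x
  proof (cases "0 \<le> x")
    case False
    then have "(\<integral>\<^sup>+s. V (x - s) \<partial>G) = (\<integral>\<^sup>+s. 0 \<partial>G)"
      using nonneg neg by (intro nn_integral_cong_AE) auto
    then show ?thesis using False neg by simp
  qed (simp add: eq)
  have le: "c * partial_renewal n x \<le> V x" for n x
  proof (induction n arbitrary: x)
    case (Suc n)
    have "c * partial_renewal (Suc n) x = c * indicator {0..} x + (\<integral>\<^sup>+s. c * partial_renewal n (x - s) \<partial>G)"
      unfolding partial_renewal_Suc by (subst nn_integral_cmult) (auto simp: distrib_left)
    also have "\<dots> \<le> c * indicator {0..} x + (\<integral>\<^sup>+s. V (x - s) \<partial>G)"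
      by (intro add_mono nn_integral_mono Suc.IH) auto
    also have "\<dots> = V x" by (rule eq'[symmetric])
    finally show ?case .
  qed (simp add: partial_renewal_def)
  \<comment> \<open>The factor \<open>V x\<close> is frozen while y moves: jumps are nonnegative, so
    every argument reached from y \<le> x stays at or below x.\<close>
  have ge: "V y \<le> c * partial_renewal n y + V x * emeasure (conv_power G n) {..y}" if "y \<le> x" for n x y
    using that
  proof (induction n arbitrary: y)
    case 0
    then show ?case using neg[of y] mono[of y x]
      by (simp only: conv_power_0) (auto simp: partial_renewal_def indicator_def)
  next
    case (Suc n)
    have "V y = c * indicator {0..} y + (\<integral>\<^sup>+s. V (y - s) \<partial>G)" by (rule eq')
    also have "\<dots> \<le> c * indicator {0..} y +
        (\<integral>\<^sup>+s. c * partial_renewal n (y - s) + V x * emeasure (conv_power G n) {..y - s} \<partial>G)"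
      using nonneg Suc by (intro add_mono nn_integral_mono_AE) auto
    also have "\<dots> = c * partial_renewal (Suc n) y + V x * emeasure (conv_power G (Suc n)) {..y}"
      unfolding partial_renewal_Suc conv_power_Suc
      by (subst nn_integral_add) (auto simp: nn_integral_cmult distrib_left add.assoc)
    finally show ?case .
  qed
  have "(\<lambda>n. c * partial_renewal n x + V x * emeasure (conv_power G n) {..x})
      \<longlonglongrightarrow> c * renewal x + V x * 0"
  proof (intro tendsto_add)
    have "(\<lambda>n. partial_renewal n x) \<longlonglongrightarrow> renewal x"
      unfolding partial_renewal_def renewal_def by (rule summable_LIMSEQ) simp
    then show "(\<lambda>n. c * partial_renewal n x) \<longlonglongrightarrow> c * renewal x"
      using c by (intro ennreal_tendsto_cmult) auto
    show "(\<lambda>n. V x * emeasure (conv_power G n) {..x}) \<longlonglongrightarrow> V x * 0"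
      using conv_power_tendsto_0 fin[of x] by (intro ennreal_tendsto_cmult) auto
  qed
  then have "V x \<le> c * renewal x"
    by (intro LIMSEQ_le_const) (auto intro!: ge)
  moreover have "c * renewal x \<le> V x"
    unfolding renewal_eq_SUP SUP_mult_left_ennreal by (intro SUP_least le)
  ultimately show ?thesis by (rule antisym)
qed

end

lemma sets_less [measurable]: "{z::real \<times> real. fst z < snd z} \<in> sets (borel \<Otimes>\<^sub>M borel)"
  unfolding borel_prod by (intro borel_open open_Collect_less continuous_intros)

section \<open>Stationary delay and linear bounds for the renewal function\<close>

locale renewal_law = positive_law +
  assumes square_integrable: "integrable G (\<lambda>s. s\<^sup>2)"
begin

definition mean :: real where "mean = (\<integral>s. s \<partial>G)"
definition second_moment :: real where "second_moment = (\<integral>s. s\<^sup>2 \<partial>G)"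

lemma mean_integrable: "integrable G (\<lambda>s. s)"
proof (rule Bochner_Integration.integrable_bound)
  show "integrable G (\<lambda>s. 1 + s\<^sup>2)"
    using square_integrable by auto
  show "AE s in G. norm s \<le> norm (1 + s\<^sup>2)"
  proof (intro AE_I2)
    fix s :: real
    show "norm s \<le> norm (1 + s\<^sup>2)"
      using zero_le_power2[of "\<bar>s\<bar> - 1"] by (simp add: power2_diff)
  qed
qed auto

lemma mean_pos: "0 < mean"
proof -
  have "0 \<le> mean" unfolding mean_def using nonneg by (intro integral_nonneg_AE) auto
  moreover have "mean \<noteq> 0"
    unfolding mean_def using mean_integrable nonneg not_zero
    by (subst integral_nonneg_eq_0_iff_AE) auto
  ultimately show ?thesis by simp
qed

lemma second_moment_nonneg: "0 \<le> second_moment"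
  unfolding second_moment_def by simp

text \<open>Up to the factor \<open>mean\<close> this is the stationary delay distribution: with such a delay the
  renewal function is exactly linear.\<close>

definition tail_law :: "real measure" where
  "tail_law = density lborel (\<lambda>y. emeasure G {y<..} * indicator {0..} y)"

lemma measurable_tail [measurable]: "(\<lambda>y. emeasure G {y<..}) \<in> borel_measurable borel"
proof -
  have "(\<lambda>y. emeasure G (Pair y -` {z. fst z < snd z})) \<in> borel_measurable borel"
    using sets_less by (intro measurable_emeasure_Pair) (simp cong: sets_pair_measure_cong)
  then show ?thesis by (simp add: vimage_def greaterThan_def)
qed

lemma sets_tail_law [simp, measurable_cong]: "sets tail_law = sets borel"
  by (simp add: tail_law_def)

lemma space_tail_law [simp]: "space tail_law = UNIV"
  by (simp add: tail_law_def)

text \<open>Writing the tail as the integral of the indicator of y < s and exchanging the order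
  reduces moments of \<open>tail_law\<close> to moments of G one degree higher: its mass is
  \<open>mean\<close>, its first moment \<open>second_moment / 2\<close>.\<close>

lemma nn_integral_tail_law:
  assumes [measurable]: "f \<in> borel_measurable borel"
  shows "(\<integral>\<^sup>+y. f y \<partial>tail_law) = (\<integral>\<^sup>+s. (\<integral>\<^sup>+y. f y * indicator {0..<s} y \<partial>lborel) \<partial>G)"
proof -
  interpret pair_sigma_finite lborel G ..
  have "(\<integral>\<^sup>+y. f y \<partial>tail_law) = (\<integral>\<^sup>+y. (emeasure G {y<..} * indicator {0..} y) * f y \<partial>lborel)"
    unfolding tail_law_def by (subst nn_integral_density) auto
  also have "\<dots> = (\<integral>\<^sup>+y. (\<integral>\<^sup>+s. f y * indicator {0..} y * indicator {z. fst z < snd z} (y, s) \<partial>G) \<partial>lborel)"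
  proof (rule nn_integral_cong)
    fix y :: real
    have "(\<integral>\<^sup>+s. f y * indicator {0..} y * indicator {z. fst z < snd z} (y, s) \<partial>G)
        = f y * indicator {0..} y * (\<integral>\<^sup>+s. indicator {z. fst z < snd z} (y, s) \<partial>G)"
      by (rule nn_integral_cmult) measurable
    also have "(\<integral>\<^sup>+s. indicator {z. fst z < snd z} (y, s) \<partial>G) = (\<integral>\<^sup>+s. indicator {y<..} s \<partial>G)"
      by (intro nn_integral_cong) (auto simp: indicator_def)
    also have "\<dots> = emeasure G {y<..}" by simp
    finally show "(emeasure G {y<..} * indicator {0..} y) * f y =
        (\<integral>\<^sup>+s. f y * indicator {0..} y * indicator {z. fst z < snd z} (y, s) \<partial>G)"
      by (simp add: ac_simps)
  qed
  also have "\<dots> = (\<integral>\<^sup>+s. (\<integral>\<^sup>+y. f y * indicator {0..} y * indicator {z. fst z < snd z} (y, s) \<partial>lborel) \<partial>G)"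
    by (rule Fubini'[symmetric]) measurable
  also have "\<dots> = (\<integral>\<^sup>+s. (\<integral>\<^sup>+y. f y * indicator {0..<s} y \<partial>lborel) \<partial>G)"
    by (intro nn_integral_cong) (auto simp: indicator_def)
  finally show ?thesis .
qed

lemma tail_law_nonneg: "AE y in tail_law. 0 \<le> y"
  unfolding tail_law_def by (subst AE_density) (auto simp: indicator_def)

lemma nn_integral_mean: "(\<integral>\<^sup>+s. ennreal s \<partial>G) = ennreal mean"
  unfolding mean_def using mean_integrable nonneg by (intro nn_integral_eq_integral) auto

lemma emeasure_tail_law: "emeasure tail_law UNIV = ennreal mean"
proof -
  have "emeasure tail_law UNIV = (\<integral>\<^sup>+y. 1 \<partial>tail_law)" by simp
  also have "\<dots> = (\<integral>\<^sup>+s. emeasure lborel {0..<s} \<partial>G)"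
    by (subst nn_integral_tail_law) auto
  also have "\<dots> = (\<integral>\<^sup>+s. ennreal s \<partial>G)"
    using nonneg by (intro nn_integral_cong_AE) auto
  finally show ?thesis by (simp add: nn_integral_mean)
qed

lemma finite_tail_law: "finite_measure tail_law"
  by (rule finite_measureI) (simp add: emeasure_tail_law)

lemma nn_integral_id_tail_law: "(\<integral>\<^sup>+y. ennreal y \<partial>tail_law) = ennreal (second_moment / 2)"
proof -
  have "(\<integral>\<^sup>+y. ennreal y * indicator {0..<s} y \<partial>lborel) = ennreal (s\<^sup>2 / 2)" if "0 \<le> s" for s
  proof -
    have "(\<integral>\<^sup>+y. ennreal y * indicator {0..<s} y \<partial>lborel) = (\<integral>\<^sup>+y. ennreal y * indicator {0..s} y \<partial>lborel)"
      by (rule nn_integral_cong_AE, rule AE_mp[OF AE_lborel_singleton[of s]]) (auto simp: indicator_def)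
    also have "\<dots> = ennreal (s\<^sup>2 / 2 - 0\<^sup>2 / 2)"
      using that by (intro nn_integral_FTC_Icc) (auto intro!: derivative_eq_intros)
    finally show ?thesis by simp
  qed
  then have "(\<integral>\<^sup>+y. ennreal y \<partial>tail_law) = (\<integral>\<^sup>+s. ennreal (s\<^sup>2 / 2) \<partial>G)"
    using nonneg by (subst nn_integral_tail_law) (auto intro!: nn_integral_cong_AE)
  also have "\<dots> = ennreal (\<integral>s. s\<^sup>2 / 2 \<partial>G)"
    using square_integrable by (intro nn_integral_eq_integral) auto
  finally show ?thesis by (simp add: second_moment_def)
qed

text \<open>Integrating over \<open>{..x}\<close> instead of \<open>{0..x}\<close> adds nothing,
  since \<open>renewal\<close> vanishes on the negatives, and makes translation and reflection exact
  changes of variable.\<close>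

definition renewal_integral :: "real \<Rightarrow> ennreal" where
  "renewal_integral x = (\<integral>\<^sup>+t. renewal t * indicator {..x} t \<partial>lborel)"

lemma renewal_integral_le: "renewal_integral x \<le> renewal x * ennreal x"
proof -
  have "renewal_integral x \<le> (\<integral>\<^sup>+t. renewal x * indicator {0..x} t \<partial>lborel)"
    unfolding renewal_integral_def
    by (intro nn_integral_mono) (auto simp: indicator_def mono_renewal renewal_neg)
  also have "\<dots> \<le> renewal x * ennreal x"
    by (subst nn_integral_cmult_indicator, simp, cases "0 \<le> x") auto
  finally show ?thesis .
qed

lemma renewal_integral_finite: "renewal_integral x < \<infinity>"
  using renewal_integral_le[of x] renewal_finite[of x]
  by (auto simp: ennreal_mult_less_top intro: le_less_trans)

lemma mono_renewal_integral: "x \<le> y \<Longrightarrow> renewal_integral x \<le> renewal_integral y"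
  unfolding renewal_integral_def by (intro nn_integral_mono) (auto simp: indicator_def)

lemma renewal_integral_neg: "x \<le> 0 \<Longrightarrow> renewal_integral x = 0"
  using renewal_integral_le[of x] by (simp add: ennreal_neg)

lemma measurable_renewal_integral [measurable]: "renewal_integral \<in> borel_measurable borel"
proof -
  have "mono (\<lambda>z. enn2real (renewal_integral z))"
    using mono_renewal_integral renewal_integral_finite by (auto intro!: monoI enn2real_mono)
  from borel_measurable_mono[OF this]
  have "(\<lambda>z. ennreal (enn2real (renewal_integral z))) \<in> borel_measurable borel"
    by measurable
  moreover have "(\<lambda>z. ennreal (enn2real (renewal_integral z))) = renewal_integral"
    using renewal_integral_finite by (intro ext ennreal_enn2real) simp
  ultimately show ?thesis by simp
qed

lemma shift_integral:
  "(\<integral>\<^sup>+t. renewal (t - s) * indicator {..x} t \<partial>lborel) = renewal_integral (x - s)"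
  unfolding renewal_integral_def
  by (subst nn_integral_real_affine[of _ 1 s])
     (auto simp: one_ennreal_def[symmetric] intro!: nn_integral_cong simp: indicator_def)

lemma reflect_integral:
  "(\<integral>\<^sup>+y. renewal (x - y) * indicator {s..} y \<partial>lborel) = renewal_integral (x - s)"
  unfolding renewal_integral_def
  by (subst nn_integral_real_affine[of _ "-1" x])
     (auto simp: one_ennreal_def[symmetric] intro!: nn_integral_cong simp: indicator_def)

lemma renewal_integral_equation:
  assumes "0 \<le> x"
  shows "renewal_integral x = ennreal x + (\<integral>\<^sup>+s. renewal_integral (x - s) \<partial>G)"
proof -
  interpret pair_sigma_finite lborel G ..
  have "renewal_integral x =
      (\<integral>\<^sup>+t. indicator {0..x} t + (\<integral>\<^sup>+s. renewal (t - s) * indicator {..x} t \<partial>G) \<partial>lborel)"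
    unfolding renewal_integral_def
    by (intro nn_integral_cong, subst (1) renewal_equation)
       (auto simp: indicator_def)
  also have "\<dots> = emeasure lborel {0..x} + (\<integral>\<^sup>+t. (\<integral>\<^sup>+s. renewal (t - s) * indicator {..x} t \<partial>G) \<partial>lborel)"
    by (subst nn_integral_add) auto
  also have "(\<integral>\<^sup>+t. (\<integral>\<^sup>+s. renewal (t - s) * indicator {..x} t \<partial>G) \<partial>lborel)
     = (\<integral>\<^sup>+s. (\<integral>\<^sup>+t. renewal (t - s) * indicator {..x} t \<partial>lborel) \<partial>G)"
    by (rule Fubini'[symmetric]) measurable
  finally show ?thesis using assms by (simp add: shift_integral)
qed

text \<open>Over the last s units before x the function U integrates to the difference of
  \<open>renewal_integral\<close> at x and at x - s. Averaged over s this is the left-hand side, and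
  by the integrated renewal equation the average is x. The common term is finite, hence
  cancels.\<close>

lemma nn_integral_renewal_tail_law:
  assumes "0 \<le> x"
  shows "(\<integral>\<^sup>+y. renewal (x - y) \<partial>tail_law) = ennreal x"
proof -
  have "(\<integral>\<^sup>+s. renewal_integral x \<partial>G) =
      (\<integral>\<^sup>+s. (\<integral>\<^sup>+y. renewal (x - y) * indicator {0..<s} y \<partial>lborel) + renewal_integral (x - s) \<partial>G)"
  proof (rule nn_integral_cong_AE)
    show "AE s in G. renewal_integral x =
        (\<integral>\<^sup>+y. renewal (x - y) * indicator {0..<s} y \<partial>lborel) + renewal_integral (x - s)"
      using nonneg
    proof eventually_elim
      fix s :: real assume "0 \<le> s"
      then have "renewal_integral (x - 0) = (\<integral>\<^sup>+y. renewal (x - y) * indicator {0..<s} y + renewal (x - y) * indicator {s..} y \<partial>lborel)"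
        unfolding reflect_integral[symmetric] by (intro nn_integral_cong) (auto simp: indicator_def)
      then show "renewal_integral x =
        (\<integral>\<^sup>+y. renewal (x - y) * indicator {0..<s} y \<partial>lborel) + renewal_integral (x - s)"
        by (subst (asm) nn_integral_add) (auto simp: reflect_integral)
    qed
  qed
  also have "\<dots> = (\<integral>\<^sup>+y. renewal (x - y) \<partial>tail_law) + (\<integral>\<^sup>+s. renewal_integral (x - s) \<partial>G)"
  proof (subst nn_integral_add)
    have [measurable]: "{z::real \<times> real. 0 \<le> snd z \<and> snd z < fst z} \<in> sets (borel \<Otimes>\<^sub>M borel)"
      unfolding borel_prod Collect_conj_eq
      by (intro sets.Int borel_open borel_closed open_Collect_less closed_Collect_le continuous_intros)
    have "(\<lambda>s. \<integral>\<^sup>+y. renewal (x - y) * indicator {z. 0 \<le> snd z \<and> snd z < fst z} (s, y) \<partial>lborel) \<in> borel_measurable borel"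
      by measurable
    then show "(\<lambda>s. \<integral>\<^sup>+y. renewal (x - y) * indicator {0..<s} y \<partial>lborel) \<in> borel_measurable G"
      by (simp add: indicator_def cong: measurable_cong_sets)
  qed (simp_all add: nn_integral_tail_law)
  finally have "(\<integral>\<^sup>+y. renewal (x - y) \<partial>tail_law) + (\<integral>\<^sup>+s. renewal_integral (x - s) \<partial>G)
     = ennreal x + (\<integral>\<^sup>+s. renewal_integral (x - s) \<partial>G)"
    unfolding renewal_integral_equation[OF assms, symmetric] by (simp add: emeasure_space_1[simplified])
  moreover have "(\<integral>\<^sup>+s. renewal_integral (x - s) \<partial>G) \<noteq> \<infinity>"
    unfolding infinity_ennreal_def
    using renewal_integral_equation[OF assms] renewal_integral_finite[of x]
    by (metis ennreal_add_eq_top less_irrefl infinity_ennreal_def)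
  ultimately show ?thesis
    by (auto simp: add.commute[of _ "\<integral>\<^sup>+s. renewal_integral (x - s) \<partial>G"] ennreal_add_left_cancel)
qed

text \<open>A delay can only remove renewals: \<open>renewal (x - y) \<le> renewal x\<close> for y
  \<ge> 0, integrated against \<open>tail_law\<close>, whose mass is \<open>mean\<close>.\<close>

lemma renewal_lower: "0 \<le> x \<Longrightarrow> ennreal x \<le> renewal x * ennreal mean"
proof -
  assume "0 \<le> x"
  have "(\<integral>\<^sup>+y. renewal (x - y) \<partial>tail_law) \<le> (\<integral>\<^sup>+y. renewal x \<partial>tail_law)"
    using tail_law_nonneg by (intro nn_integral_mono_AE) (auto elim!: eventually_mono intro!: mono_renewal)
  then show ?thesis
    using \<open>0 \<le> x\<close> by (simp add: nn_integral_renewal_tail_law emeasure_tail_law)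
qed

text \<open>Lorden's inequality, following Carlsson and Nerman: average
  \<open>U x \<le> U (x + t - y) + U (y - t)\<close> over two independent stationary delays \<open>t\<close> and \<open>y\<close>.\<close>

lemma renewal_upper:
  assumes "0 \<le> x"
  shows "renewal x * ennreal (mean\<^sup>2) \<le> ennreal (x * mean + second_moment)"
proof -
  interpret T: finite_measure tail_law by (rule finite_tail_law)
  interpret pair_sigma_finite tail_law tail_law ..
  have 1: "(\<integral>\<^sup>+y. renewal (x + t - y) \<partial>tail_law) = ennreal x + ennreal t" if "0 \<le> t" for t
    using assms that by (subst nn_integral_renewal_tail_law) auto
  have "renewal x * ennreal mean * ennreal mean = (\<integral>\<^sup>+t. (\<integral>\<^sup>+y. renewal x \<partial>tail_law) \<partial>tail_law)"
    by (simp add: emeasure_tail_law)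
  also have "\<dots> \<le> (\<integral>\<^sup>+t. (\<integral>\<^sup>+y. renewal (x + t - y) + renewal (y - t) \<partial>tail_law) \<partial>tail_law)"
    using renewal_subadd[of "x + t - y" "y - t" for t y] by (intro nn_integral_mono) simp
  also have "\<dots> = (\<integral>\<^sup>+t. (\<integral>\<^sup>+y. renewal (x + t - y) \<partial>tail_law) \<partial>tail_law)
      + (\<integral>\<^sup>+t. (\<integral>\<^sup>+y. renewal (y - t) \<partial>tail_law) \<partial>tail_law)"
    by (simp add: nn_integral_add)
  \<comment> \<open>After the exchange the identity for \<open>tail_law\<close> applies to the inner
    integral and leaves y. Each of the two double integrals thus contributes one half of
    \<open>second_moment\<close>.\<close>
  also have "(\<integral>\<^sup>+t. (\<integral>\<^sup>+y. renewal (y - t) \<partial>tail_law) \<partial>tail_law)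
      = (\<integral>\<^sup>+y. (\<integral>\<^sup>+t. renewal (y - t) \<partial>tail_law) \<partial>tail_law)"
    by (rule Fubini') measurable
  also have "\<dots> = (\<integral>\<^sup>+y. ennreal y \<partial>tail_law)"
    using tail_law_nonneg
    by (intro nn_integral_cong_AE) (auto elim!: eventually_mono simp: nn_integral_renewal_tail_law)
  also have "(\<integral>\<^sup>+t. (\<integral>\<^sup>+y. renewal (x + t - y) \<partial>tail_law) \<partial>tail_law) = (\<integral>\<^sup>+t. ennreal x + ennreal t \<partial>tail_law)"
    using tail_law_nonneg by (intro nn_integral_cong_AE) (auto elim!: eventually_mono simp: 1)
  also have "\<dots> = ennreal x * ennreal mean + ennreal (second_moment / 2)"
    by (subst nn_integral_add) (auto simp: emeasure_tail_law nn_integral_id_tail_law)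
  also have "\<dots> + (\<integral>\<^sup>+y. ennreal y \<partial>tail_law) = ennreal (x * mean + second_moment)"
    using assms mean_pos second_moment_nonneg
    by (simp add: nn_integral_id_tail_law ennreal_mult[symmetric] ennreal_plus[symmetric] del: ennreal_plus)
  finally show ?thesis
    using mean_pos by (simp add: power2_eq_square ennreal_mult mult.assoc)
qed

definition U :: "real \<Rightarrow> real" where "U x = enn2real (renewal x)"

text \<open>The truncation at 0 makes the excess vanish on the negatives, so it is bounded on the
  whole line and may be integrated at x - y without restricting y.\<close>

definition excess :: "real \<Rightarrow> real" where "excess x = U x - max x 0 / mean"

lemma renewal_eq_U: "renewal x = ennreal (U x)"
  using renewal_finite[of x] by (simp add: U_def)

lemma U_nonneg: "0 \<le> U x"
  by (simp add: U_def)

lemma U_neg: "x < 0 \<Longrightarrow> U x = 0"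
  by (simp add: U_def renewal_neg)

lemma mono_U: "x \<le> y \<Longrightarrow> U x \<le> U y"
  using renewal_finite by (auto simp: U_def intro!: enn2real_mono mono_renewal)

lemma U_ge_1: "0 \<le> x \<Longrightarrow> 1 \<le> U x"
  using renewal_ge_1[of x] by (simp add: renewal_eq_U)

lemma measurable_U [measurable]: "U \<in> borel_measurable borel"
  unfolding U_def by measurable

lemma measurable_excess [measurable]: "excess \<in> borel_measurable borel"
  unfolding excess_def by measurable

lemma excess_nonneg: "0 \<le> excess x"
proof (cases "0 \<le> x")
  case True
  then have "ennreal x \<le> ennreal (U x * mean)"
    using renewal_lower[of x] mean_pos by (simp add: renewal_eq_U ennreal_mult U_nonneg)
  then show ?thesis
    using True mean_pos U_nonneg by (simp add: excess_def field_simps)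
qed (simp add: excess_def U_neg)

lemma excess_le: "excess x \<le> second_moment / mean\<^sup>2"
proof (cases "0 \<le> x")
  case True
  then have "ennreal (U x * mean\<^sup>2) \<le> ennreal (x * mean + second_moment)"
    using renewal_upper[of x] mean_pos by (simp add: renewal_eq_U ennreal_mult U_nonneg)
  then have "U x * mean\<^sup>2 \<le> x * mean + second_moment"
    using True mean_pos second_moment_nonneg by (subst (asm) ennreal_le_iff) auto
  then have "U x \<le> (x * mean + second_moment) / mean\<^sup>2"
    using mean_pos by (simp add: pos_le_divide_eq)
  also have "\<dots> = x / mean + second_moment / mean\<^sup>2"
    using mean_pos by (simp add: add_divide_distrib power2_eq_square)
  finally show ?thesis
    using True by (simp add: excess_def)
qed (simp add: excess_def U_neg second_moment_nonneg)

end

subsection \<open>Asymptotics of the renewal function\<close>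

context prob_space
begin

text \<open>If the increments had a positive limit superior, an almost extremal increment at a large \<open>x\<close>
  would force almost extremal increments at \<open>x - a, x - 2 a, \<dots>\<close>, whose sum is unbounded.\<close>

lemma increment_le:
  fixes f X :: "_ \<Rightarrow> real"
  assumes [measurable]: "f \<in> borel_measurable borel" "X \<in> borel_measurable M"
    and bdd: "\<And>x. \<bar>f x\<bar> \<le> B"
    and harmonic: "((\<lambda>x. f x - expectation (\<lambda>w. f (x - X w))) \<longlongrightarrow> 0) at_top"
    and supp: "\<And>e. 0 < e \<Longrightarrow> \<exists>S\<in>events. 0 < prob S \<and> (\<forall>w\<in>S. \<forall>x. \<bar>f (x - X w) - f (x - a)\<bar> \<le> e)"
    and "0 < \<epsilon>"
  shows "eventually (\<lambda>x. f (x + a) - f x \<le> \<epsilon>) at_top"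
proof -
  define h where "h x = f (x + a) - f x" for x
  have [measurable]: "h \<in> borel_measurable borel" unfolding h_def by measurable
  have h_bdd: "\<bar>h x\<bar> \<le> 2 * B" for x
    using bdd[of "x + a"] bdd[of x] by (simp add: h_def)
  have int_f: "integrable M (\<lambda>w. f (x - X w))" for x
    using bdd by (intro integrable_const_bound[where B = B]) auto
  have int_h: "integrable M (\<lambda>w. h (x - X w))" for x
    using h_bdd by (intro integrable_const_bound[where B = "2 * B"]) auto
  have h_harmonic: "((\<lambda>x. h x - expectation (\<lambda>w. h (x - X w))) \<longlongrightarrow> 0) at_top"
  proof -
    have "filterlim (\<lambda>x. x + a) at_top at_top"
      using filterlim_tendsto_add_at_top[OF tendsto_const[of a] filterlim_ident] by (simp add: add.commute)
    from tendsto_diff[OF filterlim_compose[OF harmonic this] harmonic]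
    have "((\<lambda>x. (f (x + a) - expectation (\<lambda>w. f (x + a - X w))) - (f x - expectation (\<lambda>w. f (x - X w)))) \<longlongrightarrow> 0) at_top"
      by simp
    also have "(\<lambda>x. (f (x + a) - expectation (\<lambda>w. f (x + a - X w))) - (f x - expectation (\<lambda>w. f (x - X w))))
       = (\<lambda>x. h x - expectation (\<lambda>w. h (x - X w)))"
    proof
      fix x
      have "expectation (\<lambda>w. h (x - X w)) = expectation (\<lambda>w. f (x + a - X w)) - expectation (\<lambda>w. f (x - X w))"
        unfolding h_def using int_f[of "x + a"] int_f[of x]
        by (subst Bochner_Integration.integral_diff[symmetric]) (auto simp: algebra_simps)
      then show "(f (x + a) - expectation (\<lambda>w. f (x + a - X w))) - (f x - expectation (\<lambda>w. f (x - X w)))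
         = h x - expectation (\<lambda>w. h (x - X w))" by (simp add: h_def)
    qed
    finally show ?thesis .
  qed
  \<comment> \<open>m is the limit superior of h at infinity, taken as the infimum of the eventual
    upper bounds.\<close>
  define A where "A = {m. eventually (\<lambda>x. h x \<le> m) at_top}"
  define m where "m = Inf A"
  have A_ne: "2 * B \<in> A"
    using h_bdd by (auto simp: A_def abs_le_iff intro!: always_eventually)
  have A_lower: "- 2 * B \<le> k" if k: "k \<in> A" for k
  proof -
    obtain x where "h x \<le> k"
      using k by (auto simp: A_def eventually_at_top_linorder)
    then show ?thesis using h_bdd[of x] by linarith
  qed
  have above: "eventually (\<lambda>x. h x \<le> m + \<delta>) at_top" if \<delta>: "0 < \<delta>" for \<delta>
  proof -
    obtain k where "k \<in> A" "k < m + \<delta>"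
      using cInf_lessD[of A "m + \<delta>"] \<delta> A_ne by (auto simp: m_def)
    then show ?thesis by (auto simp: A_def elim: eventually_mono)
  qed
  have below: "\<exists>x\<ge>T. m - \<delta> < h x" if "0 < \<delta>" for \<delta> T
  proof (rule ccontr)
    assume "\<not> ?thesis"
    then have "m - \<delta> \<in> A"
      by (auto simp: A_def eventually_at_top_linorder not_less intro!: exI[of _ T])
    then have "m \<le> m - \<delta>"
      unfolding m_def by (intro cInf_lower bdd_belowI[OF A_lower]) auto
    then show False using that by simp
  qed
  have pos_part: "((\<lambda>x. expectation (\<lambda>w. max (h (x - X w) - m) 0)) \<longlongrightarrow> 0) at_top"
  proof -
    have "((\<lambda>x. expectation (\<lambda>w. max (h (x - X w) - m) 0)) \<longlongrightarrow> expectation (\<lambda>_. 0)) at_top"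
    proof (rule integral_dominated_convergence_at_top[where w = "\<lambda>_. 2 * B + \<bar>m\<bar>"])
      show "AE w in M. ((\<lambda>x. max (h (x - X w) - m) 0) \<longlongrightarrow> 0) at_top"
      proof (intro AE_I2 tendstoI)
        fix w and e :: real assume "0 < e"
        have "filterlim (\<lambda>x. - X w + x) at_top at_top"
          by (intro filterlim_tendsto_add_at_top[OF tendsto_const filterlim_ident])
        from eventually_compose_filterlim[OF above[of "e / 2"] this] \<open>0 < e\<close>
        show "eventually (\<lambda>x. dist (max (h (x - X w) - m) 0) 0 < e) at_top"
          by (auto elim!: eventually_mono)
      qed
      show "eventually (\<lambda>x. AE w in M. norm (max (h (x - X w) - m) 0) \<le> 2 * B + \<bar>m\<bar>) at_top"
      proof (intro always_eventually allI AE_I2)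
        fix x w
        show "norm (max (h (x - X w) - m) 0) \<le> 2 * B + \<bar>m\<bar>"
          using h_bdd[of "x - X w"] by (auto simp: max_def)
      qed
    qed auto
    then show ?thesis by simp
  qed
  have step: "\<exists>\<delta>>0. \<exists>T. \<forall>x\<ge>T. m - \<delta> < h x \<longrightarrow> m - \<eta> < h (x - a)" if "0 < \<eta>" for \<eta>
  proof -
    obtain S where S [measurable]: "S \<in> events" and S_pos: "0 < prob S"
      and S_near: "\<And>w x. w \<in> S \<Longrightarrow> \<bar>f (x - X w) - f (x - a)\<bar> \<le> \<eta> / 4"
      using supp[of "\<eta> / 4"] \<open>0 < \<eta>\<close> by auto
    \<comment> \<open>Suppose h is at most m - \<eta> at x - a. On S it is then at most m - \<eta> /
      2 at x - X, so the expectation loses \<open>prob S * \<eta> / 2\<close>, that is 3 \<delta>.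
      The deficit of h at x, the defect of harmonicity and the part of h above m account for less
      than \<delta> each, a contradiction.\<close>
    define \<delta> where "\<delta> = prob S * \<eta> / 6"
    have "0 < \<delta>" using S_pos \<open>0 < \<eta>\<close> by (simp add: \<delta>_def)
    have "eventually (\<lambda>x. h x - expectation (\<lambda>w. h (x - X w)) < \<delta>
        \<and> expectation (\<lambda>w. max (h (x - X w) - m) 0) < \<delta>) at_top"
      using order_tendstoD(2)[OF h_harmonic \<open>0 < \<delta>\<close>] order_tendstoD(2)[OF pos_part \<open>0 < \<delta>\<close>]
      by eventually_elim simp
    then obtain T where T: "\<And>x. T \<le> x \<Longrightarrow> h x - expectation (\<lambda>w. h (x - X w)) < \<delta>"
        "\<And>x. T \<le> x \<Longrightarrow> expectation (\<lambda>w. max (h (x - X w) - m) 0) < \<delta>"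
      by (auto simp: eventually_at_top_linorder)
    have "m - \<eta> < h (x - a)" if "T \<le> x" "m - \<delta> < h x" for x
    proof (rule ccontr)
      assume neg: "\<not> m - \<eta> < h (x - a)"
      have "h (x - X w) \<le> m + max (h (x - X w) - m) 0 - \<eta> / 2 * indicator S w" for w
      proof (cases "w \<in> S")
        case True
        have "h (x - X w) = f (x + a - X w) - f (x - X w)" "h (x - a) = f x - f (x - a)"
          by (simp_all add: h_def algebra_simps)
        moreover have "\<bar>f (x + a - X w) - f x\<bar> \<le> \<eta> / 4"
          using S_near[OF True, of "x + a"] by simp
        ultimately have "h (x - X w) \<le> h (x - a) + \<eta> / 2"
          using S_near[OF True, of x] by linarith
        then show ?thesis using neg True by simp
      qed simp
      moreover have int_max: "integrable M (\<lambda>w. max (h (x - X w) - m) 0)"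
        using int_h by (intro Bochner_Integration.integrable_max) auto
      moreover have int_S: "integrable M (\<lambda>w. \<eta> / 2 * indicator S w)"
        by (intro integrable_mult_right integrable_real_indicator) (auto simp: emeasure_eq_measure)
      ultimately have "expectation (\<lambda>w. h (x - X w)) \<le>
          expectation (\<lambda>w. m + max (h (x - X w) - m) 0 - \<eta> / 2 * indicator S w)"
        using int_h by (intro integral_mono Bochner_Integration.integrable_diff Bochner_Integration.integrable_add) auto
      also have "\<dots> = m + expectation (\<lambda>w. max (h (x - X w) - m) 0) - \<eta> / 2 * prob S"
        using int_max int_S
        by (subst Bochner_Integration.integral_diff Bochner_Integration.integral_add; simp add: prob_space)+
      finally have "expectation (\<lambda>w. h (x - X w)) \<le> m + expectation (\<lambda>w. max (h (x - X w) - m) 0) - 3 * \<delta>"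
        by (simp add: \<delta>_def)
      then show False
        using T[OF \<open>T \<le> x\<close>] \<open>m - \<delta> < h x\<close> by linarith
    qed
    then show ?thesis using \<open>0 < \<delta>\<close> by blast
  qed
  have steps: "\<exists>\<delta>>0. \<exists>T. \<forall>x\<ge>T. m - \<delta> < h x \<longrightarrow> (\<forall>i\<le>j. m - \<eta> < h (x - real i * a))"
    if "0 < \<eta>" for \<eta> j
    using that
  proof (induction j arbitrary: \<eta>)
    case 0
    then show ?case by (intro exI[of _ \<eta>]) auto
  next
    case (Suc j)
    obtain \<delta>1 T1 where 1: "0 < \<delta>1" "\<And>x. T1 \<le> x \<Longrightarrow> m - \<delta>1 < h x \<Longrightarrow> m - \<eta> < h (x - a)"
      using step[OF Suc.prems] by blast
    obtain \<delta> T where 2: "0 < \<delta>"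
      "\<And>x i. T \<le> x \<Longrightarrow> m - \<delta> < h x \<Longrightarrow> i \<le> j \<Longrightarrow> m - min \<eta> \<delta>1 < h (x - real i * a)"
      using Suc.IH[of "min \<eta> \<delta>1"] Suc.prems 1 by fastforce
    have "m - \<eta> < h (x - real i * a)"
      if x: "max T (T1 + real j * a) \<le> x" "m - \<delta> < h x" and i: "i \<le> Suc j" for x i
    proof (cases "i \<le> j")
      case True
      then show ?thesis using 2(2)[of x i] x by linarith
    next
      case False
      then have "i = Suc j" using i by simp
      moreover have "m - \<eta> < h (x - real j * a - a)"
        using 2(2)[of x j] x by (intro 1(2)) (auto simp: min_def split: if_splits)
      ultimately show ?thesis by (simp add: algebra_simps)
    qed
    then show ?case using \<open>0 < \<delta>\<close> by blast
  qed
  have "m \<le> 0"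
  proof (rule ccontr)
    assume "\<not> m \<le> 0"
    then have "0 < m / 2" by simp
    obtain N :: nat where N: "2 * B < real N * (m / 2)"
      using reals_Archimedean3[OF \<open>0 < m / 2\<close>] by blast
    obtain \<delta> T where \<delta>: "0 < \<delta>"
      and T: "\<And>x i. T \<le> x \<Longrightarrow> m - \<delta> < h x \<Longrightarrow> i \<le> N \<Longrightarrow> m / 2 < h (x - real i * a)"
      using steps[OF \<open>0 < m / 2\<close>, of N] by auto
    obtain x where x: "T \<le> x" "m - \<delta> < h x" using below[OF \<delta>] by blast
    \<comment> \<open>Telescoping: N successive increments, each above m / 2, add up to a difference
      of two values of f, hence to at most 2 B.\<close>
    have "(\<Sum>i<N. h (x - real i * a)) = (\<Sum>i<N. - f (x + a - real (Suc i) * a) - - f (x + a - real i * a))"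
      by (intro sum.cong) (auto simp: h_def algebra_simps)
    also have "\<dots> = f (x + a) - f (x + a - real N * a)"
      by (subst sum_lessThan_telescope) simp
    also have "\<dots> \<le> 2 * B"
      using bdd[of "x + a"] bdd[of "x + a - real N * a"] by (simp add: abs_le_iff)
    finally have "(\<Sum>i<N. h (x - real i * a)) \<le> 2 * B" .
    moreover have "(\<Sum>i<N. m / 2) \<le> (\<Sum>i<N. h (x - real i * a))"
      using T[OF x] by (intro sum_mono less_imp_le) auto
    ultimately show False using N by simp
  qed
  then show ?thesis
    using above[OF \<open>0 < \<epsilon>\<close>] by (auto simp: h_def elim!: eventually_mono)
qed

text \<open>One-sided bounds for f and for - f together. The condition on a is phrased through f
  instead of the support of X, so that it covers both a Lipschitz f with jumps near a and a step
  function with jumps exactly at a.\<close>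

lemma increment_vanishes:
  fixes f X :: "_ \<Rightarrow> real"
  assumes [measurable]: "f \<in> borel_measurable borel" "X \<in> borel_measurable M"
    and bdd: "\<And>x. \<bar>f x\<bar> \<le> B"
    and harmonic: "((\<lambda>x. f x - expectation (\<lambda>w. f (x - X w))) \<longlongrightarrow> 0) at_top"
    and supp: "\<And>e. 0 < e \<Longrightarrow> \<exists>S\<in>events. 0 < prob S \<and> (\<forall>w\<in>S. \<forall>x. \<bar>f (x - X w) - f (x - a)\<bar> \<le> e)"
  shows "((\<lambda>x. f (x + a) - f x) \<longlongrightarrow> 0) at_top"
proof (rule tendstoI)
  fix e :: real assume "0 < e"
  have "eventually (\<lambda>x. f (x + a) - f x \<le> e / 2) at_top"
    using \<open>0 < e\<close> by (intro increment_le[OF assms]) auto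
  moreover have "eventually (\<lambda>x. - f (x + a) - - f x \<le> e / 2) at_top"
  proof (rule increment_le[where f = "\<lambda>x. - f x" and X = X and B = B])
    show "((\<lambda>x. - f x - expectation (\<lambda>w. - f (x - X w))) \<longlongrightarrow> 0) at_top"
      using tendsto_minus[OF harmonic] by simp
    fix e :: real assume "0 < e"
    from supp[OF this]
    show "\<exists>S\<in>events. 0 < prob S \<and> (\<forall>w\<in>S. \<forall>x. \<bar>- f (x - X w) - - f (x - a)\<bar> \<le> e)"
      by (simp add: abs_minus_commute)
  qed (use bdd \<open>0 < e\<close> in auto)
  ultimately show "eventually (\<lambda>x. dist (f (x + a) - f x) 0 < e) at_top"
    by eventually_elim (use \<open>0 < e\<close> in \<open>auto simp: abs_less_iff\<close>)
qed

end

text \<open>d is the infimum of the positive elements. If it were 0, multiples of arbitrarily small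
  elements would be dense; otherwise division by d leaves a remainder in the group that is smaller
  than d, hence 0.\<close>

lemma closed_subgroup_real:
  fixes \<Gamma> :: "real set"
  assumes "closed \<Gamma>" "0 \<in> \<Gamma>" and diff: "\<And>a b. a \<in> \<Gamma> \<Longrightarrow> b \<in> \<Gamma> \<Longrightarrow> a - b \<in> \<Gamma>"
    and "\<Gamma> \<noteq> UNIV" "\<Gamma> \<noteq> {0}"
  shows "\<exists>d>0. \<Gamma> = range (\<lambda>k::int. d * of_int k)"
proof -
  have uminus: "- a \<in> \<Gamma>" if "a \<in> \<Gamma>" for a
    using diff[OF \<open>0 \<in> \<Gamma>\<close> that] by simp
  have add: "a + b \<in> \<Gamma>" if "a \<in> \<Gamma>" "b \<in> \<Gamma>" for a b
    using diff[OF that(1) uminus[OF that(2)]] by simp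
  have mult_nat: "a * of_nat n \<in> \<Gamma>" if "a \<in> \<Gamma>" for a n
    by (induction n) (use that \<open>0 \<in> \<Gamma>\<close> add in \<open>auto simp: distrib_left\<close>)
  have mult: "a * of_int k \<in> \<Gamma>" if "a \<in> \<Gamma>" for a k
    using mult_nat[OF that, of "nat k"] uminus[OF mult_nat[OF that, of "nat (- k)"]]
    by (cases "0 \<le> k") auto
  define P where "P = \<Gamma> \<inter> {0<..}"
  have "P \<noteq> {}"
  proof -
    obtain a where "a \<in> \<Gamma>" "a \<noteq> 0" using \<open>\<Gamma> \<noteq> {0}\<close> \<open>0 \<in> \<Gamma>\<close> by auto
    then show ?thesis using uminus[of a] by (cases "0 < a") (auto simp: P_def)
  qed
  have bdd: "bdd_below P" by (auto simp: P_def intro!: bdd_belowI[of _ 0])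
  define d where "d = Inf P"
  have lower: "d \<le> a" if "a \<in> P" for a
    unfolding d_def by (intro cInf_lower bdd that)
  have "0 \<le> d" unfolding d_def using \<open>P \<noteq> {}\<close> by (intro cInf_greatest) (auto simp: P_def)
  have "d \<in> closure P" unfolding d_def by (intro closure_contains_Inf \<open>P \<noteq> {}\<close> bdd)
  then have "d \<in> \<Gamma>"
    using closure_minimal[of P \<Gamma>] \<open>closed \<Gamma>\<close> by (auto simp: P_def)
  have "d \<noteq> 0"
  proof
    assume "d = 0"
    have "x \<in> closure \<Gamma>" for x
      unfolding closure_approachable
    proof safe
      fix e :: real assume "0 < e"
      then obtain p where p: "p \<in> P" "p < e"
        using cInf_lessD[OF \<open>P \<noteq> {}\<close>, of e] \<open>d = 0\<close> by (auto simp: d_def)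
      then have "0 < p" "p \<in> \<Gamma>" by (auto simp: P_def)
      have "p * of_int \<lfloor>x / p\<rfloor> \<le> x" "x < p * of_int \<lfloor>x / p\<rfloor> + p"
        using floor_divide_lower[OF \<open>0 < p\<close>, of x] floor_divide_upper[OF \<open>0 < p\<close>, of x]
        by (auto simp: algebra_simps)
      then have "dist (p * of_int \<lfloor>x / p\<rfloor>) x < e"
        using p by (simp add: dist_real_def)
      then show "\<exists>y\<in>\<Gamma>. dist y x < e"
        using mult[OF \<open>p \<in> \<Gamma>\<close>] by blast
    qed
    then show False using \<open>closed \<Gamma>\<close> \<open>\<Gamma> \<noteq> UNIV\<close> by auto
  qed
  then have "0 < d" using \<open>0 \<le> d\<close> by simp
  have "a \<in> range (\<lambda>k::int. d * of_int k)" if "a \<in> \<Gamma>" for a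
  proof -
    have r: "d * of_int \<lfloor>a / d\<rfloor> \<le> a" "a < d * of_int \<lfloor>a / d\<rfloor> + d"
      using floor_divide_lower[OF \<open>0 < d\<close>, of a] floor_divide_upper[OF \<open>0 < d\<close>, of a]
      by (auto simp: algebra_simps)
    have "a - d * of_int \<lfloor>a / d\<rfloor> \<in> \<Gamma>"
      by (intro diff that mult \<open>d \<in> \<Gamma>\<close>)
    then have "a - d * of_int \<lfloor>a / d\<rfloor> = 0"
      using lower[of "a - d * of_int \<lfloor>a / d\<rfloor>"] r by (force simp: P_def)
    then show ?thesis by auto
  qed
  then show ?thesis
    using \<open>0 < d\<close> mult[OF \<open>d \<in> \<Gamma>\<close>] by blast
qed

lemma tendsto_min_at_top: "((\<lambda>x. min x s) \<longlongrightarrow> s) at_top" for s :: real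
  by (rule tendsto_eventually) (auto intro: eventually_mono[OF eventually_ge_at_top[of s]])

section \<open>Defect of harmonicity and averages of the excess\<close>

context renewal_law
begin

lemma integrable_bounded:
  fixes f :: "real \<Rightarrow> real"
  assumes [measurable]: "f \<in> borel_measurable borel" and "\<And>x. \<bar>f x\<bar> \<le> B"
  shows "integrable G f"
  using assms by (intro integrable_const_bound[where B = B]) auto

definition excess_bound :: real where "excess_bound = second_moment / mean\<^sup>2"

lemma abs_excess_le: "\<bar>excess x\<bar> \<le> excess_bound"
  using excess_nonneg[of x] excess_le[of x] by (simp add: excess_bound_def)

lemma integrable_U_shift: "integrable G (\<lambda>s. U (x - s))"
  using nonneg U_nonneg by (intro integrable_const_bound[where B = "U x"]) (auto elim!: eventually_mono intro: mono_U)

lemma U_equation: "U x = indicator {0..} x + (\<integral>s. U (x - s) \<partial>G)"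
proof -
  have "ennreal (U x) = indicator {0..} x + (\<integral>\<^sup>+s. ennreal (U (x - s)) \<partial>G)"
    using renewal_equation[of x] by (simp add: renewal_eq_U)
  also have "(\<integral>\<^sup>+s. ennreal (U (x - s)) \<partial>G) = ennreal (\<integral>s. U (x - s) \<partial>G)"
    by (intro nn_integral_eq_integral integrable_U_shift) (auto simp: U_nonneg)
  also have "indicator {0..} x + ennreal (\<integral>s. U (x - s) \<partial>G) = ennreal (indicator {0..} x + (\<integral>s. U (x - s) \<partial>G))"
    by (auto simp: indicator_def U_nonneg ennreal_1[symmetric] simp del: ennreal_1)
  finally show ?thesis
    by (subst (asm) ennreal_inj) (auto simp: U_nonneg intro!: add_nonneg_nonneg)
qed

lemma integrable_min: "integrable G (\<lambda>s. min x s)" if "0 \<le> x"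
  using mean_integrable by (intro Bochner_Integration.integrable_min) auto

text \<open>For x \<ge> 0 the truncated linear part at x - s equals
  \<open>(x - min x s) / mean\<close>, so only a truncated mean survives. The defect therefore
  vanishes at infinity.\<close>

lemma excess_equation:
  assumes "0 \<le> x"
  shows "excess x - (\<integral>s. excess (x - s) \<partial>G) = 1 - (\<integral>s. min x s \<partial>G) / mean"
proof -
  have "(\<integral>s. excess (x - s) \<partial>G) = (\<integral>s. U (x - s) - (x - min x s) / mean \<partial>G)"
    using assms by (intro Bochner_Integration.integral_cong) (auto simp: excess_def max_def min_def)
  also have "\<dots> = (\<integral>s. U (x - s) \<partial>G) - (x - (\<integral>s. min x s \<partial>G)) / mean"
    using integrable_U_shift[of x] integrable_min[OF assms] by (simp add: prob_space[simplified])
  finally show ?thesis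
    using assms U_equation[of x] by (simp add: excess_def diff_divide_distrib)
qed

lemma excess_almost_harmonic: "((\<lambda>x. excess x - (\<integral>s. excess (x - s) \<partial>G)) \<longlongrightarrow> 0) at_top"
proof -
  have "((\<lambda>x. \<integral>s. min x s \<partial>G) \<longlongrightarrow> (\<integral>s. s \<partial>G)) at_top"
  proof (rule integral_dominated_convergence_at_top[where w = "\<lambda>s. s"])
    show "AE s in G. ((\<lambda>x. min x s) \<longlongrightarrow> s) at_top"
      by (intro AE_I2 tendsto_min_at_top)
    show "eventually (\<lambda>x. AE s in G. norm (min x s) \<le> s) at_top"
      using eventually_ge_at_top[of 0]
    proof eventually_elim
      case (elim x)
      show ?case using nonneg by eventually_elim (use elim in auto)
    qed
  qed (auto intro: mean_integrable)
  then have "((\<lambda>x. 1 - (\<integral>s. min x s \<partial>G) / mean) \<longlongrightarrow> 1 - mean / mean) at_top"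
    using mean_pos by (intro tendsto_intros) (auto simp: mean_def)
  then have "((\<lambda>x. 1 - (\<integral>s. min x s \<partial>G) / mean) \<longlongrightarrow> 0) at_top"
    using mean_pos by simp
  then show ?thesis
    by (rule Lim_transform_eventually)
       (use excess_equation in \<open>auto intro!: eventually_mono[OF eventually_ge_at_top[of 0]]\<close>)
qed

lemma integrable_tail_id: "integrable tail_law (\<lambda>y. y)"
  and integral_tail_id: "(\<integral>y. y \<partial>tail_law) = second_moment / 2"
proof -
  have "AE y in tail_law. 0 \<le> y" by (rule tail_law_nonneg)
  then show "integrable tail_law (\<lambda>y. y)"
    by (intro integrableI_nn_integral_finite[OF _ _ nn_integral_id_tail_law]) auto
  show "(\<integral>y. y \<partial>tail_law) = second_moment / 2"
    using tail_law_nonneg nn_integral_id_tail_law second_moment_nonneg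
    by (subst integral_eq_nn_integral) auto
qed

lemma measure_tail_law: "measure tail_law UNIV = mean"
  using mean_pos by (simp add: measure_def emeasure_tail_law)

text \<open>U averages to exactly x against \<open>tail_law\<close>, so U drops out and the
  truncated first moment of \<open>tail_law\<close>, divided by \<open>mean\<close>, remains. This
  determines the constant before any limit of the excess itself is known.\<close>

lemma excess_tail_limit: "((\<lambda>x. \<integral>y. excess (x - y) \<partial>tail_law) \<longlongrightarrow> second_moment / (2 * mean)) at_top"
proof -
  interpret T: finite_measure tail_law by (rule finite_tail_law)
  have eq: "(\<integral>y. excess (x - y) \<partial>tail_law) = (\<integral>y. min x y \<partial>tail_law) / mean" if "0 \<le> x" for x
  proof -
    have int_U: "integrable tail_law (\<lambda>y. U (x - y))"
      using tail_law_nonneg U_nonneg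
      by (intro T.integrable_const_bound[where B = "U x"]) (auto elim!: eventually_mono intro: mono_U)
    have int_min: "integrable tail_law (\<lambda>y. min x y)"
      using integrable_tail_id by (intro Bochner_Integration.integrable_min) auto
    have "ennreal (\<integral>y. U (x - y) \<partial>tail_law) = ennreal x"
      using nn_integral_renewal_tail_law[OF that] int_U
      by (simp add: renewal_eq_U nn_integral_eq_integral U_nonneg)
    then have "(\<integral>y. U (x - y) \<partial>tail_law) = x"
      using that U_nonneg by (subst (asm) ennreal_inj) auto
    moreover have "(\<integral>y. excess (x - y) \<partial>tail_law) = (\<integral>y. U (x - y) - (x - min x y) / mean \<partial>tail_law)"
      using that by (intro Bochner_Integration.integral_cong) (auto simp: excess_def max_def min_def)
    moreover have "\<dots> = (\<integral>y. U (x - y) \<partial>tail_law) - (x * mean - (\<integral>y. min x y \<partial>tail_law)) / mean"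
      using int_U int_min by (simp add: measure_tail_law)
    ultimately show ?thesis using mean_pos by (simp add: diff_divide_distrib)
  qed
  have "((\<lambda>x. \<integral>y. min x y \<partial>tail_law) \<longlongrightarrow> (\<integral>y. y \<partial>tail_law)) at_top"
  proof (rule integral_dominated_convergence_at_top[where w = "\<lambda>s. s"])
    show "AE s in tail_law. ((\<lambda>x. min x s) \<longlongrightarrow> s) at_top"
      by (intro AE_I2 tendsto_min_at_top)
    show "eventually (\<lambda>x. AE s in tail_law. norm (min x s) \<le> s) at_top"
      using eventually_ge_at_top[of 0]
    proof eventually_elim
      case (elim x)
      show ?case using tail_law_nonneg by eventually_elim (use elim in auto)
    qed
  qed (auto intro: integrable_tail_id)
  then have "((\<lambda>x. (\<integral>y. min x y \<partial>tail_law) / mean) \<longlongrightarrow> (second_moment / 2) / mean) at_top"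
    using mean_pos by (intro tendsto_intros) (auto simp: integral_tail_id)
  then have "((\<lambda>x. (\<integral>y. min x y \<partial>tail_law) / mean) \<longlongrightarrow> second_moment / (2 * mean)) at_top"
    by simp
  then show ?thesis
    by (rule Lim_transform_eventually)
       (use eq in \<open>auto intro!: eventually_mono[OF eventually_ge_at_top[of 0]]\<close>)
qed


section \<open>The limit for non-arithmetic laws\<close>

text \<open>Every point off the closed set has a null ball around it; by Lindelof's theorem
  countably many null open sets cover the complement.\<close>

lemma AE_in_closed:
  assumes "closed \<Gamma>" and supp: "\<And>a. (\<And>\<delta>. 0 < \<delta> \<Longrightarrow> 0 < prob (ball a \<delta>)) \<Longrightarrow> a \<in> \<Gamma>"
  shows "AE s in G. s \<in> \<Gamma>"
proof -
  define F where "F = {S :: real set. open S \<and> emeasure G S = 0}"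
  obtain F' where F': "F' \<subseteq> F" "countable F'" "\<Union>F' = \<Union>F"
    using Lindelof[of F] by (auto simp: F_def)
  have "- \<Gamma> \<subseteq> \<Union>F"
  proof
    fix a assume "a \<in> - \<Gamma>"
    then obtain \<delta> where "0 < \<delta>" "\<not> 0 < prob (ball a \<delta>)" using supp by blast
    then have "ball a \<delta> \<in> F"
      by (auto simp: F_def emeasure_eq_measure not_less measure_le_0_iff)
    then show "a \<in> \<Union>F" using \<open>0 < \<delta>\<close> by (intro UnionI[of "ball a \<delta>"]) auto
  qed
  moreover have "(\<Union>S\<in>F'. S) \<in> null_sets G"
    using F' by (intro null_sets_UN') (auto simp: F_def null_sets_def)
  ultimately show ?thesis
    using F'(3) by (intro AE_I'[of "\<Union>F'"]) auto
qed

text \<open>Uniform law on [0, e]. The excess may jump, so jumps of the walk near a need not give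
  values near those for a. Its averages over windows are Lipschitz, which repairs this.\<close>

definition window :: "real \<Rightarrow> real measure" where
  "window e = density lborel (\<lambda>t. ennreal (indicator {0..e} t / e))"

definition smoothed :: "real \<Rightarrow> real \<Rightarrow> real" where
  "smoothed e x = (\<integral>t. excess (x + t) \<partial>window e)"

lemma sets_window [simp, measurable_cong]: "sets (window e) = sets borel"
  by (simp add: window_def)

lemma prob_space_window: "0 < e \<Longrightarrow> prob_space (window e)"
proof
  assume "0 < e"
  have "emeasure (window e) (space (window e)) = (\<integral>\<^sup>+t. ennreal (1 / e) * indicator {0..e} t \<partial>lborel)"
    unfolding window_def by (subst emeasure_density) (auto intro!: nn_integral_cong simp: indicator_def)
  also have "\<dots> = 1"
    using \<open>0 < e\<close> by (subst nn_integral_cmult_indicator) (auto simp: ennreal_mult[symmetric])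
  finally show "emeasure (window e) (space (window e)) = 1" .
qed

lemma AE_window: "AE t in window e. 0 \<le> t \<and> t \<le> e"
  unfolding window_def by (subst AE_density) (auto simp: indicator_def)

lemma integrable_window:
  fixes f :: "real \<Rightarrow> real"
  assumes "0 < e" and [measurable]: "f \<in> borel_measurable borel" and "\<And>x. \<bar>f x\<bar> \<le> B"
  shows "integrable (window e) f"
  using assms prob_space.finite_measure[OF prob_space_window[OF \<open>0 < e\<close>]]
  by (intro finite_measure.integrable_const_bound[where B = B]) auto

lemma integrable_window_excess: "0 < e \<Longrightarrow> integrable (window e) (\<lambda>t. excess (x + t))"
  by (rule integrable_window[where B = excess_bound]) (auto simp: abs_excess_le)

lemma measurable_smoothed [measurable]: "0 < e \<Longrightarrow> smoothed e \<in> borel_measurable borel"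
proof -
  assume "0 < e"
  interpret W: prob_space "window e" by (rule prob_space_window[OF \<open>0 < e\<close>])
  show ?thesis unfolding smoothed_def by measurable
qed

lemma window_le: 
  assumes "0 < e" "integrable (window e) f" "\<And>t. 0 \<le> t \<Longrightarrow> t \<le> e \<Longrightarrow> f t \<le> (B::real)"
  shows "(\<integral>t. f t \<partial>window e) \<le> B"
proof -
  interpret W: prob_space "window e" by (rule prob_space_window[OF \<open>0 < e\<close>])
  show ?thesis
    using assms by (intro W.integral_le_const) (auto intro: eventually_mono[OF AE_window])
qed

lemma window_ge: 
  assumes "0 < e" "integrable (window e) f" "\<And>t. 0 \<le> t \<Longrightarrow> t \<le> e \<Longrightarrow> (B::real) \<le> f t"
  shows "B \<le> (\<integral>t. f t \<partial>window e)"
proof -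
  interpret W: prob_space "window e" by (rule prob_space_window[OF \<open>0 < e\<close>])
  show ?thesis
    using assms by (intro W.integral_ge_const) (auto intro: eventually_mono[OF AE_window])
qed

lemma abs_smoothed_le: "0 < e \<Longrightarrow> \<bar>smoothed e x\<bar> \<le> excess_bound"
  unfolding smoothed_def abs_le_iff using abs_excess_le
  by (intro conjI window_le) 
     (auto simp: abs_le_iff integrable_window_excess minus_le_iff intro!: window_ge integrable_window_excess)

text \<open>The windows at x and at y can differ only on [x, y] and [x + e, y + e], two intervals of
  length y - x; the density 1 / e gives the constant. The inclusion also holds for disjoint
  windows.\<close>

lemma smoothed_lipschitz_aux:
  assumes "0 < e" "x \<le> y"
  shows "\<bar>smoothed e x - smoothed e y\<bar> \<le> 2 * excess_bound / e * (y - x)"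
proof -
  let ?I = "\<lambda>x u. indicator {x..x + e} u :: real"
  have B: "0 \<le> excess_bound" using abs_excess_le[of 0] by linarith
  have eq: "smoothed e x = (\<integral>u. ?I x u * excess u \<partial>lborel) / e" for x
  proof -
    have "smoothed e x = (\<integral>t. (indicator {0..e} t / e) * excess (x + t) \<partial>lborel)"
      unfolding smoothed_def window_def using \<open>0 < e\<close> by (subst integral_real_density) auto
    also have "\<dots> = (\<integral>t. (?I x (x + 1 * t) * excess (x + 1 * t)) / e \<partial>lborel)"
      by (intro Bochner_Integration.integral_cong) (auto simp: indicator_def)
    also have "\<dots> = (\<integral>t. ?I x (x + 1 * t) * excess (x + 1 * t) \<partial>lborel) / e"
      by simp
    also have "(\<integral>t. ?I x (x + 1 * t) * excess (x + 1 * t) \<partial>lborel) = (\<integral>u. ?I x u * excess u \<partial>lborel)"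
      using lborel_integral_real_affine[of 1 "\<lambda>u. ?I x u * excess u" x] by simp
    finally show ?thesis .
  qed
  have int: "integrable lborel (\<lambda>u. ?I x u * excess u)" for x
  proof (rule Bochner_Integration.integrable_bound)
    show "integrable lborel (\<lambda>u. excess_bound * ?I x u)"
      by (intro integrable_mult_right integrable_real_indicator) (auto simp: emeasure_lborel_Icc_eq)
    show "AE u in lborel. norm (?I x u * excess u) \<le> norm (excess_bound * ?I x u)"
      using abs_excess_le B by (intro AE_I2) (simp add: indicator_def)
  qed auto
  have "norm ((\<integral>u. ?I x u * excess u - ?I y u * excess u \<partial>lborel))
      \<le> (\<integral>u. excess_bound * (indicator {x..y} u + indicator {x + e..y + e} u) \<partial>lborel)"
  proof (rule Bochner_Integration.integral_norm_bound_integral)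
    show "integrable lborel (\<lambda>u. ?I x u * excess u - ?I y u * excess u)"
      using int by auto
    show "integrable lborel (\<lambda>u. excess_bound * (indicator {x..y} u + indicator {x + e..y + e} u) :: real)"
      by (intro integrable_mult_right Bochner_Integration.integrable_add integrable_real_indicator)
         (auto simp: emeasure_lborel_Icc_eq)
    fix u
    show "norm (?I x u * excess u - ?I y u * excess u)
        \<le> excess_bound * (indicator {x..y} u + indicator {x + e..y + e} u)"
      using abs_excess_le[of u] B assms by (auto simp: indicator_def)
  qed
  also have "\<dots> = excess_bound * ((y - x) + (y - x))"
    using assms by (simp add: Bochner_Integration.integral_add)
  finally have "\<bar>(\<integral>u. ?I x u * excess u \<partial>lborel) - (\<integral>u. ?I y u * excess u \<partial>lborel)\<bar> \<le> excess_bound * (2 * (y - x))"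
    using int by (simp add: Bochner_Integration.integral_diff)
  then have "\<bar>(\<integral>u. ?I x u * excess u \<partial>lborel) - (\<integral>u. ?I y u * excess u \<partial>lborel)\<bar> / e \<le> excess_bound * (2 * (y - x)) / e"
    using \<open>0 < e\<close> by (intro divide_right_mono) auto
  then show ?thesis
    using \<open>0 < e\<close> unfolding eq by (simp add: diff_divide_distrib[symmetric] abs_divide ac_simps)
qed

lemma smoothed_lipschitz:
  assumes "0 < e"
  shows "\<bar>smoothed e x - smoothed e y\<bar> \<le> 2 * excess_bound / e * \<bar>x - y\<bar>"
  using smoothed_lipschitz_aux[OF assms, of x y] smoothed_lipschitz_aux[OF assms, of y x]
  by (cases "x \<le> y") (auto simp: abs_minus_commute)

text \<open>By Fubini the defect of the average is the average of the defects, which are bounded and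
  tend to 0.\<close>

lemma smoothed_harmonic:
  assumes "0 < e"
  shows "((\<lambda>x. smoothed e x - (\<integral>s. smoothed e (x - s) \<partial>G)) \<longlongrightarrow> 0) at_top"
proof -
  interpret W: prob_space "window e" by (rule prob_space_window[OF \<open>0 < e\<close>])
  interpret WG: pair_prob_space "window e" G ..
  let ?z = "\<lambda>x. excess x - (\<integral>s. excess (x - s) \<partial>G)"
  have z_bdd: "\<bar>?z x\<bar> \<le> 2 * excess_bound" for x
  proof -
    have "\<bar>\<integral>s. excess (x - s) \<partial>G\<bar> \<le> (\<integral>s. excess_bound \<partial>G)"
      unfolding real_norm_def[symmetric]
      by (rule Bochner_Integration.integral_norm_bound_integral)
         (auto intro!: integrable_bounded[where B = excess_bound] simp: abs_excess_le)
    then show ?thesis using abs_excess_le[of x] by (simp add: prob_space[simplified])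
  qed
  have eq: "smoothed e x - (\<integral>s. smoothed e (x - s) \<partial>G) = (\<integral>t. ?z (x + t) \<partial>window e)" for x
  proof -
    have "integrable (window e \<Otimes>\<^sub>M G) (\<lambda>(t, s). excess (x - s + t))"
      by (rule WG.integrable_const_bound[where B = excess_bound]) (auto simp: abs_excess_le)
    then have "(\<integral>s. smoothed e (x - s) \<partial>G) = (\<integral>t. (\<integral>s. excess (x - s + t) \<partial>G) \<partial>window e)"
      unfolding smoothed_def by (intro WG.Fubini_integral) simp
    also have "\<dots> = (\<integral>t. (\<integral>s. excess (x + t - s) \<partial>G) \<partial>window e)"
      by (simp add: algebra_simps)
    finally have "(\<integral>s. smoothed e (x - s) \<partial>G) = (\<integral>t. (\<integral>s. excess (x + t - s) \<partial>G) \<partial>window e)" .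
    moreover have "integrable (window e) (\<lambda>t. ?z (x + t))"
      by (rule integrable_window[OF \<open>0 < e\<close> _ z_bdd]) measurable
    moreover note integrable_window_excess[OF \<open>0 < e\<close>, of x]
    ultimately show ?thesis
      using Bochner_Integration.integral_diff[OF integrable_window_excess[OF \<open>0 < e\<close>, of x]
        Bochner_Integration.integrable_diff[OF integrable_window_excess[OF \<open>0 < e\<close>, of x], of "\<lambda>t. ?z (x + t)"]]
      by (simp add: smoothed_def)
  qed
  have "((\<lambda>x. \<integral>t. ?z (x + t) \<partial>window e) \<longlongrightarrow> (\<integral>t. 0 \<partial>window e)) at_top"
  proof (rule integral_dominated_convergence_at_top[where w = "\<lambda>_. 2 * excess_bound"])
    show "AE t in window e. ((\<lambda>x. ?z (x + t)) \<longlongrightarrow> 0) at_top"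
    proof (intro AE_I2)
      fix t :: real
      have "filterlim (\<lambda>x. x + t) at_top at_top"
        using filterlim_tendsto_add_at_top[OF tendsto_const[of t] filterlim_ident] by (simp add: add.commute)
      from filterlim_compose[OF excess_almost_harmonic this]
      show "((\<lambda>x. ?z (x + t)) \<longlongrightarrow> 0) at_top" .
    qed
  qed (use z_bdd in \<open>auto intro!: always_eventually\<close>)
  then show ?thesis by (simp add: eq)
qed

text \<open>The shifts with vanishing increments form a group, closed by the Lipschitz bound, that
  contains every point of the support of G. A proper closed subgroup is {0} or a lattice; the former
  is excluded because G is not concentrated at 0, the latter by hypothesis.\<close>

lemma smoothed_increments:
  assumes "0 < e" and nonarith: "\<And>d. 0 < d \<Longrightarrow> \<not> (AE s in G. \<exists>k::int. s = d * of_int k)"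
  shows "((\<lambda>x. smoothed e (x + a) - smoothed e x) \<longlongrightarrow> 0) at_top"
proof -
  define \<Gamma> where "\<Gamma> = {a. ((\<lambda>x. smoothed e (x + a) - smoothed e x) \<longlongrightarrow> 0) at_top}"
  define L where "L = 2 * excess_bound / e"
  have L: "0 \<le> L" using abs_excess_le[of 0] \<open>0 < e\<close> by (simp add: L_def)
  have lip: "\<bar>smoothed e x - smoothed e y\<bar> \<le> L * \<bar>x - y\<bar>" for x y
    using smoothed_lipschitz[OF \<open>0 < e\<close>] by (simp add: L_def)
  have "0 \<in> \<Gamma>" by (simp add: \<Gamma>_def)
  have diff: "a - b \<in> \<Gamma>" if "a \<in> \<Gamma>" "b \<in> \<Gamma>" for a b
  proof -
    have "((\<lambda>x. (smoothed e (x + a) - smoothed e x) - (smoothed e (x + b) - smoothed e x)) \<longlongrightarrow> 0 - 0) at_top"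
      using that by (intro tendsto_diff) (auto simp: \<Gamma>_def)
    then have lim: "((\<lambda>x. smoothed e (x + a) - smoothed e (x + b)) \<longlongrightarrow> 0) at_top"
      by simp
    have "filterlim (\<lambda>x. x + - b) at_top at_top"
      using filterlim_tendsto_add_at_top[OF tendsto_const[of "- b"] filterlim_ident] by (simp add: add.commute)
    from filterlim_compose[OF lim this] show ?thesis
      by (simp add: \<Gamma>_def algebra_simps)
  qed
  have "closed \<Gamma>"
    unfolding closure_subset_eq[symmetric]
  proof
    fix a assume "a \<in> closure \<Gamma>"
    then have approx: "\<forall>\<delta>>0. \<exists>b\<in>\<Gamma>. dist b a < \<delta>"
      by (simp add: closure_approachable)
    show "a \<in> \<Gamma>"
      unfolding \<Gamma>_def
    proof (rule, rule tendstoI)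
      fix \<epsilon> :: real assume "0 < \<epsilon>"
      have "0 < \<epsilon> / (2 * (L + 1))" using L \<open>0 < \<epsilon>\<close> by simp
      then obtain b where b: "b \<in> \<Gamma>" "\<bar>b - a\<bar> < \<epsilon> / (2 * (L + 1))"
        using approx by (auto simp: dist_real_def)
      have "(L + 1) * \<bar>b - a\<bar> < \<epsilon> / 2"
        using b(2) L by (simp add: field_simps)
      moreover have "L * \<bar>b - a\<bar> \<le> (L + 1) * \<bar>b - a\<bar>"
        by (intro mult_right_mono) auto
      ultimately have small: "\<bar>smoothed e (x + b) - smoothed e (x + a)\<bar> < \<epsilon> / 2" for x
        using lip[of "x + b" "x + a"] by simp
      have "eventually (\<lambda>x. dist (smoothed e (x + b) - smoothed e x) 0 < \<epsilon> / 2) at_top"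
        using b(1) \<open>0 < \<epsilon>\<close> by (intro tendstoD) (auto simp: \<Gamma>_def)
      then show "eventually (\<lambda>x. dist (smoothed e (x + a) - smoothed e x) 0 < \<epsilon>) at_top"
      proof eventually_elim
        case (elim x)
        then show ?case using small[of x] unfolding dist_real_def diff_zero by linarith
      qed
    qed
  qed
  have "AE s in G. s \<in> \<Gamma>"
  proof (rule AE_in_closed[OF \<open>closed \<Gamma>\<close>])
    fix a assume pos: "\<And>\<delta>. 0 < \<delta> \<Longrightarrow> 0 < prob (ball a \<delta>)"
    show "a \<in> \<Gamma>"
      unfolding \<Gamma>_def
    proof (rule, rule increment_vanishes[where X = "\<lambda>s. s"])
      fix \<epsilon> :: real assume "0 < \<epsilon>"
      define \<delta> where "\<delta> = \<epsilon> / (L + 1)"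
      have "0 < \<delta>" using L \<open>0 < \<epsilon>\<close> by (simp add: \<delta>_def)
      moreover have "\<bar>smoothed e (x - w) - smoothed e (x - a)\<bar> \<le> \<epsilon>" if "w \<in> ball a \<delta>" for w x
      proof -
        have "\<bar>smoothed e (x - w) - smoothed e (x - a)\<bar> \<le> L * \<bar>w - a\<bar>"
          using lip[of "x - w" "x - a"] by (simp add: abs_minus_commute)
        also have "\<dots> \<le> (L + 1) * \<delta>"
          using that L by (intro mult_mono) (auto simp: dist_real_def)
        finally show ?thesis using L by (simp add: \<delta>_def)
      qed
      ultimately show "\<exists>S\<in>events. 0 < prob S \<and> (\<forall>w\<in>S. \<forall>x. \<bar>smoothed e (x - w) - smoothed e (x - a)\<bar> \<le> \<epsilon>)"
        using pos by (intro bexI[of _ "ball a \<delta>"]) auto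
    qed (use \<open>0 < e\<close> abs_smoothed_le smoothed_harmonic in auto)
  qed
  moreover have "\<Gamma> \<noteq> {0}"
    using not_zero calculation by auto
  ultimately have "\<Gamma> = UNIV"
    using closed_subgroup_real[OF \<open>closed \<Gamma>\<close> \<open>0 \<in> \<Gamma>\<close> diff] nonarith
    by (metis (mono_tags, lifting) AE_mp AE_I2 imageE)
  then show ?thesis by (auto simp: \<Gamma>_def)
qed

text \<open>U is increasing, so the excess falls at rate at most \<open>1 / mean\<close>. Averages
  over the window after x are therefore not much below its value at x, and averages over the window
  before x not much above.\<close>

lemma excess_near_smoothed:
  assumes "0 < e"
  shows "excess x - e / mean \<le> smoothed e x" and "smoothed e (x - e) \<le> excess x + e / mean"
proof -
  have step: "excess u \<le> excess v + (v - u) / mean" if "u \<le> v" for u v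
  proof -
    have "max v 0 \<le> max u 0 + (v - u)" using that by (simp add: max_def)
    then have "max v 0 / mean \<le> (max u 0 + (v - u)) / mean"
      using mean_pos by (intro divide_right_mono) auto
    then show ?thesis
      unfolding excess_def add_divide_distrib using mono_U[OF that] by linarith
  qed
  have le: "t / mean \<le> e / mean" if "t \<le> e" for t
    using that mean_pos by (intro divide_right_mono) auto
  show "excess x - e / mean \<le> smoothed e x"
    unfolding smoothed_def
  proof (rule window_ge[OF \<open>0 < e\<close> integrable_window_excess[OF \<open>0 < e\<close>]])
    fix t assume "0 \<le> t" "t \<le> e"
    then show "excess x - e / mean \<le> excess (x + t)"
      using step[of x "x + t"] le[of t] by simp
  qed
  show "smoothed e (x - e) \<le> excess x + e / mean"
    unfolding smoothed_def
  proof (rule window_le[OF \<open>0 < e\<close> integrable_window_excess[OF \<open>0 < e\<close>]])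
    fix t assume "0 \<le> t" "t \<le> e"
    then show "excess (x - e + t) \<le> excess x + e / mean"
      using step[of "x - e + t" x] le[of "e - t"] by simp
  qed
qed

lemma excess_increments:
  assumes nonarith: "\<And>d. 0 < d \<Longrightarrow> \<not> (AE s in G. \<exists>k::int. s = d * of_int k)"
  shows "((\<lambda>x. excess (x - y) - excess x) \<longlongrightarrow> 0) at_top"
proof (rule tendstoI)
  fix \<epsilon> :: real assume "0 < \<epsilon>"
  \<comment> \<open>Passing to averages on both sides costs twice \<open>\<epsilon> / 4\<close>; the
    two increments of averages involved cost less than \<open>\<epsilon> / 8\<close> each.\<close>
  define e where "e = mean * \<epsilon> / 4"
  have e: "0 < e" "e / mean = \<epsilon> / 4" using \<open>0 < \<epsilon>\<close> mean_pos by (auto simp: e_def)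
  have ev: "eventually (\<lambda>x. \<bar>smoothed e (x + a) - smoothed e x\<bar> < \<epsilon> / 8) at_top" for a
    using tendstoD[OF smoothed_increments[OF \<open>0 < e\<close> nonarith], of "\<epsilon> / 8" a] \<open>0 < \<epsilon>\<close> by simp
  show "eventually (\<lambda>x. dist (excess (x - y) - excess x) 0 < \<epsilon>) at_top"
    using ev[of "- y"] ev[of "- e"] ev[of "- y - e"]
  proof eventually_elim
    case (elim x)
    have "\<bar>smoothed e (x - y) - smoothed e x\<bar> < \<epsilon> / 8" "\<bar>smoothed e (x - e) - smoothed e x\<bar> < \<epsilon> / 8"
        "\<bar>smoothed e (x - y - e) - smoothed e x\<bar> < \<epsilon> / 8"
      using elim by (simp_all add: algebra_simps)
    then have "\<bar>excess (x - y) - excess x\<bar> < \<epsilon>"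
      using \<open>0 < \<epsilon>\<close> excess_near_smoothed[OF e(1), of x, unfolded e(2)]
        excess_near_smoothed[OF e(1), of "x - y", unfolded e(2)] by linarith
    then show ?case by simp
  qed
qed

text \<open>Since increments vanish, the average of the excess against \<open>tail_law\<close>
  behaves like its value at x times the mass \<open>mean\<close>; the limit of this average is
  already known.\<close>

lemma excess_limit:
  assumes nonarith: "\<And>d. 0 < d \<Longrightarrow> \<not> (AE s in G. \<exists>k::int. s = d * of_int k)"
  shows "(excess \<longlongrightarrow> second_moment / (2 * mean\<^sup>2)) at_top"
proof -
  interpret T: finite_measure tail_law by (rule finite_tail_law)
  have int: "integrable tail_law (\<lambda>y. excess (x - y))" for x
    using abs_excess_le by (intro T.integrable_const_bound[where B = excess_bound]) auto
  have "((\<lambda>x. \<integral>y. excess (x - y) - excess x \<partial>tail_law) \<longlongrightarrow> (\<integral>y. 0 \<partial>tail_law)) at_top"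
  proof (rule integral_dominated_convergence_at_top[where w = "\<lambda>_. 2 * excess_bound"])
    show "AE y in tail_law. ((\<lambda>x. excess (x - y) - excess x) \<longlongrightarrow> 0) at_top"
      by (intro AE_I2 excess_increments nonarith)
    show "eventually (\<lambda>x. AE y in tail_law. norm (excess (x - y) - excess x) \<le> 2 * excess_bound) at_top"
    proof (intro always_eventually allI AE_I2)
      fix x y
      show "norm (excess (x - y) - excess x) \<le> 2 * excess_bound"
        using abs_excess_le[of "x - y"] abs_excess_le[of x] unfolding real_norm_def by linarith
    qed
  qed auto
  then have "((\<lambda>x. (\<integral>y. excess (x - y) \<partial>tail_law) - excess x * mean) \<longlongrightarrow> 0) at_top"
    using int by (simp add: measure_tail_law ac_simps)
  from tendsto_divide[OF tendsto_diff[OF excess_tail_limit this] tendsto_const[of mean]]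
  show ?thesis
    using mean_pos by (simp add: power2_eq_square mult.assoc)
qed

end

section \<open>The limit along the integers for laws of unit span\<close>

lemma frac_integral: "(\<integral>\<^sup>+y. ennreal (of_int \<lceil>y\<rceil> - y) * indicator {0..<real n} y \<partial>lborel) = ennreal (real n / 2)"
proof (induction n)
  case (Suc n)
  have "(\<integral>\<^sup>+y. ennreal (of_int \<lceil>y\<rceil> - y) * indicator {0..<real (Suc n)} y \<partial>lborel)
     = (\<integral>\<^sup>+y. ennreal (of_int \<lceil>y\<rceil> - y) * indicator {0..<real n} y
          + ennreal (real (Suc n) - y) * indicator {real n..real (Suc n)} y \<partial>lborel)"
  proof (rule nn_integral_cong_AE, rule AE_mp[OF AE_lborel_singleton[of "real n"]],
      rule AE_mp[OF AE_lborel_singleton[of "real (Suc n)"]], intro AE_I2 impI)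
    fix y :: real assume "y \<noteq> real n" "y \<noteq> real (Suc n)"
    moreover have "\<lceil>y\<rceil> = int (Suc n)" if "real n < y" "y < real (Suc n)"
      using that by (simp add: ceiling_eq_iff)
    ultimately show "ennreal (of_int \<lceil>y\<rceil> - y) * indicator {0..<real (Suc n)} y
       = ennreal (of_int \<lceil>y\<rceil> - y) * indicator {0..<real n} y
          + ennreal (real (Suc n) - y) * indicator {real n..real (Suc n)} y"
      by (auto simp: indicator_def)
  qed
  also have "\<dots> = ennreal (real n / 2) + (\<integral>\<^sup>+y. ennreal (real (Suc n) - y) * indicator {real n..real (Suc n)} y \<partial>lborel)"
    by (subst nn_integral_add) (simp_all add: Suc.IH)
  also have "(\<integral>\<^sup>+y. ennreal (real (Suc n) - y) * indicator {real n..real (Suc n)} y \<partial>lborel)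
     = ennreal ((- (real (Suc n) - real (Suc n))\<^sup>2 / 2) - (- (real (Suc n) - real n)\<^sup>2 / 2))"
    by (intro nn_integral_FTC_Icc) (auto intro!: derivative_eq_intros simp: field_simps)
  also have "(- (real (Suc n) - real (Suc n))\<^sup>2 / 2) - (- (real (Suc n) - real n)\<^sup>2 / 2) = 1 / 2"
    by simp
  also have "ennreal (real n / 2) + ennreal (1 / 2) = ennreal (real (Suc n) / 2)"
    by (subst ennreal_plus[symmetric]) (auto simp: add_divide_distrib)
  finally show ?case .
qed simp

context renewal_law
begin

text \<open>Sums of jumps stay on the lattice, so their distribution functions are constant on each
  cell.\<close>

lemma U_lattice:
  assumes "0 < d" and lattice: "AE s in G. \<exists>k::int. s = d * of_int k"
  shows "U x = U (d * of_int \<lfloor>x / d\<rfloor>)"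
proof -
  have "emeasure (conv_power G n) {..x} = emeasure (conv_power G n) {..d * of_int \<lfloor>x / d\<rfloor>}" for n
  proof (induction n arbitrary: x)
    case 0
    show ?case
      using \<open>0 < d\<close> by (simp only: conv_power_0) (simp add: indicator_def zero_le_mult_iff zero_le_divide_iff)
  next
    case (Suc n)
    have "(\<integral>\<^sup>+s. emeasure (conv_power G n) {..x - s} \<partial>G)
      = (\<integral>\<^sup>+s. emeasure (conv_power G n) {..d * of_int \<lfloor>x / d\<rfloor> - s} \<partial>G)"
    proof (rule nn_integral_cong_AE)
      show "AE s in G. emeasure (conv_power G n) {..x - s} = emeasure (conv_power G n) {..d * of_int \<lfloor>x / d\<rfloor> - s}"
        using lattice
      proof eventually_elim
        case (elim s)
        then obtain k :: int where s: "s = d * of_int k" by auto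
        have "(x - s) / d = x / d - of_int k" using \<open>0 < d\<close> by (simp add: s diff_divide_distrib)
        then have "d * of_int \<lfloor>(x - s) / d\<rfloor> = d * of_int \<lfloor>x / d\<rfloor> - s"
          by (simp add: s right_diff_distrib)
        then show ?case using Suc.IH[of "x - s"] by simp
      qed
    qed
    then show ?case by (simp only: conv_power_Suc)
  qed
  then show ?thesis unfolding U_def renewal_def by presburger
qed

lemma tail_law_frac:
  assumes "AE s in G. s \<in> \<int>"
  shows "(\<integral>y. of_int \<lceil>y\<rceil> - y \<partial>tail_law) = mean / 2"
proof -
  have "(\<integral>\<^sup>+y. ennreal (of_int \<lceil>y\<rceil> - y) \<partial>tail_law) = (\<integral>\<^sup>+s. ennreal (s / 2) \<partial>G)"
  proof (subst nn_integral_tail_law)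
    show "(\<integral>\<^sup>+s. (\<integral>\<^sup>+y. ennreal (of_int \<lceil>y\<rceil> - y) * indicator {0..<s} y \<partial>lborel) \<partial>G) = (\<integral>\<^sup>+s. ennreal (s / 2) \<partial>G)"
    proof (rule nn_integral_cong_AE)
      show "AE s in G. (\<integral>\<^sup>+y. ennreal (of_int \<lceil>y\<rceil> - y) * indicator {0..<s} y \<partial>lborel) = ennreal (s / 2)"
        using assms nonneg
      proof eventually_elim
        case (elim s)
        then obtain n :: nat where "s = real n"
          by (auto elim!: Ints_cases) (metis of_nat_nat)
        then show ?case using frac_integral[of n] by simp
      qed
    qed
  qed measurable
  also have "\<dots> = ennreal (\<integral>s. s / 2 \<partial>G)"
    using mean_integrable nonneg by (intro nn_integral_eq_integral) auto
  finally show ?thesis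
    using mean_pos by (subst integral_eq_nn_integral) (auto simp: mean_def)
qed

text \<open>The same group argument for the excess at the integer part. No smoothing is required: a
  support point is an atom and is hit exactly, and a set of integers is automatically closed. The
  group is then a lattice of integer span d \<le> 1.\<close>

lemma lattice_increments:
  fixes a :: real
  assumes int: "AE s in G. s \<in> \<int>"
    and span: "\<And>d. 0 < d \<Longrightarrow> (AE s in G. \<exists>k::int. s = d * of_int k) \<Longrightarrow> d \<le> 1"
    and a: "a \<in> \<int>"
  shows "((\<lambda>x. excess (of_int \<lfloor>x + a\<rfloor>) - excess (of_int \<lfloor>x\<rfloor>)) \<longlongrightarrow> 0) at_top"
proof -
  define f where "f x = excess (of_int \<lfloor>x\<rfloor>)" for x :: real
  have [measurable]: "f \<in> borel_measurable borel" unfolding f_def by measurable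
  define \<Gamma> where "\<Gamma> = {a \<in> \<int>. ((\<lambda>x. f (x + a) - f x) \<longlongrightarrow> 0) at_top}"
  have floor_lim: "filterlim (\<lambda>x::real. real_of_int \<lfloor>x\<rfloor>) at_top at_top"
  proof (rule filterlim_at_top_mono)
    show "filterlim (\<lambda>x::real. - 1 + x) at_top at_top"
      by (rule filterlim_tendsto_add_at_top[OF tendsto_const filterlim_ident])
    show "eventually (\<lambda>x::real. - 1 + x \<le> real_of_int \<lfloor>x\<rfloor>) at_top"
      by (intro always_eventually allI) linarith
  qed
  have harmonic: "((\<lambda>x. f x - (\<integral>s. f (x - s) \<partial>G)) \<longlongrightarrow> 0) at_top"
  proof -
    have "(\<integral>s. f (x - s) \<partial>G) = (\<integral>s. excess (of_int \<lfloor>x\<rfloor> - s) \<partial>G)" for x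
      using int by (intro integral_cong_AE) (auto elim!: eventually_mono Ints_cases simp: f_def)
    then show ?thesis
      using filterlim_compose[OF excess_almost_harmonic floor_lim] by (simp add: f_def)
  qed
  have "0 \<in> \<Gamma>" by (simp add: \<Gamma>_def)
  have diff: "a - b \<in> \<Gamma>" if "a \<in> \<Gamma>" "b \<in> \<Gamma>" for a b
  proof -
    have "((\<lambda>x. (f (x + a) - f x) - (f (x + b) - f x)) \<longlongrightarrow> 0 - 0) at_top"
      using that by (intro tendsto_diff) (auto simp: \<Gamma>_def)
    then have lim: "((\<lambda>x. f (x + a) - f (x + b)) \<longlongrightarrow> 0) at_top"
      by simp
    have "filterlim (\<lambda>x. x + - b) at_top at_top"
      using filterlim_tendsto_add_at_top[OF tendsto_const[of "- b"] filterlim_ident] by (simp add: add.commute)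
    from filterlim_compose[OF lim this] show ?thesis
      using that by (simp add: \<Gamma>_def algebra_simps)
  qed
  have "closed \<Gamma>"
    by (rule closed_subset_Ints) (auto simp: \<Gamma>_def)
  have Ints_ball: "prob (ball a \<delta>) = prob (ball a \<delta> \<inter> \<int>)" for a \<delta>
    using int by (intro finite_measure_eq_AE) (auto elim!: eventually_mono)
  have AE_\<Gamma>: "AE s in G. s \<in> \<Gamma>"
  proof (rule AE_in_closed[OF \<open>closed \<Gamma>\<close>])
    fix a assume pos: "\<And>\<delta>. 0 < \<delta> \<Longrightarrow> 0 < prob (ball a \<delta>)"
    have "a \<in> \<int>"
    proof (rule ccontr)
      assume "a \<notin> \<int>"
      then obtain \<delta> where "0 < \<delta>" "ball a \<delta> \<subseteq> - \<int>"
        using open_contains_ball[of "- (\<int> :: real set)"] closed_Ints by (auto simp: open_Compl)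
      then have "ball a \<delta> \<inter> \<int> = {}" by auto
      then show False using pos[OF \<open>0 < \<delta>\<close>] Ints_ball[of a \<delta>] by simp
    qed
    moreover have "((\<lambda>x. f (x + a) - f x) \<longlongrightarrow> 0) at_top"
    proof (rule increment_vanishes[where X = "\<lambda>s. s" and B = excess_bound])
      fix \<epsilon> :: real assume "0 < \<epsilon>"
      \<comment> \<open>Two integers at distance less than 1 / 2 coincide, so the ball isolates the
        atom at a.\<close>
      have near: "w = a" if "w \<in> ball a (1 / 2) \<inter> \<int>" for w
        using that \<open>a \<in> \<int>\<close> Ints_eq_abs_less1[of a w] by (auto simp: dist_real_def)
      have "\<bar>f (x - w) - f (x - a)\<bar> \<le> \<epsilon>" if "w \<in> ball a (1 / 2) \<inter> \<int>" for w x
        using near[OF that] \<open>0 < \<epsilon>\<close> by simp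
      then show "\<exists>S\<in>events. 0 < prob S \<and> (\<forall>w\<in>S. \<forall>x. \<bar>f (x - w) - f (x - a)\<bar> \<le> \<epsilon>)"
        using pos[of "1 / 2"] Ints_ball[of a "1 / 2"]
        by (intro bexI[of _ "ball a (1 / 2) \<inter> \<int>"] conjI) auto
    qed (use harmonic abs_excess_le in \<open>auto simp: f_def\<close>)
    ultimately show "a \<in> \<Gamma>" by (simp add: \<Gamma>_def)
  qed
  have "\<Gamma> \<noteq> {0}"
    using not_zero AE_\<Gamma> by auto
  have "(1 / 2 :: real) \<notin> \<Gamma>"
    using fraction_not_in_Ints[of 2 1, where 'a = real] by (simp add: \<Gamma>_def)
  then have "\<Gamma> \<noteq> UNIV" by blast
  then obtain d where "0 < d" and d: "\<Gamma> = range (\<lambda>k::int. d * of_int k)"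
    using closed_subgroup_real[OF \<open>closed \<Gamma>\<close> \<open>0 \<in> \<Gamma>\<close> diff _ \<open>\<Gamma> \<noteq> {0}\<close>] by auto
  have "AE s in G. \<exists>k::int. s = d * of_int k"
    using AE_\<Gamma> by (auto elim!: eventually_mono simp: d)
  then have "d \<le> 1" using span \<open>0 < d\<close> by simp
  have "d \<in> \<Gamma>" unfolding d by (rule image_eqI[of _ _ 1]) auto
  then have "d \<in> \<int>" by (simp add: \<Gamma>_def)
  then have "d = 1" using \<open>0 < d\<close> \<open>d \<le> 1\<close> by (auto elim!: Ints_cases)
  then have "a \<in> \<Gamma>" using a by (auto simp: d elim!: Ints_cases)
  then have "a \<in> \<int> \<and> ((\<lambda>x. f (x + a) - f x) \<longlongrightarrow> 0) at_top"
    unfolding \<Gamma>_def by (rule CollectD)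
  then show ?thesis unfolding f_def by (rule conjunct2)
qed

text \<open>U is constant between integers, hence the excess at n - y lies below the excess at the
  integer n - \<lceil>y\<rceil> by \<open>(\<lceil>y\<rceil> - y) / mean\<close>. Against
  \<open>tail_law\<close> this correction has integral 1 / 2, which becomes the summand
  \<open>mean\<close> in the numerator.\<close>

lemma excess_lattice_limit:
  assumes int: "AE s in G. s \<in> \<int>"
    and span: "\<And>d. 0 < d \<Longrightarrow> (AE s in G. \<exists>k::int. s = d * of_int k) \<Longrightarrow> d \<le> 1"
  shows "(\<lambda>n. excess (real n)) \<longlonglongrightarrow> (second_moment + mean) / (2 * mean\<^sup>2)"
proof -
  interpret T: finite_measure tail_law by (rule finite_tail_law)
  have int_excess: "integrable tail_law (\<lambda>y. excess (x - y))" for x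
    using abs_excess_le by (intro T.integrable_const_bound[where B = excess_bound]) auto
  have int_frac: "integrable tail_law (\<lambda>y. of_int \<lceil>y\<rceil> - y)"
  proof (rule T.integrable_const_bound[where B = 1], intro AE_I2)
    show "norm (of_int \<lceil>y\<rceil> - y) \<le> 1" for y :: real
      unfolding real_norm_def abs_le_iff by linarith
  qed measurable
  have U_floor: "U x = U (of_int \<lfloor>x\<rfloor>)" for x :: real
  proof -
    have "AE s in G. \<exists>k::int. s = 1 * of_int k"
      using int by (rule eventually_mono) (auto elim!: Ints_cases)
    from U_lattice[OF _ this] show ?thesis by simp
  qed
  have "(\<lambda>n. \<integral>y. excess (real n - y) + (of_int \<lceil>y\<rceil> - y) / mean - excess (real n) \<partial>tail_law) \<longlonglongrightarrow> (\<integral>y. 0 \<partial>tail_law)"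
  proof (rule integral_dominated_convergence[where w = "\<lambda>_. 2 * excess_bound + 1 / mean"])
    show "AE y in tail_law. (\<lambda>n. excess (real n - y) + (of_int \<lceil>y\<rceil> - y) / mean - excess (real n)) \<longlonglongrightarrow> 0"
    proof (intro AE_I2)
      fix y :: real
      have "(\<lambda>n. excess (of_int \<lfloor>real n + - of_int \<lceil>y\<rceil>\<rfloor>) - excess (of_int \<lfloor>real n\<rfloor>)) \<longlonglongrightarrow> 0"
        by (rule filterlim_compose[OF lattice_increments[OF int span] filterlim_real_sequentially]) auto
      moreover have "eventually (\<lambda>n. excess (of_int \<lfloor>real n + - of_int \<lceil>y\<rceil>\<rfloor>) - excess (of_int \<lfloor>real n\<rfloor>)
          = excess (real n - y) + (of_int \<lceil>y\<rceil> - y) / mean - excess (real n)) sequentially"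
        using eventually_ge_at_top[of "nat \<lceil>y\<rceil>"]
      proof eventually_elim
        case (elim n)
        then have n: "real_of_int \<lceil>y\<rceil> \<le> real n" by linarith
        then have "y \<le> real n" by linarith
        have "real_of_int (int n - \<lceil>y\<rceil>) \<le> real n - y" "real n - y < real_of_int (int n - \<lceil>y\<rceil>) + 1"
          unfolding of_int_diff of_int_of_nat_eq by linarith+
        then have "\<lfloor>real n - y\<rfloor> = int n - \<lceil>y\<rceil>"
          by (rule floor_unique)
        then have fl: "real_of_int \<lfloor>real n - y\<rfloor> = real n - of_int \<lceil>y\<rceil>"
          by simp
        have "excess (real n - y) = U (real n - of_int \<lceil>y\<rceil>) - (real n - y) / mean"
          using \<open>y \<le> real n\<close> U_floor[of "real n - y"] by (simp add: excess_def fl)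
        moreover have "excess (real n - of_int \<lceil>y\<rceil>) = U (real n - of_int \<lceil>y\<rceil>) - (real n - of_int \<lceil>y\<rceil>) / mean"
          using n by (simp add: excess_def)
        moreover have "real_of_int \<lfloor>real n + - of_int \<lceil>y\<rceil>\<rfloor> = real n - of_int \<lceil>y\<rceil>"
          by simp
        ultimately show ?case by (simp add: diff_divide_distrib)
      qed
      ultimately show "(\<lambda>n. excess (real n - y) + (of_int \<lceil>y\<rceil> - y) / mean - excess (real n)) \<longlonglongrightarrow> 0"
        by (rule Lim_transform_eventually)
    qed
    fix n
    show "AE y in tail_law. norm (excess (real n - y) + (of_int \<lceil>y\<rceil> - y) / mean - excess (real n)) \<le> 2 * excess_bound + 1 / mean"
    proof (intro AE_I2)
      fix y :: real
      have "0 \<le> (of_int \<lceil>y\<rceil> - y) / mean" "(of_int \<lceil>y\<rceil> - y) / mean \<le> 1 / mean"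
        using mean_pos by (intro divide_nonneg_pos divide_right_mono; linarith)+
      then show "norm (excess (real n - y) + (of_int \<lceil>y\<rceil> - y) / mean - excess (real n)) \<le> 2 * excess_bound + 1 / mean"
        using abs_excess_le[of "real n - y"] abs_excess_le[of "real n"] unfolding real_norm_def by linarith
    qed
  qed auto
  moreover have "(\<integral>y. excess (real n - y) + (of_int \<lceil>y\<rceil> - y) / mean - excess (real n) \<partial>tail_law)
     = (\<integral>y. excess (real n - y) \<partial>tail_law) + 1 / 2 - excess (real n) * mean" for n
  proof -
    have "(\<integral>y. excess (real n - y) + (of_int \<lceil>y\<rceil> - y) / mean - excess (real n) \<partial>tail_law)
      = (\<integral>y. excess (real n - y) \<partial>tail_law) + (\<integral>y. (of_int \<lceil>y\<rceil> - y) / mean \<partial>tail_law) - (\<integral>y. excess (real n) \<partial>tail_law)"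
      using int_excess int_frac by (simp add: Bochner_Integration.integral_add Bochner_Integration.integral_diff del: Bochner_Integration.integral_divide)
    then show ?thesis
      using mean_pos by (simp add: tail_law_frac[OF int] measure_tail_law)
  qed
  ultimately have A: "(\<lambda>n. (\<integral>y. excess (real n - y) \<partial>tail_law) + 1 / 2 - excess (real n) * mean) \<longlonglongrightarrow> 0"
    by simp
  have B: "(\<lambda>n. (\<integral>y. excess (real n - y) \<partial>tail_law) + 1 / 2) \<longlonglongrightarrow> second_moment / (2 * mean) + 1 / 2"
    by (intro tendsto_add filterlim_compose[OF excess_tail_limit filterlim_real_sequentially] tendsto_const)
  have "(\<lambda>n. excess (real n)) \<longlonglongrightarrow> (second_moment / (2 * mean) + 1 / 2 - 0) / mean"
    using tendsto_divide[OF tendsto_diff[OF B A] tendsto_const[of mean]] mean_pos by simp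
  moreover have "(second_moment / (2 * mean) + 1 / 2 - 0) / mean = (second_moment + mean) / (2 * mean\<^sup>2)"
    using mean_pos by (simp add: field_simps power2_eq_square)
  ultimately show ?thesis by (simp only:)
qed

end

subsection \<open>Increments with positive drift\<close>

text \<open>Needed with an argument bounded above only. For x = - u < 0 the claim is
  \<open>1 \<le> (1 - u + u * u) * exp u\<close>, and already the quadratic Taylor polynomial of exp
  makes the product at least 1.\<close>

lemma exp_le_quadratic: "exp x \<le> 1 + x + x\<^sup>2" if "x \<le> 1" for x :: real
proof (cases "0 \<le> x")
  case True
  then show ?thesis using that by (rule exp_bound)
next
  case False
  define u where "u = - x"
  have "0 < u" using False by (simp add: u_def)
  have lower: "1 + u + u\<^sup>2 / 2 \<le> exp u"
    using \<open>0 < u\<close> by (intro exp_lower_Taylor_quadratic) simp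
  have "(1 - u + u\<^sup>2) * (1 + u + u\<^sup>2 / 2) = 1 + (u ^ 2 + u ^ 3 + u ^ 4) / 2"
    by (simp add: field_simps power2_eq_square power3_eq_cube power4_eq_xxxx)
  then have "1 \<le> (1 - u + u\<^sup>2) * (1 + u + u\<^sup>2 / 2)"
    using \<open>0 < u\<close> by simp
  also have "\<dots> \<le> (1 - u + u\<^sup>2) * exp u"
  proof (intro mult_left_mono lower)
    show "0 \<le> 1 - u + u\<^sup>2"
      using zero_le_power2[of "u - 1"] zero_le_power2[of u] \<open>0 < u\<close> by (simp add: power2_diff)
  qed
  finally have "exp (- u) \<le> 1 - u + u\<^sup>2"
    by (simp add: exp_minus field_simps)
  then show ?thesis by (simp add: u_def)
qed

locale increment_law = prob_space F for F :: "real measure" +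
  fixes r :: real
  assumes sets_increment [measurable_cong, simp]: "sets F = sets borel"
    and r_nonneg: "0 \<le> r"
    and lower: "AE y in F. - r \<le> y"
    and square_integrable: "integrable F (\<lambda>y. y\<^sup>2)"
    and drift_pos: "0 < (\<integral>y. y \<partial>F)"
begin

lemma space_increment [simp]: "space F = UNIV"
  using sets_eq_imp_space_eq[OF sets_increment] by simp

definition drift :: real where "drift = (\<integral>y. y \<partial>F)"

lemma increment_integrable: "integrable F (\<lambda>y. y)"
  using drift_pos not_integrable_integral_eq by fastforce

lemma exp_integrable: "0 \<le> \<theta> \<Longrightarrow> integrable F (\<lambda>y. exp (- \<theta> * y))"
proof (rule integrable_const_bound)
  assume "0 \<le> \<theta>"
  show "AE y in F. norm (exp (- \<theta> * y)) \<le> exp (\<theta> * r)"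
    using lower by eventually_elim (use \<open>0 \<le> \<theta>\<close> mult_left_mono[of "- r" _ \<theta>] in force)
qed measurable

lemma exp_moment_less_1: "\<exists>\<theta>>0. (\<integral>y. exp (- \<theta> * y) \<partial>F) < 1"
proof -
  define m2 where "m2 = (\<integral>y. y\<^sup>2 \<partial>F)"
  have m2: "0 \<le> m2" unfolding m2_def by simp
  \<comment> \<open>The first bound gives \<theta> r \<le> 1, so the quadratic estimate applies to -
    \<theta> y; the second gives \<theta> m2 < \<open>drift\<close>, so the linear term wins. Adding
    1 keeps both denominators positive.\<close>
  define \<theta> where "\<theta> = min (1 / (r + 1)) (drift / (m2 + 1))"
  have "0 < drift" using drift_pos by (simp add: drift_def)
  then have "0 < \<theta>" using r_nonneg m2 by (simp add: \<theta>_def)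
  have "\<theta> * (r + 1) \<le> 1" 
    using r_nonneg pos_le_divide_eq[of "r + 1" \<theta> 1] by (simp add: \<theta>_def)
  then have \<theta>r: "\<theta> * r \<le> 1" using \<open>0 < \<theta>\<close> by (simp add: distrib_left)
  have "\<theta> * (m2 + 1) \<le> drift"
    using m2 pos_le_divide_eq[of "m2 + 1" \<theta> drift] by (simp add: \<theta>_def)
  then have "\<theta> * m2 < drift" using \<open>0 < \<theta>\<close> by (simp add: distrib_left)
  have "(\<integral>y. exp (- \<theta> * y) \<partial>F) \<le> (\<integral>y. 1 - \<theta> * y + \<theta>\<^sup>2 * y\<^sup>2 \<partial>F)"
  proof (rule integral_mono_AE)
    show "AE y in F. exp (- \<theta> * y) \<le> 1 - \<theta> * y + \<theta>\<^sup>2 * y\<^sup>2"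
      using lower
    proof eventually_elim
      case (elim y)
      then have "- \<theta> * y \<le> 1" using \<theta>r \<open>0 < \<theta>\<close> mult_left_mono[of "- r" y \<theta>] by linarith
      from exp_le_quadratic[OF this] show ?case by (simp add: power_mult_distrib)
    qed
  qed (use exp_integrable[of \<theta>] \<open>0 < \<theta>\<close> increment_integrable square_integrable in auto)
  also have "\<dots> = 1 - \<theta> * drift + \<theta>\<^sup>2 * m2"
    using increment_integrable square_integrable by (simp add: drift_def m2_def prob_space[simplified])
  also have "\<dots> < 1"
    using mult_strict_left_mono[OF \<open>\<theta> * m2 < drift\<close> \<open>0 < \<theta>\<close>] by (simp add: power2_eq_square)
  finally show ?thesis using \<open>0 < \<theta>\<close> by blast
qed

text \<open>Any exponent with moment below 1 would do. Fixing one provides the weight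
  \<open>exp (rate * x)\<close> against which growth is measured from here on.\<close>

definition rate :: real where "rate = (SOME \<theta>. 0 < \<theta> \<and> (\<integral>y. exp (- \<theta> * y) \<partial>F) < 1)"
definition decay :: real where "decay = (\<integral>y. exp (- rate * y) \<partial>F)"

lemma rate_pos: "0 < rate" and decay_less_1: "decay < 1"
  using someI_ex[OF exp_moment_less_1[unfolded Bex_def]] unfolding rate_def decay_def by auto

lemma decay_nonneg: "0 \<le> decay"
  unfolding decay_def by simp

lemma nn_integral_exp: "(\<integral>\<^sup>+y. ennreal (exp (- rate * y)) \<partial>F) = ennreal decay"
  unfolding decay_def using exp_integrable[of rate] rate_pos by (intro nn_integral_eq_integral) auto

text \<open>The weight \<open>exp (rate * x)\<close> is an eigenfunction of averaging over one
  increment, with eigenvalue \<open>decay\<close> < 1; hence each averaging contracts the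
  bound.\<close>

lemma nn_integral_exp_bound:
  assumes "0 \<le> c" and le: "\<And>x. f x \<le> ennreal (c * exp (rate * x))"
  shows "(\<integral>\<^sup>+y. f (x - y) \<partial>F) \<le> ennreal (c * decay * exp (rate * x))"
proof -
  have "(\<integral>\<^sup>+y. f (x - y) \<partial>F) \<le> (\<integral>\<^sup>+y. ennreal (c * exp (rate * x)) * ennreal (exp (- rate * y)) \<partial>F)"
  proof (rule nn_integral_mono)
    fix y
    have "f (x - y) \<le> ennreal (c * exp (rate * (x - y)))" by (rule le)
    also have "c * exp (rate * (x - y)) = c * exp (rate * x) * exp (- rate * y)"
      by (simp add: algebra_simps flip: exp_add)
    also have "ennreal \<dots> = ennreal (c * exp (rate * x)) * ennreal (exp (- rate * y))"
      using \<open>0 \<le> c\<close> by (simp add: ennreal_mult)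
    finally show "f (x - y) \<le> ennreal (c * exp (rate * x)) * ennreal (exp (- rate * y))" .
  qed
  also have "\<dots> = ennreal (c * exp (rate * x)) * ennreal decay"
    by (subst nn_integral_cmult, measurable) (simp only: nn_integral_exp)
  finally show ?thesis
    using decay_nonneg \<open>0 \<le> c\<close> by (simp add: ennreal_mult[symmetric] ac_simps)
qed

lemma geometric_zero:
  fixes a :: ennreal
  assumes "\<And>n. a \<le> ennreal (c * decay ^ n)"
  shows "a = 0"
proof -
  have "(\<lambda>n. ennreal (c * decay ^ n)) \<longlonglongrightarrow> ennreal (c * 0)"
    using decay_nonneg decay_less_1 by (intro tendsto_ennrealI tendsto_mult LIMSEQ_realpow_zero) auto
  then have "a \<le> ennreal (c * 0)"
    using assms by (intro LIMSEQ_le_const) auto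
  then show ?thesis by simp
qed

text \<open>Each use of the equation multiplies the exponential bound by \<open>decay\<close>, so
  the bound can be made arbitrarily small at every x. Vanishing on the negatives keeps it valid
  after steps that leave the half-line.\<close>

lemma harmonic_zero:
  fixes w :: "real \<Rightarrow> real"
  assumes neg: "\<And>x. x < 0 \<Longrightarrow> w x = 0"
    and harmonic: "\<And>x. 0 \<le> x \<Longrightarrow> w x = (\<integral>y. w (x - y) \<partial>F)"
    and growth: "\<And>x. 0 \<le> x \<Longrightarrow> \<bar>w x\<bar> \<le> C * exp (rate * x)"
  shows "w x = 0"
proof -
  have "0 \<le> C" using growth[of 0] by simp
  have "ennreal \<bar>w x\<bar> \<le> ennreal (C * decay ^ n * exp (rate * x))" for n x
  proof (induction n arbitrary: x)
    case 0
    then show ?case using growth[of x] neg[of x] \<open>0 \<le> C\<close> by (cases "0 \<le> x") auto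
  next
    case (Suc n)
    show ?case
    proof (cases "0 \<le> x")
      case True
      \<comment> \<open>If the integrand is not integrable, the Bochner integral is 0 by convention
        and the bound is trivial.\<close>
      have "ennreal \<bar>w x\<bar> \<le> (\<integral>\<^sup>+y. ennreal \<bar>w (x - y)\<bar> \<partial>F)"
        unfolding harmonic[OF True]
        using integral_norm_bound_ennreal[of F "\<lambda>y. w (x - y)"]
        by (cases "integrable F (\<lambda>y. w (x - y))") (simp_all add: not_integrable_integral_eq)
      also have "\<dots> \<le> ennreal (C * decay ^ n * decay * exp (rate * x))"
        using \<open>0 \<le> C\<close> decay_nonneg by (intro nn_integral_exp_bound Suc.IH) auto
      finally show ?thesis by (simp add: ac_simps)
    qed (simp add: neg)
  qed
  then have "ennreal \<bar>w x\<bar> \<le> ennreal ((C * exp (rate * x)) * decay ^ n)" for n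
    by (simp add: ac_simps)
  then have "ennreal \<bar>w x\<bar> = 0" by (rule geometric_zero)
  then show ?thesis by (simp add: ennreal_eq_0_iff)
qed

text \<open>The probability \<open>P(S\<^sub>1 \<le> x, \<dots>, S\<^sub>n \<le> x)\<close>, computed by conditioning on the first step.\<close>

primrec survival :: "nat \<Rightarrow> real \<Rightarrow> ennreal" where
  "survival 0 x = indicator {0..} x"
| "survival (Suc n) x = indicator {0..} x * (\<integral>\<^sup>+y. survival n (x - y) \<partial>F)"

text \<open>For x \<ge> 0 this is the tail-sum formula for the mean of the first n at which the walk
  exceeds x.\<close>

definition passage_time :: "real \<Rightarrow> ennreal" where
  "passage_time x = (\<Sum>n. survival n x)"

lemma measurable_survival [measurable]: "survival n \<in> borel_measurable borel"
  by (induction n) (simp_all, measurable)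

lemma measurable_passage_time [measurable]: "passage_time \<in> borel_measurable borel"
  unfolding passage_time_def by measurable

lemma mono_survival: "x \<le> x' \<Longrightarrow> survival n x \<le> survival n x'"
proof (induction n arbitrary: x x')
  case (Suc n)
  then show ?case
    by (auto intro!: mult_mono nn_integral_mono simp: indicator_def)
qed (auto simp: indicator_def)

lemma mono_passage_time: "x \<le> x' \<Longrightarrow> passage_time x \<le> passage_time x'"
  unfolding passage_time_def by (intro suminf_le mono_survival) auto

lemma survival_neg: "x < 0 \<Longrightarrow> survival n x = 0"
  by (cases n) auto

lemma passage_time_neg: "x < 0 \<Longrightarrow> passage_time x = 0"
  by (simp add: passage_time_def survival_neg)

lemma survival_le: "survival n x \<le> ennreal (decay ^ n * exp (rate * x))"
proof (induction n arbitrary: x)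
  case 0
  then show ?case using rate_pos by (auto simp: indicator_def simp flip: ennreal_1)
next
  case (Suc n)
  have "survival (Suc n) x \<le> (\<integral>\<^sup>+y. survival n (x - y) \<partial>F)"
    by (simp add: indicator_def)
  also have "\<dots> \<le> ennreal (decay ^ n * decay * exp (rate * x))"
    using decay_nonneg by (intro nn_integral_exp_bound Suc.IH) auto
  finally show ?case by (simp add: ac_simps)
qed

lemma passage_time_le: "passage_time x \<le> ennreal (1 / (1 - decay) * exp (rate * x))"
proof -
  have "passage_time x \<le> (\<Sum>n. ennreal (decay ^ n * exp (rate * x)))"
    unfolding passage_time_def by (intro suminf_le survival_le) auto
  also have "\<dots> = ennreal (\<Sum>n. decay ^ n * exp (rate * x))"
    using decay_nonneg decay_less_1 by (intro suminf_ennreal2 summable_mult2 summable_geometric) auto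
  also have "(\<Sum>n. decay ^ n * exp (rate * x)) = 1 / (1 - decay) * exp (rate * x)"
    using decay_nonneg decay_less_1 by (subst suminf_mult2[symmetric]) (auto simp: suminf_geometric)
  finally show ?thesis .
qed

lemma passage_time_finite: "passage_time x < \<infinity>"
  using passage_time_le[of x] by (rule le_less_trans) simp

lemma passage_time_equation:
  assumes "0 \<le> x"
  shows "passage_time x = 1 + (\<integral>\<^sup>+y. passage_time (x - y) \<partial>F)"
proof -
  have "passage_time x = (\<Sum>n. survival (Suc n) x) + survival 0 x"
    unfolding passage_time_def
    using suminf_offset[OF summableI, of "\<lambda>n. survival n x" 1] by (simp del: survival.simps add: add.commute)
  also have "(\<Sum>n. survival (Suc n) x) = (\<integral>\<^sup>+y. passage_time (x - y) \<partial>F)"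
    using assms unfolding passage_time_def by (simp add: nn_integral_suminf)
  finally show ?thesis using assms by (simp add: add.commute)
qed

end

subsection \<open>The walk up to its ladder period\<close>

lemma (in prob_space) nn_integral_indep:
  assumes indep: "indep_var S X T Y" and h: "h \<in> borel_measurable (S \<Otimes>\<^sub>M T)"
  shows "(\<integral>\<^sup>+w. h (X w, Y w) \<partial>M) = (\<integral>\<^sup>+w. (\<integral>\<^sup>+w'. h (X w, Y w') \<partial>M) \<partial>M)"
proof -
  have X [measurable]: "X \<in> measurable M S" and Y [measurable]: "Y \<in> measurable M T"
    using indep by (auto dest: indep_var_rv1 indep_var_rv2)
  interpret Y: prob_space "distr M T Y" by (rule prob_space_distr[OF Y])
  have pair: "distr M S X \<Otimes>\<^sub>M distr M T Y = distr M (S \<Otimes>\<^sub>M T) (\<lambda>w. (X w, Y w))"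
    using indep unfolding indep_var_distribution_eq by simp
  have "(\<integral>\<^sup>+w. h (X w, Y w) \<partial>M) = (\<integral>\<^sup>+z. h z \<partial>distr M (S \<Otimes>\<^sub>M T) (\<lambda>w. (X w, Y w)))"
    using h by (subst nn_integral_distr) auto
  also have "\<dots> = (\<integral>\<^sup>+x. (\<integral>\<^sup>+y. h (x, y) \<partial>distr M T Y) \<partial>distr M S X)"
    unfolding pair[symmetric] using h by (intro Y.nn_integral_fst[symmetric]) simp
  also have "\<dots> = (\<integral>\<^sup>+w. (\<integral>\<^sup>+y. h (X w, y) \<partial>distr M T Y) \<partial>M)"
    using h by (subst nn_integral_distr) (auto intro!: Y.borel_measurable_nn_integral)
  also have "\<dots> = (\<integral>\<^sup>+w. (\<integral>\<^sup>+w'. h (X w, Y w') \<partial>M) \<partial>M)"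
    using h by (intro nn_integral_cong nn_integral_distr Y) (auto dest: measurable_space[OF X])
  finally show ?thesis .
qed

locale demand_walk = prob_space M for M :: "'a measure" +
  fixes D :: "'a \<Rightarrow> real" and Ds :: "nat \<Rightarrow> 'a \<Rightarrow> real" and r :: real
  assumes D_measurable [measurable]: "D \<in> borel_measurable M"
    and D_nonneg: "AE w in M. 0 \<le> D w"
    and D_square: "integrable M (\<lambda>w. (D w)\<^sup>2)"
    and Ds_indep: "indep_vars (\<lambda>_. borel) Ds UNIV"
    and Ds_distr: "\<And>t. distr M borel (Ds t) = distr M borel D"
    and order_nonneg: "0 \<le> r" and order_less: "r < expectation D"
begin

lemma Ds_measurable [measurable]: "Ds t \<in> borel_measurable M"
  using Ds_indep by (auto simp: indep_vars_def)

abbreviation increment :: "real measure" where "increment \<equiv> distr M borel (\<lambda>w. D w - r)"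

lemma D_integrable: "integrable M D"
  using order_less order_nonneg not_integrable_integral_eq by fastforce

lemma AE_increment: "(AE y in increment. P y) \<longleftrightarrow> (AE w in M. P (D w - r))" if "Measurable.pred borel P"
  using that by (subst AE_distr_iff) auto

lemma integral_increment: "(\<integral>y. y \<partial>increment) = expectation D - r"
proof -
  have "(\<integral>y. y \<partial>increment) = expectation (\<lambda>w. D w - r)"
    by (rule integral_distr) simp_all
  also have "\<dots> = expectation D - r"
    using D_integrable by (simp add: prob_space)
  finally show ?thesis .
qed

sublocale F: increment_law increment r
proof (intro increment_law.intro increment_law_axioms.intro)
  show "prob_space increment" by (rule prob_space_distr) simp
  show "AE y in increment. - r \<le> y"
    using D_nonneg by (subst AE_increment) auto
  have "integrable M (\<lambda>w. (D w)\<^sup>2 - 2 * r * D w + r\<^sup>2)"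
    using D_square D_integrable by auto
  then have "integrable M (\<lambda>w. (D w - r)\<^sup>2)"
    by (simp add: power2_diff algebra_simps)
  then show "integrable increment (\<lambda>y. y\<^sup>2)"
    by (subst integrable_distr_eq) auto
  show "0 < (\<integral>y. y \<partial>increment)"
    using order_less by (simp add: integral_increment)
qed (simp_all add: order_nonneg)

lemma drift_eq: "F.drift = expectation D - r"
  by (simp add: F.drift_def integral_increment)

lemma distr_step: "distr M borel (\<lambda>w. Ds t w - r) = increment"
proof -
  have "distr M borel (\<lambda>w. Ds t w - r) = distr (distr M borel (Ds t)) borel (\<lambda>y. y - r)"
    by (subst distr_distr) (auto simp: comp_def)
  also have "\<dots> = increment"
    unfolding Ds_distr by (subst distr_distr) (auto simp: comp_def)
  finally show ?thesis .
qed

lemma measurable_walk [measurable]: "walk Ds r t \<in> borel_measurable M"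
  unfolding walk_def by measurable

lemma walk_0 [simp]: "walk Ds r 0 w = 0"
  by (simp add: walk_def)

lemma walk_Suc: "walk Ds r (Suc n) w = walk Ds r n w + (Ds (Suc n) w - r)"
  by (simp add: walk_def)

text \<open>With \<tau> the ladder period, this is the event \<tau> > n. The inequality is strict
  because the ladder is weak.\<close>

definition stay :: "nat \<Rightarrow> 'a set" where
  "stay n = {w \<in> space M. \<forall>k\<in>{1..n}. walk Ds r k w < 0}"

lemma stay_0: "stay 0 = space M"
  by (simp add: stay_def)

lemma stay_Suc: "w \<in> stay (Suc n) \<longleftrightarrow> w \<in> stay n \<and> walk Ds r (Suc n) w < 0"
  by (auto simp: stay_def le_Suc_eq)

lemma measurable_stay [measurable]: "stay n \<in> events"
  unfolding stay_def by measurable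

lemma walk_stay: "w \<in> stay n \<Longrightarrow> walk Ds r n w \<le> 0"
  by (cases n) (auto simp: stay_Suc)

text \<open>Both \<open>stay n\<close> and the position at time n are functions of the demands 1 to
  n, which are independent of demand n + 1; so the next increment can be integrated out.\<close>

lemma nn_integral_step:
  assumes g [measurable]: "g \<in> borel_measurable borel"
  shows "(\<integral>\<^sup>+w. g (walk Ds r (Suc n) w) * indicator (stay n) w \<partial>M)
    = (\<integral>\<^sup>+w. (\<integral>\<^sup>+y. g (walk Ds r n w + y) \<partial>increment) * indicator (stay n) w \<partial>M)"
proof -
  let ?S = "PiM {1..n} (\<lambda>_. borel) :: (nat \<Rightarrow> real) measure"
  let ?X = "\<lambda>w. restrict (\<lambda>i. Ds i w) {1..n}"
  let ?T = "PiM {Suc n} (\<lambda>_. borel) :: (nat \<Rightarrow> real) measure"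
  let ?Y = "\<lambda>w. restrict (\<lambda>i. Ds i w) {Suc n}"
  let ?s = "\<lambda>k a. \<Sum>i=1..k. a i - r"
  define A where "A = {a \<in> space ?S. \<forall>k\<in>{1..n}. ?s k a < 0}"
  have s_meas [measurable]: "(\<lambda>a. ?s k a) \<in> borel_measurable ?S" if "k \<le> n" for k
    using that by (intro borel_measurable_sum borel_measurable_diff measurable_component_singleton) auto
  have [measurable]: "A \<in> sets ?S"
    unfolding A_def by (intro sets.sets_Collect_finite_All borel_measurable_less s_meas) auto
  have indep: "indep_var ?S ?X ?T ?Y"
    by (rule indep_var_restrict[OF Ds_indep]) auto
  have s: "?s k (?X w) = walk Ds r k w" if "k \<le> n" for k w
    using that unfolding walk_def by (intro sum.cong) auto
  have A: "indicator A (?X w) = (indicator (stay n) w :: ennreal)" if "w \<in> space M" for w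
    using that s by (auto simp: indicator_def A_def stay_def space_PiM)
  define h where "h z = g (?s n (fst z) + (snd z (Suc n) - r)) * indicator A (fst z)"
    for z :: "(nat \<Rightarrow> real) \<times> (nat \<Rightarrow> real)"
  have "(\<lambda>z. ?s n (fst z) + (snd z (Suc n) - r)) \<in> borel_measurable (?S \<Otimes>\<^sub>M ?T)"
    by (intro borel_measurable_add borel_measurable_diff measurable_compose[OF measurable_fst s_meas]
        measurable_compose[OF measurable_snd measurable_component_singleton]) auto
  then have "h \<in> borel_measurable (?S \<Otimes>\<^sub>M ?T)"
    unfolding h_def by measurable
  from nn_integral_indep[OF indep this]
  have "(\<integral>\<^sup>+w. g (walk Ds r n w + (Ds (Suc n) w - r)) * indicator A (?X w) \<partial>M)
     = (\<integral>\<^sup>+w. (\<integral>\<^sup>+w'. g (walk Ds r n w + (Ds (Suc n) w' - r)) * indicator A (?X w) \<partial>M) \<partial>M)"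
    by (simp only: h_def fst_conv snd_conv s order_refl restrict_apply' singletonI)
  moreover have "(\<integral>\<^sup>+w'. g (walk Ds r n w + (Ds (Suc n) w' - r)) * indicator A (?X w) \<partial>M)
     = (\<integral>\<^sup>+y. g (walk Ds r n w + y) \<partial>increment) * indicator A (?X w)" for w
    unfolding distr_step[of "Suc n", symmetric]
    by (subst nn_integral_distr) (auto simp: nn_integral_multc)
  moreover have "(\<integral>\<^sup>+w. f w * indicator (stay n) w \<partial>M) = (\<integral>\<^sup>+w. f w * indicator A (?X w) \<partial>M)" for f
    by (intro nn_integral_cong) (simp only: A)
  ultimately show ?thesis
    by (simp only: walk_Suc)
qed

section \<open>The killed walk and the Wiener--Hopf factorisation\<close>

definition killed :: "nat \<Rightarrow> (real \<Rightarrow> ennreal) \<Rightarrow> ennreal" where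
  "killed n f = (\<integral>\<^sup>+w. f (walk Ds r n w) * indicator (stay n) w \<partial>M)"

text \<open>Integration against the occupation measure of the walk strictly before the ladder period.\<close>

definition occupation :: "(real \<Rightarrow> ennreal) \<Rightarrow> ennreal" where
  "occupation f = (\<Sum>n. killed n f)"

text \<open>The contribution of \<tau> = n + 1 to the mean of f at the ladder height; the index
  counts the steps before the last one.\<close>

definition first_passage :: "nat \<Rightarrow> (real \<Rightarrow> ennreal) \<Rightarrow> ennreal" where
  "first_passage n f = (\<integral>\<^sup>+w. f (walk Ds r (Suc n) w) * indicator (stay n - stay (Suc n)) w \<partial>M)"

lemma killed_cong:
  assumes "\<And>s. s \<le> 0 \<Longrightarrow> f s = g s"
  shows "killed n f = killed n g"
  unfolding killed_def using assms walk_stay by (intro nn_integral_cong) (auto simp: indicator_def)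

lemma killed_mono:
  assumes "\<And>s. s \<le> 0 \<Longrightarrow> f s \<le> g s"
  shows "killed n f \<le> killed n g"
  unfolding killed_def using assms walk_stay by (intro nn_integral_mono) (auto simp: indicator_def)

lemma occupation_cong: "(\<And>s. s \<le> 0 \<Longrightarrow> f s = g s) \<Longrightarrow> occupation f = occupation g"
  unfolding occupation_def by (intro suminf_cong killed_cong)

lemma occupation_mono: "(\<And>s. s \<le> 0 \<Longrightarrow> f s \<le> g s) \<Longrightarrow> occupation f \<le> occupation g"
  unfolding occupation_def by (intro suminf_le killed_mono) auto

lemma occupation_add:
  assumes [measurable]: "f \<in> borel_measurable borel" "g \<in> borel_measurable borel"
  shows "occupation (\<lambda>s. f s + g s) = occupation f + occupation g"
  unfolding occupation_def killed_def distrib_right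
  by (subst nn_integral_add) (auto simp: suminf_add)

lemma occupation_cmult:
  assumes [measurable]: "f \<in> borel_measurable borel"
  shows "occupation (\<lambda>s. c * f s) = c * occupation f"
  unfolding occupation_def killed_def mult.assoc
  by (subst nn_integral_cmult) auto

text \<open>A walk not yet stopped either survives the next step or reaches its ladder period there.
  Summing over n yields the factorisation.\<close>

lemma killed_step:
  assumes [measurable]: "f \<in> borel_measurable borel"
  shows "killed n (\<lambda>s. \<integral>\<^sup>+y. f (s + y) \<partial>increment) = killed (Suc n) f + first_passage n f"
proof -
  have "killed n (\<lambda>s. \<integral>\<^sup>+y. f (s + y) \<partial>increment) = (\<integral>\<^sup>+w. f (walk Ds r (Suc n) w) * indicator (stay n) w \<partial>M)"
    unfolding killed_def by (rule nn_integral_step[symmetric]) simp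
  also have "\<dots> = (\<integral>\<^sup>+w. f (walk Ds r (Suc n) w) * indicator (stay (Suc n)) w
      + f (walk Ds r (Suc n) w) * indicator (stay n - stay (Suc n)) w \<partial>M)"
    by (intro nn_integral_cong) (auto simp: indicator_def stay_Suc)
  also have "\<dots> = killed (Suc n) f + first_passage n f"
    unfolding killed_def first_passage_def by (rule nn_integral_add) measurable
  finally show ?thesis .
qed

text \<open>One step multiplies the exponential weight by \<open>decay\<close> on average, and
  killing only decreases it. On s \<le> 0 the weight is at least 1, so \<tau> has a geometric
  tail.\<close>

lemma killed_exp: "killed n (\<lambda>s. ennreal (exp (- F.rate * s))) \<le> ennreal (F.decay ^ n)"
proof (induction n)
  case 0
  show ?case by (simp add: killed_def stay_0 emeasure_space_1)
next
  case (Suc n)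
  let ?e = "\<lambda>s. ennreal (exp (- F.rate * s))"
  have "killed (Suc n) ?e \<le> killed n (\<lambda>s. \<integral>\<^sup>+y. ?e (s + y) \<partial>increment)"
    by (subst killed_step) auto
  also have "\<dots> = killed n (\<lambda>s. ennreal F.decay * ?e s)"
  proof (rule killed_cong)
    fix s :: real
    have "(\<integral>\<^sup>+y. ?e (s + y) \<partial>increment) = (\<integral>\<^sup>+y. ?e s * ?e y \<partial>increment)"
      by (intro nn_integral_cong) (simp add: ennreal_mult[symmetric] distrib_left flip: exp_add)
    also have "\<dots> = ?e s * ennreal F.decay"
      by (subst nn_integral_cmult, measurable) (simp only: F.nn_integral_exp)
    finally show "(\<integral>\<^sup>+y. ?e (s + y) \<partial>increment) = ennreal F.decay * ?e s"
      by (simp add: ac_simps)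
  qed
  also have "\<dots> = ennreal F.decay * killed n ?e"
    unfolding killed_def mult.assoc by (subst nn_integral_cmult) auto
  also have "\<dots> \<le> ennreal F.decay * ennreal (F.decay ^ n)"
    by (intro mult_left_mono Suc.IH) simp
  also have "\<dots> = ennreal (F.decay ^ Suc n)"
    using F.decay_nonneg by (simp add: ennreal_mult)
  finally show ?case .
qed

lemma occupation_exp_finite: "occupation (\<lambda>s. ennreal (exp (- F.rate * s))) < \<infinity>"
proof -
  have "occupation (\<lambda>s. ennreal (exp (- F.rate * s))) \<le> (\<Sum>n. ennreal (F.decay ^ n))"
    unfolding occupation_def by (intro suminf_le killed_exp) auto
  also have "\<dots> < \<infinity>"
    using F.decay_nonneg F.decay_less_1 by (subst suminf_ennreal2) (auto intro!: summable_geometric)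
  finally show ?thesis .
qed

lemma occupation_finite:
  assumes "0 \<le> c" "\<And>s. s \<le> 0 \<Longrightarrow> f s \<le> ennreal (c * exp (- F.rate * s))"
  shows "occupation f < \<infinity>"
proof -
  have "occupation f \<le> occupation (\<lambda>s. ennreal c * ennreal (exp (- F.rate * s)))"
    using assms by (intro occupation_mono) (auto simp: ennreal_mult)
  also have "\<dots> = ennreal c * occupation (\<lambda>s. ennreal (exp (- F.rate * s)))"
    by (rule occupation_cmult) measurable
  also have "\<dots> < \<infinity>"
    using occupation_exp_finite by (simp add: ennreal_mult_less_top)
  finally show ?thesis .
qed

lemma AE_leaves: "AE w in M. \<exists>n. w \<notin> stay n"
proof -
  have "emeasure M (\<Inter>n. stay n) \<le> ennreal (1 * F.decay ^ n)" for n
  proof -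
    have "emeasure M (\<Inter>n. stay n) \<le> emeasure M (stay n)"
      by (intro emeasure_mono) auto
    also have "\<dots> = (\<integral>\<^sup>+w. 1 * indicator (stay n) w \<partial>M)"
      by simp
    also have "\<dots> = killed n (\<lambda>_. 1)" by (simp add: killed_def)
    also have "\<dots> \<le> killed n (\<lambda>s. ennreal (exp (- F.rate * s)))"
      using F.rate_pos by (intro killed_mono) (auto simp: mult_nonneg_nonpos simp flip: ennreal_1)
    also have "\<dots> \<le> ennreal (F.decay ^ n)" by (rule killed_exp)
    finally show ?thesis by simp
  qed
  then have "emeasure M (\<Inter>n. stay n) = 0" by (rule F.geometric_zero)
  then have "(\<Inter>n. stay n) \<in> null_sets M" by (auto simp: null_sets_def)
  then show ?thesis by (rule AE_I') auto
qed

lemma ladder_period_eq: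
  assumes "w \<in> stay n" "w \<notin> stay (Suc n)"
  shows "ladder_period Ds r w = Suc n"
proof -
  have "0 \<le> walk Ds r (Suc n) w" using assms by (auto simp: stay_Suc)
  moreover have "Suc n \<le> k" if "0 < k" "0 \<le> walk Ds r k w" for k
  proof (rule ccontr)
    assume "\<not> Suc n \<le> k"
    then have "k \<in> {1..n}" using that by simp
    then have "walk Ds r k w < 0" using assms(1) unfolding stay_def by blast
    then show False using that by simp
  qed
  ultimately show ?thesis
    unfolding ladder_period_def by (intro cInf_eq_minimum) auto
qed

lemma measurable_ladder_height [measurable]: "ladder_height Ds r \<in> borel_measurable M"
proof -
  have [measurable]: "ladder_period Ds r \<in> measurable M (count_space UNIV)"
    unfolding ladder_period_def Inf_nat_def mem_Collect_eq by measurable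
  show ?thesis
    unfolding ladder_height_def
    by (rule measurable_compose_countable[where f = "\<lambda>n w. walk Ds r n w" and g = "ladder_period Ds r"]) measurable
qed

lemma exit_step:
  assumes "w \<in> space M" "\<exists>n. w \<notin> stay n"
  shows "\<exists>n. w \<in> stay n \<and> w \<notin> stay (Suc n)"
proof (rule ccontr)
  assume *: "\<not> ?thesis"
  have "w \<in> stay n" for n
    by (induction n) (use * assms in \<open>auto simp: stay_0\<close>)
  then show False using assms by blast
qed

lemma stay_antimono: "n \<le> m \<Longrightarrow> stay m \<subseteq> stay n"
  by (auto simp: stay_def)

text \<open>Splitting by the value of \<tau>: exactly one index contributes, except on the null
  event where the walk stays negative and \<open>ladder_period\<close> has only a conventional
  value.\<close>

lemma nn_integral_ladder_height:
  assumes [measurable]: "f \<in> borel_measurable borel"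
  shows "(\<integral>\<^sup>+w. f (ladder_height Ds r w) \<partial>M) = (\<Sum>n. first_passage n f)"
proof -
  have "(\<Sum>n. first_passage n f) = (\<integral>\<^sup>+w. (\<Sum>n. f (walk Ds r (Suc n) w) * indicator (stay n - stay (Suc n)) w) \<partial>M)"
    unfolding first_passage_def by (rule nn_integral_suminf[symmetric]) measurable
  also have "\<dots> = (\<integral>\<^sup>+w. f (ladder_height Ds r w) \<partial>M)"
  proof (rule nn_integral_cong_AE)
    show "AE w in M. (\<Sum>n. f (walk Ds r (Suc n) w) * indicator (stay n - stay (Suc n)) w) = f (ladder_height Ds r w)"
      using AE_leaves AE_space
    proof eventually_elim
      case (elim w)
      then obtain n where n: "w \<in> stay n" "w \<notin> stay (Suc n)"
        using exit_step by blast
      have "w \<notin> stay m - stay (Suc m)" if "m \<noteq> n" for m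
        using n that stay_antimono[of "Suc m" n] stay_antimono[of "Suc n" m] by (auto simp: neq_iff Suc_le_eq)
      then have "(\<Sum>m. f (walk Ds r (Suc m) w) * indicator (stay m - stay (Suc m)) w)
        = (\<Sum>m\<in>{n}. f (walk Ds r (Suc m) w) * indicator (stay m - stay (Suc m)) w)"
        by (intro suminf_finite) (auto simp: indicator_def)
      then show ?case
        using n by (simp add: ladder_height_def ladder_period_eq)
    qed
  qed
  finally show ?thesis ..
qed

abbreviation ladder :: "real measure" where "ladder \<equiv> distr M borel (ladder_height Ds r)"

text \<open>Wiener--Hopf factorisation in additive form.\<close>

lemma occupation_identity:
  assumes [measurable]: "f \<in> borel_measurable borel"
  shows "occupation (\<lambda>s. \<integral>\<^sup>+y. f (s + y) \<partial>increment) + f 0 = occupation f + (\<integral>\<^sup>+z. f z \<partial>ladder)"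
proof -
  have "occupation (\<lambda>s. \<integral>\<^sup>+y. f (s + y) \<partial>increment) = (\<Sum>n. killed (Suc n) f) + (\<Sum>n. first_passage n f)"
    unfolding occupation_def by (simp add: killed_step suminf_add)
  moreover have "occupation f = (\<Sum>n. killed (Suc n) f) + killed 0 f"
    unfolding occupation_def
    using suminf_offset[OF summableI, of "\<lambda>n. killed n f" 1] by (simp add: add.commute)
  moreover have "killed 0 f = f 0"
    by (simp add: killed_def stay_0 nn_integral_cmult emeasure_space_1 cong: nn_integral_cong)
  moreover have "(\<integral>\<^sup>+z. f z \<partial>ladder) = (\<Sum>n. first_passage n f)"
    by (subst nn_integral_distr) (auto simp: nn_integral_ladder_height)
  ultimately show ?thesis by (simp add: ac_simps)
qed


text \<open>The total mass of the occupation measure is the sum of the probabilities of \<tau> > n,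
  that is, the mean of \<tau>.\<close>

definition ladder_epochs :: ennreal where "ladder_epochs = occupation (\<lambda>_. 1)"

lemma ladder_epochs_finite: "ladder_epochs < \<infinity>"
  unfolding ladder_epochs_def using F.rate_pos
  by (intro occupation_finite[where c = 1]) (auto simp: mult_nonneg_nonpos simp flip: ennreal_1)

lemma ladder_epochs_ge_1: "1 \<le> ladder_epochs"
proof -
  have "1 = killed 0 (\<lambda>_. 1)" by (simp add: killed_def stay_0 emeasure_space_1)
  also have "\<dots> = (\<Sum>n\<in>{0}. killed n (\<lambda>_. 1))" by simp
  also have "\<dots> \<le> ladder_epochs"
    unfolding ladder_epochs_def occupation_def by (intro sum_le_suminf) auto
  finally show ?thesis .
qed

lemma occupation_const: "occupation (\<lambda>_. c) = c * ladder_epochs"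
  using occupation_cmult[of "\<lambda>_. 1" c] by (simp add: ladder_epochs_def)

lemma AE_ladder: "(AE z in ladder. P z) \<longleftrightarrow> (AE w in M. P (ladder_height Ds r w))" if "Measurable.pred borel P"
  using that by (subst AE_distr_iff) auto

lemma ladder_nonneg: "AE w in M. 0 \<le> ladder_height Ds r w"
  using AE_leaves AE_space
proof eventually_elim
  case (elim w)
  then obtain n where "w \<in> stay n" "w \<notin> stay (Suc n)" using exit_step by blast
  then show ?case by (auto simp: ladder_height_def ladder_period_eq stay_Suc)
qed

lemma occupation_nonpos: "occupation (\<lambda>s. ennreal (max s 0)) = 0"
proof -
  have "occupation (\<lambda>s. ennreal (max s 0)) = occupation (\<lambda>_. 0)"
    by (rule occupation_cong) simp
  then show ?thesis by (simp add: occupation_const)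
qed

text \<open>Wald's identity, obtained from the factorisation applied to positive and negative parts.\<close>

lemma nn_integral_ladder: "(\<integral>\<^sup>+z. ennreal z \<partial>ladder) = ennreal F.drift * ladder_epochs"
proof -
  let ?p = "\<lambda>s. ennreal (max s 0)" and ?n = "\<lambda>s. ennreal (max (- s) 0)"
  have int: "integrable increment (\<lambda>y. max (s + y) 0)" "integrable increment (\<lambda>y. max (- (s + y)) 0)" for s
    using F.increment_integrable by (auto intro!: Bochner_Integration.integrable_max)
  have eq: "(\<integral>\<^sup>+y. ?p (s + y) \<partial>increment) + ?n s = (\<integral>\<^sup>+y. ?n (s + y) \<partial>increment) + ennreal F.drift" if "s \<le> 0" for s
  proof -
    have "(\<integral>y. max (s + y) 0 \<partial>increment) = (\<integral>y. max (- (s + y)) 0 + (s + y) \<partial>increment)"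
      by (intro Bochner_Integration.integral_cong) (auto simp: max_def)
    also have "\<dots> = (\<integral>y. max (- (s + y)) 0 \<partial>increment) + (s + F.drift)"
      using int(2)[of s] F.increment_integrable by (simp add: F.drift_def F.prob_space[simplified])
    finally have "(\<integral>y. max (s + y) 0 \<partial>increment) + max (- s) 0 = (\<integral>y. max (- (s + y)) 0 \<partial>increment) + F.drift"
      using that by simp
    then have "ennreal (\<integral>y. max (s + y) 0 \<partial>increment) + ennreal (max (- s) 0)
       = ennreal (\<integral>y. max (- (s + y)) 0 \<partial>increment) + ennreal F.drift"
      using F.drift_pos by (subst (1 2) ennreal_plus[symmetric]) (auto simp: F.drift_def)
    then show ?thesis
      using int[of s] by (subst (1 2) nn_integral_eq_integral) auto
  qed
  \<comment> \<open>The ladder height has no negative part, and the walk before \<tau> has no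
    positive part, so one term drops out in each application of the factorisation.\<close>
  have "(\<integral>\<^sup>+z. ?n z \<partial>ladder) = (\<integral>\<^sup>+w. 0 \<partial>M)"
    using ladder_nonneg
    by (subst nn_integral_distr, simp, simp, intro nn_integral_cong_AE) (auto elim!: eventually_mono simp: ennreal_neg)
  with occupation_identity[of ?n]
  have neg: "occupation (\<lambda>s. \<integral>\<^sup>+y. ?n (s + y) \<partial>increment) = occupation ?n" by simp
  have pos: "occupation (\<lambda>s. \<integral>\<^sup>+y. ?p (s + y) \<partial>increment) = (\<integral>\<^sup>+z. ?p z \<partial>ladder)"
    using occupation_identity[of ?p] unfolding occupation_nonpos by simp
  have "(\<integral>\<^sup>+z. ?p z \<partial>ladder) + occupation ?n = occupation (\<lambda>s. (\<integral>\<^sup>+y. ?p (s + y) \<partial>increment) + ?n s)"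
    unfolding pos[symmetric] by (intro occupation_add[symmetric]) measurable
  also have "\<dots> = occupation (\<lambda>s. (\<integral>\<^sup>+y. ?n (s + y) \<partial>increment) + ennreal F.drift)"
    by (rule occupation_cong) (rule eq)
  also have "\<dots> = occupation ?n + ennreal F.drift * ladder_epochs"
    by (subst occupation_add) (measurable, simp only: neg occupation_const)
  finally have "occupation ?n + (\<integral>\<^sup>+z. ?p z \<partial>ladder) = occupation ?n + ennreal F.drift * ladder_epochs"
    by (simp add: add.commute)
  \<comment> \<open>Finiteness permits the cancellation. The factor \<open>1 / F.rate\<close> comes
    from t \<le> exp t at t = - rate s.\<close>
  moreover have "occupation ?n < \<infinity>"
  proof (rule occupation_finite[where c = "1 / F.rate"])
    fix s :: real assume "s \<le> 0"
    have "- s \<le> 1 / F.rate * exp (- F.rate * s)"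
      using exp_ge_add_one_self[of "- F.rate * s"] F.rate_pos by (simp add: field_simps)
    then show "?n s \<le> ennreal (1 / F.rate * exp (- F.rate * s))"
      using \<open>s \<le> 0\<close> by (intro ennreal_leI) simp
  qed (use F.rate_pos in simp)
  ultimately have "(\<integral>\<^sup>+z. ?p z \<partial>ladder) = ennreal F.drift * ladder_epochs"
    by (auto simp: ennreal_add_left_cancel)
  moreover have "ennreal (max z 0) = ennreal z" for z
    by (cases "0 \<le> z") (auto simp: ennreal_neg)
  ultimately show ?thesis by simp
qed

text \<open>Before \<tau> the walk is at or below 0, so the overshoot is at most the last increment.
  The factorisation for the squared positive part thus bounds the second moment of the ladder height
  by the mean of \<tau> times that of the squared increment.\<close>

lemma ladder_square_finite: "(\<integral>\<^sup>+z. ennreal (z\<^sup>2) \<partial>ladder) < \<infinity>"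
proof -
  let ?q = "\<lambda>s. ennreal ((max s 0)\<^sup>2)"
  have "(\<integral>\<^sup>+z. ennreal (z\<^sup>2) \<partial>ladder) = (\<integral>\<^sup>+z. ?q z \<partial>ladder)"
    using ladder_nonneg
    by (subst (1 2) nn_integral_distr) (auto intro!: nn_integral_cong_AE elim!: eventually_mono)
  also have "\<dots> \<le> occupation ?q + (\<integral>\<^sup>+z. ?q z \<partial>ladder)" by simp
  also have "\<dots> = occupation (\<lambda>s. \<integral>\<^sup>+y. ?q (s + y) \<partial>increment) + ?q 0"
    by (rule occupation_identity[symmetric]) measurable
  also have "\<dots> = occupation (\<lambda>s. \<integral>\<^sup>+y. ?q (s + y) \<partial>increment)" by simp
  also have "\<dots> \<le> occupation (\<lambda>_. \<integral>\<^sup>+y. ennreal (y\<^sup>2) \<partial>increment)"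
  proof (intro occupation_mono nn_integral_mono ennreal_leI)
    fix s y :: real assume "s \<le> 0"
    then have "(max (s + y) 0)\<^sup>2 \<le> \<bar>y\<bar>\<^sup>2" by (intro power_mono) auto
    then show "(max (s + y) 0)\<^sup>2 \<le> y\<^sup>2" by simp
  qed
  also have "\<dots> = (\<integral>\<^sup>+y. ennreal (y\<^sup>2) \<partial>increment) * ladder_epochs" by (rule occupation_const)
  also have "\<dots> < \<infinity>"
    using ladder_epochs_finite F.square_integrable
    by (subst nn_integral_eq_integral) (auto simp: ennreal_mult_less_top)
  finally show ?thesis .
qed

sublocale G: renewal_law ladder
proof (intro renewal_law.intro positive_law.intro nonneg_law.intro nonneg_law_axioms.intro
    positive_law_axioms.intro renewal_law_axioms.intro)
  show "prob_space ladder" by (rule prob_space_distr) simp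
  show "AE z in ladder. 0 \<le> z" using ladder_nonneg by (subst AE_ladder) auto
  show "\<not> (AE z in ladder. z = 0)"
  proof
    assume "AE z in ladder. z = 0"
    then have "(\<integral>\<^sup>+z. ennreal z \<partial>ladder) = (\<integral>\<^sup>+z. 0 \<partial>ladder)"
      by (intro nn_integral_cong_AE) (auto elim!: eventually_mono)
    then have "ennreal F.drift * ladder_epochs = 0" by (simp add: nn_integral_ladder)
    then show False
      using F.drift_pos ladder_epochs_ge_1 by (auto simp: F.drift_def ennreal_eq_0_iff)
  qed
  show "integrable ladder (\<lambda>z. z\<^sup>2)"
    using ladder_square_finite by (intro integrableI_nonneg) auto
qed simp

section \<open>Passage times and the renewal function\<close>

definition mean_period :: real where "mean_period = enn2real ladder_epochs"

lemma ladder_epochs_eq: "ladder_epochs = ennreal mean_period"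
  using ladder_epochs_finite by (simp add: mean_period_def)

lemma mean_period_ge_1: "1 \<le> mean_period"
  using ladder_epochs_ge_1 by (simp add: ladder_epochs_eq)

lemma mean_eq: "G.mean = F.drift * mean_period"
proof -
  have "ennreal G.mean = ennreal (F.drift * mean_period)"
    using G.nn_integral_mean nn_integral_ladder F.drift_pos mean_period_ge_1
    by (simp add: ladder_epochs_eq ennreal_mult F.drift_def)
  then show ?thesis
    using G.mean_pos F.drift_pos mean_period_ge_1 by (subst (asm) ennreal_inj) (auto simp: F.drift_def)
qed

lemma passage_time_eq: "F.passage_time x = ladder_epochs * G.renewal x"
proof (rule G.renewal_unique[OF F.measurable_passage_time F.passage_time_neg F.mono_passage_time F.passage_time_finite ladder_epochs_finite])
  fix x :: real assume "0 \<le> x"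
  let ?V = "\<lambda>s. F.passage_time (x - s)"
  let ?FV = "\<lambda>s. \<integral>\<^sup>+y. F.passage_time (x - (s + y)) \<partial>increment"
  \<comment> \<open>Before \<tau> the position s is at most 0, so x - s \<ge> 0 and the one-step
    equation holds at every position visited.\<close>
  have eq: "?V s = 1 + ?FV s" if "s \<le> 0" for s
    using F.passage_time_equation[of "x - s"] that \<open>0 \<le> x\<close> by (simp add: algebra_simps)
  have "occupation ?FV + ?V 0 = occupation ?V + (\<integral>\<^sup>+z. ?V z \<partial>ladder)"
    by (rule occupation_identity) measurable
  also have "occupation ?V = occupation (\<lambda>s. 1 + ?FV s)"
    by (rule occupation_cong) (rule eq)
  also have "\<dots> = ladder_epochs + occupation ?FV"
    by (subst occupation_add) (auto simp: ladder_epochs_def)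
  finally have "occupation ?FV + ?V 0 = occupation ?FV + (ladder_epochs + (\<integral>\<^sup>+z. ?V z \<partial>ladder))"
    by (simp add: ac_simps)
  \<comment> \<open>The passage time grows at most like the exponential weight, which is integrable
    for the occupation measure; so the common term cancels.\<close>
  moreover have "occupation ?FV < \<infinity>"
  proof (rule occupation_finite)
    fix s :: real assume "s \<le> 0"
    have "?FV s \<le> ?V s" using eq[OF \<open>s \<le> 0\<close>] by simp
    also have "\<dots> \<le> ennreal (1 / (1 - F.decay) * exp (F.rate * (x - s)))"
      by (rule F.passage_time_le)
    also have "1 / (1 - F.decay) * exp (F.rate * (x - s)) = (1 / (1 - F.decay) * exp (F.rate * x)) * exp (- F.rate * s)"
      by (simp add: right_diff_distrib exp_diff exp_minus field_simps)
    finally show "?FV s \<le> ennreal ((1 / (1 - F.decay) * exp (F.rate * x)) * exp (- F.rate * s))" .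
  qed (use F.decay_less_1 in simp)
  ultimately show "F.passage_time x = ladder_epochs + (\<integral>\<^sup>+z. ?V z \<partial>ladder)"
    by (auto simp: ennreal_add_left_cancel)
qed

lemma integrable_U_increment: "integrable increment (\<lambda>y. G.U (x - y))"
  using F.lower G.U_nonneg
  by (intro F.integrable_const_bound[where B = "G.U (x + r)"]) (auto elim!: eventually_mono intro: G.mono_U)

lemma passage_time_U: "F.passage_time x = ennreal (mean_period * G.U x)"
  using mean_period_ge_1 by (simp add: passage_time_eq ladder_epochs_eq G.renewal_eq_U ennreal_mult G.U_nonneg)

text \<open>The renewal function of the ladder heights thus solves an equation for the original
  increments. This carries lattice structure from the heights over to D - r and absorbs constants in
  the equation for v.\<close>

lemma U_increment_equation:
  assumes "0 \<le> x"
  shows "mean_period * G.U x = 1 + (\<integral>y. mean_period * G.U (x - y) \<partial>increment)"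
proof -
  have "ennreal (mean_period * G.U x) = 1 + (\<integral>\<^sup>+y. ennreal (mean_period * G.U (x - y)) \<partial>increment)"
    using F.passage_time_equation[OF assms] by (simp add: passage_time_U)
  also have "\<dots> = 1 + ennreal (\<integral>y. mean_period * G.U (x - y) \<partial>increment)"
    using integrable_U_increment[of x] mean_period_ge_1 G.U_nonneg by (subst nn_integral_eq_integral) auto
  also have "\<dots> = ennreal (1 + (\<integral>y. mean_period * G.U (x - y) \<partial>increment))"
    using mean_period_ge_1 G.U_nonneg by (subst ennreal_plus) (auto intro!: integral_nonneg_AE)
  finally show ?thesis
    using mean_period_ge_1 G.U_nonneg by (subst (asm) ennreal_inj) (auto intro!: integral_nonneg_AE add_nonneg_nonneg)
qed

lemma mean_period_nonneg: "0 \<le> mean_period" and mean_period_pos: "0 < mean_period"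
  using mean_period_ge_1 by auto

text \<open>The renewal function is constant on the cells of a lattice carrying the ladder heights. By the
  equation for \<open>U\<close> an increment off the lattice would make it constant across cells, hence bounded.\<close>

lemma increment_lattice:
  assumes "0 < d" and lattice: "AE z in ladder. \<exists>k::int. z = d * of_int k"
  shows "AE y in increment. \<exists>k::int. y = d * of_int k"
proof -
  \<comment> \<open>Shifts inside one cell that approach its right end. Being countably many, they
    allow a single exceptional null set for all K and j.\<close>
  define c where "c j = d * (1 - 1 / real (j + 2))" for j :: nat
  have c: "0 \<le> c j" "c j < d" for j
    using \<open>0 < d\<close> by (auto simp: c_def field_simps)
  have "AE y in increment. G.U (d * real K + c j - y) = G.U (d * real K - y)" for K j
  proof -
    have "0 \<le> d * real K" using \<open>0 < d\<close> by simp
    have "\<lfloor>(d * real K + c j) / d\<rfloor> = \<lfloor>d * real K / d\<rfloor>"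
      using \<open>0 < d\<close> c[of j] by (simp add: add_divide_distrib floor_eq_iff)
    then have "G.U (d * real K + c j) = G.U (d * real K)"
      using G.U_lattice[OF \<open>0 < d\<close> lattice, of "d * real K + c j"] G.U_lattice[OF \<open>0 < d\<close> lattice, of "d * real K"] by simp
    then have "(\<integral>y. mean_period * G.U (d * real K + c j - y) \<partial>increment) = (\<integral>y. mean_period * G.U (d * real K - y) \<partial>increment)"
      using U_increment_equation[of "d * real K"] U_increment_equation[of "d * real K + c j"] c[of j] \<open>0 \<le> d * real K\<close>
      by auto
    then have "(\<integral>y. G.U (d * real K + c j - y) - G.U (d * real K - y) \<partial>increment) = 0"
      using mean_period_pos integrable_U_increment by simp
    \<comment> \<open>The integrand is nonnegative because U is increasing, so a vanishing mean
      makes it vanish almost surely.\<close>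
    then have "AE y in increment. G.U (d * real K + c j - y) - G.U (d * real K - y) = 0"
      using c[of j] by (subst (asm) integral_nonneg_eq_0_iff_AE)
        (auto intro!: Bochner_Integration.integrable_diff integrable_U_increment G.mono_U)
    then show ?thesis by simp
  qed
  then have "AE y in increment. \<forall>K j. G.U (d * real K + c j - y) = G.U (d * real K - y)"
    by (simp add: AE_all_countable)
  then show ?thesis
  proof eventually_elim
    case (elim y)
    show ?case
    proof (rule ccontr)
      assume off: "\<not> (\<exists>k::int. y = d * of_int k)"
      define q where "q = y / d"
      have "y = d * q" using \<open>0 < d\<close> by (simp add: q_def)
      \<comment> \<open>The phase of d K - y inside its cell, the same for every K. It is positive
        as y is off the lattice, so a shift \<open>c j\<close> with 1 / (j + 2) < \<phi> pushes the
        point into the next cell.\<close>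
      define \<phi> where "\<phi> = of_int \<lceil>q\<rceil> - q"
      have "q \<noteq> of_int \<lceil>q\<rceil>" using off \<open>y = d * q\<close> by metis
      then have "0 < \<phi>" "\<phi> < 1" unfolding \<phi>_def by linarith+
      obtain j :: nat where "1 / \<phi> < real j" using reals_Archimedean2 by blast
      then have "1 / \<phi> < real (j + 2)" by simp
      then have j: "1 / real (j + 2) < \<phi>" using \<open>0 < \<phi>\<close> by (simp add: field_simps)
      have step: "G.U (d * of_int (m + 1)) = G.U (d * of_int m)" if "- \<lceil>q\<rceil> \<le> m" for m
      proof -
        define K where "K = nat (m + \<lceil>q\<rceil>)"
        have K: "real K = of_int m + of_int \<lceil>q\<rceil>" using that by (simp add: K_def)
        have 1: "(d * real K - y) / d = of_int m + \<phi>"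
          using \<open>0 < d\<close> by (simp add: \<open>y = d * q\<close> K \<phi>_def field_simps)
        have 2: "(d * real K + c j - y) / d = of_int m + \<phi> + (1 - 1 / real (j + 2))"
          using \<open>0 < d\<close> 1 by (simp add: c_def add_divide_distrib diff_divide_distrib)
        have "\<lfloor>(d * real K - y) / d\<rfloor> = m"
          unfolding 1 using \<open>0 < \<phi>\<close> \<open>\<phi> < 1\<close> by (intro floor_unique) auto
        moreover have "\<lfloor>(d * real K + c j - y) / d\<rfloor> = m + 1"
          unfolding 2
        proof (rule floor_unique)
          have "0 < 1 / real (j + 2)" by simp
          then show "of_int m + \<phi> + (1 - 1 / real (j + 2)) < of_int (m + 1) + 1"
            unfolding of_int_add of_int_1 using \<open>\<phi> < 1\<close> by linarith
          show "of_int (m + 1) \<le> of_int m + \<phi> + (1 - 1 / real (j + 2))" using j by simp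
        qed
        moreover have "G.U (d * real K + c j - y) = G.U (d * real K - y)" using elim by blast
        ultimately show ?thesis
          using G.U_lattice[OF \<open>0 < d\<close> lattice, of "d * real K - y"]
            G.U_lattice[OF \<open>0 < d\<close> lattice, of "d * real K + c j - y"] by simp
      qed
      define m0 where "m0 = max 0 (- \<lceil>q\<rceil>)"
      have const: "G.U (d * of_int (m0 + int n)) = G.U (d * of_int m0)" for n
      proof (induction n)
        case (Suc n)
        then show ?case using step[of "m0 + int n"] by (simp add: m0_def ac_simps)
      qed simp
      \<comment> \<open>Beyond m0 the function U would be constant, against its lower bound x /
        \<open>G.mean\<close>.\<close>
      obtain n :: nat where n: "G.mean * G.U (d * of_int m0) < real n * d"
        using reals_Archimedean3[OF \<open>0 < d\<close>] by blast
      have "real n * d \<le> d * of_int (m0 + int n)"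
        using \<open>0 < d\<close> by (simp add: m0_def algebra_simps)
      moreover have "max (d * of_int (m0 + int n)) 0 / G.mean \<le> G.U (d * of_int (m0 + int n))"
        using G.excess_nonneg[of "d * of_int (m0 + int n)"] by (simp add: G.excess_def)
      then have "max (d * of_int (m0 + int n)) 0 \<le> G.mean * G.U (d * of_int m0)"
        unfolding const using G.mean_pos by (simp add: field_simps)
      ultimately show False using n by linarith
    qed
  qed
qed

end

subsection \<open>The relative value function\<close>

lemma power_le_exp:
  assumes "0 < (a::real)"
  shows "\<exists>C\<ge>0. \<forall>x\<ge>0. (1 + x) ^ k \<le> C * exp (a * x)"
proof -
  \<comment> \<open>Dividing by k + 1 instead of k keeps s positive for k = 0 while k s \<le>
    a.\<close>
  define s where "s = a / (real k + 1)"
  have "0 < s" using assms by (simp add: s_def)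
  have "(1 + x) ^ k \<le> (1 + 1 / s) ^ k * exp (a * x)" if "0 \<le> x" for x
  proof -
    have "1 + x \<le> (1 + 1 / s) * (1 + s * x)"
      using \<open>0 < s\<close> that by (simp add: field_simps)
    also have "\<dots> \<le> (1 + 1 / s) * exp (s * x)"
      using \<open>0 < s\<close> by (intro mult_left_mono exp_ge_add_one_self) auto
    finally have "(1 + x) ^ k \<le> ((1 + 1 / s) * exp (s * x)) ^ k"
      using that by (intro power_mono) auto
    also have "\<dots> = (1 + 1 / s) ^ k * exp (real k * s * x)"
      by (simp add: power_mult_distrib exp_of_nat_mult[symmetric] mult.assoc)
    also have "\<dots> \<le> (1 + 1 / s) ^ k * exp (a * x)"
    proof -
      have "real k * s \<le> (real k + 1) * s" using \<open>0 < s\<close> by simp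
      also have "\<dots> = a" by (simp add: s_def)
      finally have "real k * s * x \<le> a * x" using that by (intro mult_right_mono)
      then show ?thesis using \<open>0 < s\<close> by (intro mult_left_mono) auto
    qed
    finally show ?thesis .
  qed
  then show ?thesis using \<open>0 < s\<close> by (intro exI[of _ "(1 + 1 / s) ^ k"]) auto
qed

context demand_walk
begin

lemma integrable_increment_shift:
  fixes f :: "real \<Rightarrow> real"
  assumes [measurable]: "f \<in> borel_measurable borel" and bound: "\<And>z. z \<le> x + r \<Longrightarrow> \<bar>f z\<bar> \<le> B"
  shows "integrable increment (\<lambda>y. f (x - y))"
proof (rule F.integrable_const_bound)
  show "AE y in increment. norm (f (x - y)) \<le> B"
    using F.lower by eventually_elim (use bound in simp)
qed measurable

definition U_integral :: "real \<Rightarrow> real" where "U_integral x = enn2real (G.renewal_integral x)"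

lemma renewal_integral_eq: "G.renewal_integral x = ennreal (U_integral x)"
  using G.renewal_integral_finite[of x] by (simp add: U_integral_def)

lemma U_integral_nonneg: "0 \<le> U_integral x"
  by (simp add: U_integral_def)

lemma U_integral_neg: "x \<le> 0 \<Longrightarrow> U_integral x = 0"
  by (simp add: U_integral_def G.renewal_integral_neg)

lemma measurable_U_integral [measurable]: "U_integral \<in> borel_measurable borel"
  unfolding U_integral_def by measurable

lemma mono_U_integral: "x \<le> y \<Longrightarrow> U_integral x \<le> U_integral y"
  using G.mono_renewal_integral G.renewal_integral_finite by (auto simp: U_integral_def intro!: enn2real_mono)

lemma integrable_U_integral: "integrable increment (\<lambda>y. U_integral (x - y))"
  using U_integral_nonneg mono_U_integral
  by (intro integrable_increment_shift[where B = "U_integral (x + r)"]) auto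

lemma U_integral_eq: "(LBINT t:{0..x}. G.U t) = U_integral x"
proof -
  have "(LBINT t:{0..x}. G.U t) = enn2real (\<integral>\<^sup>+t. ennreal (indicator {0..x} t * G.U t) \<partial>lborel)"
    unfolding set_lebesgue_integral_def
    by (subst integral_eq_nn_integral) (auto simp: G.U_nonneg)
  also have "(\<integral>\<^sup>+t. ennreal (indicator {0..x} t * G.U t) \<partial>lborel) = G.renewal_integral x"
    unfolding G.renewal_integral_def
    by (intro nn_integral_cong) (auto simp: indicator_def G.renewal_eq_U G.U_neg)
  finally show ?thesis by (simp add: U_integral_def)
qed

lemma U_integrable: "set_integrable lborel {0..x} G.U"
  unfolding set_integrable_def
proof (rule Bochner_Integration.integrable_bound)
  show "integrable lborel (\<lambda>t. indicator {0..x} t * G.U x)"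
    by (intro integrable_mult_left integrable_real_indicator) (auto simp: emeasure_lborel_Icc_eq)
qed (auto simp: indicator_def G.U_nonneg intro!: G.mono_U)

text \<open>Integrate V = 1 + P V over [0, x]. The integral of U (t - y) over this range is the
  difference of \<open>U_integral\<close> at x - y and at - y; the second value is nonzero for y < 0
  and produces the constant. Extended reals force it onto the left until the end.\<close>

lemma U_integral_equation:
  assumes "0 \<le> x"
  shows "mean_period * U_integral x = x + mean_period * (\<integral>y. U_integral (x - y) \<partial>increment) - mean_period * (\<integral>y. U_integral (- y) \<partial>increment)"
proof -
  interpret pair_sigma_finite lborel increment ..
  let ?V = "F.passage_time"
  have V: "?V t = ladder_epochs * G.renewal t" for t by (rule passage_time_eq)
  have "ladder_epochs * G.renewal_integral x = (\<integral>\<^sup>+t. ?V t * indicator {..x} t \<partial>lborel)"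
    unfolding G.renewal_integral_def V mult.assoc by (subst nn_integral_cmult) auto
  also have "\<dots> = (\<integral>\<^sup>+t. indicator {0..x} t + (\<integral>\<^sup>+y. ?V (t - y) * indicator {0..x} t \<partial>increment) \<partial>lborel)"
  proof (rule nn_integral_cong)
    fix t
    show "?V t * indicator {..x} t = indicator {0..x} t + (\<integral>\<^sup>+y. ?V (t - y) * indicator {0..x} t \<partial>increment)"
      using F.passage_time_equation[of t] F.passage_time_neg[of t]
      by (cases "0 \<le> t") (auto simp: indicator_def)
  qed
  also have "\<dots> = ennreal x + (\<integral>\<^sup>+t. (\<integral>\<^sup>+y. ?V (t - y) * indicator {0..x} t \<partial>increment) \<partial>lborel)"
    using assms by (subst nn_integral_add) auto
  also have "(\<integral>\<^sup>+t. (\<integral>\<^sup>+y. ?V (t - y) * indicator {0..x} t \<partial>increment) \<partial>lborel)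
    = (\<integral>\<^sup>+y. (\<integral>\<^sup>+t. ?V (t - y) * indicator {0..x} t \<partial>lborel) \<partial>increment)"
    by (rule Fubini'[symmetric]) measurable
  finally have 1: "ladder_epochs * G.renewal_integral x
     = ennreal x + (\<integral>\<^sup>+y. (\<integral>\<^sup>+t. ?V (t - y) * indicator {0..x} t \<partial>lborel) \<partial>increment)" .
  have shift: "(\<integral>\<^sup>+t. ?V (t - y) * indicator {..z} t \<partial>lborel) = ladder_epochs * G.renewal_integral (z - y)" for y z
    unfolding V mult.assoc by (subst nn_integral_cmult) (auto simp: G.shift_integral)
  \<comment> \<open>The ranges [0, x] and \<open>{..0}\<close> overlap in the single point 0, which
    is null.\<close>
  have 2: "(\<integral>\<^sup>+t. ?V (t - y) * indicator {0..x} t \<partial>lborel) + ladder_epochs * G.renewal_integral (0 - y)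
     = ladder_epochs * G.renewal_integral (x - y)" for y
  proof -
    have "(\<integral>\<^sup>+t. ?V (t - y) * indicator {0..x} t \<partial>lborel) + (\<integral>\<^sup>+t. ?V (t - y) * indicator {..0} t \<partial>lborel)
      = (\<integral>\<^sup>+t. ?V (t - y) * indicator {0..x} t + ?V (t - y) * indicator {..0} t \<partial>lborel)"
      by (rule nn_integral_add[symmetric]) measurable
    also have "\<dots> = (\<integral>\<^sup>+t. ?V (t - y) * indicator {..x} t \<partial>lborel)"
      by (rule nn_integral_cong_AE, rule AE_mp[OF AE_lborel_singleton[of 0]])
         (use assms in \<open>auto simp: indicator_def\<close>)
    finally show ?thesis by (simp only: shift)
  qed
  have "ladder_epochs * G.renewal_integral x + (\<integral>\<^sup>+y. ladder_epochs * G.renewal_integral (0 - y) \<partial>increment)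
    = ennreal x + ((\<integral>\<^sup>+y. (\<integral>\<^sup>+t. ?V (t - y) * indicator {0..x} t \<partial>lborel) \<partial>increment)
        + (\<integral>\<^sup>+y. ladder_epochs * G.renewal_integral (0 - y) \<partial>increment))"
    by (simp only: 1 add.assoc)
  also have "(\<integral>\<^sup>+y. (\<integral>\<^sup>+t. ?V (t - y) * indicator {0..x} t \<partial>lborel) \<partial>increment)
        + (\<integral>\<^sup>+y. ladder_epochs * G.renewal_integral (0 - y) \<partial>increment)
     = (\<integral>\<^sup>+y. ladder_epochs * G.renewal_integral (x - y) \<partial>increment)"
    unfolding 2[symmetric] by (rule nn_integral_add[symmetric]) measurable
  finally have "ladder_epochs * G.renewal_integral x + (\<integral>\<^sup>+y. ladder_epochs * G.renewal_integral (0 - y) \<partial>increment)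
    = ennreal x + (\<integral>\<^sup>+y. ladder_epochs * G.renewal_integral (x - y) \<partial>increment)" .
  moreover have "(\<integral>\<^sup>+y. ladder_epochs * G.renewal_integral (z - y) \<partial>increment)
      = ennreal (mean_period * (\<integral>y. U_integral (z - y) \<partial>increment))" for z
    using mean_period_nonneg U_integral_nonneg integrable_U_integral[of z]
    by (simp add: ladder_epochs_eq renewal_integral_eq ennreal_mult[symmetric] nn_integral_eq_integral)
  moreover have "ladder_epochs * G.renewal_integral x = ennreal (mean_period * U_integral x)"
    using mean_period_nonneg U_integral_nonneg by (simp add: ladder_epochs_eq renewal_integral_eq ennreal_mult)
  ultimately have "ennreal (mean_period * U_integral x) + ennreal (mean_period * (\<integral>y. U_integral (0 - y) \<partial>increment))
     = ennreal x + ennreal (mean_period * (\<integral>y. U_integral (x - y) \<partial>increment))"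
    by (simp only:)
  then have "ennreal (mean_period * U_integral x + mean_period * (\<integral>y. U_integral (0 - y) \<partial>increment))
     = ennreal (x + mean_period * (\<integral>y. U_integral (x - y) \<partial>increment))"
    using assms mean_period_nonneg U_integral_nonneg
    by (simp add: ennreal_plus integral_nonneg_AE)
  then have "mean_period * U_integral x + mean_period * (\<integral>y. U_integral (0 - y) \<partial>increment)
     = x + mean_period * (\<integral>y. U_integral (x - y) \<partial>increment)"
    using assms mean_period_nonneg U_integral_nonneg
    by (subst (asm) ennreal_inj) (auto intro!: add_nonneg_nonneg mult_nonneg_nonneg integral_nonneg_AE)
  then show ?thesis by simp
qed

section \<open>Translation of the notions in the statement\<close>

lemma mu_plus_eq: "mu_plus M Ds r = G.mean"
  unfolding mu_plus_def G.mean_def by (rule integral_distr[symmetric]) simp_all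

lemma var_plus_eq: "var_plus M Ds r + (mu_plus M Ds r)\<^sup>2 = G.second_moment"
proof -
  have "integrable M (ladder_height Ds r)" "integrable M (\<lambda>w. (ladder_height Ds r w)\<^sup>2)"
    using G.mean_integrable G.square_integrable by (simp_all add: integrable_distr_eq)
  then have "var_plus M Ds r = expectation (\<lambda>w. (ladder_height Ds r w)\<^sup>2) - (mu_plus M Ds r)\<^sup>2"
    unfolding var_plus_def mu_plus_def by (rule variance_eq)
  moreover have "G.second_moment = expectation (\<lambda>w. (ladder_height Ds r w)\<^sup>2)"
    unfolding G.second_moment_def by (rule integral_distr) simp_all
  ultimately show ?thesis by simp
qed

lemma kappa_eq: "kappa M D Ds r = (if lattice_rv M D then (G.second_moment + G.mean) / (2 * G.mean\<^sup>2)
    else G.second_moment / (2 * G.mean\<^sup>2))"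
  using var_plus_eq by (simp add: kappa_def mu_plus_eq)

lemma renewal_plus_eq: "renewal_plus M Ds r x = G.U x"
proof -
  have fin: "finite_measure (conv_power ladder k)" for k
    by (rule prob_space.finite_measure[OF G.conv_power_prob])
  have "G.renewal x = (\<Sum>k. ennreal (measure (conv_power ladder k) {..x}))"
    unfolding G.renewal_def using fin by (simp add: finite_measure.emeasure_eq_measure)
  moreover have "summable (\<lambda>k. measure (conv_power ladder k) {..x})"
    using G.renewal_finite[of x] unfolding calculation
    by (intro summable_suminf_not_top) auto
  ultimately have "G.renewal x = ennreal (\<Sum>k. measure (conv_power ladder k) {..x})"
    by (simp add: suminf_ennreal2)
  moreover have "0 \<le> (\<Sum>k. measure (conv_power ladder k) {..x})"
    using \<open>summable _\<close> by (intro suminf_nonneg) auto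
  ultimately show ?thesis
    unfolding renewal_plus_def cdf_def G.U_def by simp
qed

text \<open>Since max (y - x) 0 = max (x - y) 0 - x + y, holding and penalty costs involve the same
  integral, and the mean of D - r cancels.\<close>

lemma cost_term_eq:
  "cost_term M D Ds h p r x = (h + p) * (\<integral>y. max (x - y) 0 \<partial>increment) - p * x
     - h * (\<integral>j. j \<partial>(steady_state M Ds r))"
proof -
  have int: "integrable increment (\<lambda>y. max (x - y) 0)"
    using F.increment_integrable by (auto intro!: Bochner_Integration.integrable_max)
  have 1: "expectation (\<lambda>w. max (x - (D w - r)) 0) = (\<integral>y. max (x - y) 0 \<partial>increment)"
    by (rule integral_distr[symmetric]) simp_all
  have "expectation (\<lambda>w. max ((D w - r) - x) 0) = (\<integral>y. max (y - x) 0 \<partial>increment)"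
    by (rule integral_distr[symmetric]) simp_all
  also have "\<dots> = (\<integral>y. max (x - y) 0 - x + y \<partial>increment)"
    by (intro Bochner_Integration.integral_cong) (auto simp: max_def)
  also have "\<dots> = (\<integral>y. max (x - y) 0 \<partial>increment) - x + F.drift"
    using int F.increment_integrable by (simp add: F.drift_def F.prob_space[simplified])
  finally have 2: "expectation (\<lambda>w. max ((D w - r) - x) 0) = (\<integral>y. max (x - y) 0 \<partial>increment) - x + F.drift" .
  have 3: "expectation (\<lambda>w. D w - r) = F.drift"
    using D_integrable by (simp add: drift_eq prob_space)
  show ?thesis
    unfolding cost_term_def 1 2 3 by (simp add: algebra_simps)
qed

text \<open>Both sides solve the integral equation up to the unknown constant \<open>E J\<^sub>\<infinity>\<close>. Their difference is thus
  a multiple of \<open>U\<close> plus a function harmonic for the killed walk, which vanishes by its growth; and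
  \<open>v 0 = 0 < U 0\<close> forces the multiple to be zero, so the steady state need not be computed.\<close>

lemma relative_value_eq:
  assumes v: "relative_value_function M D Ds h p r v" and "0 \<le> x"
  shows "v x = h * mean_period * U_integral x - (p + h) * x"
proof -
  \<comment> \<open>Extension by zero turns the integral over [-r, x] into one over the whole line;
    v itself is arbitrary on the negatives.\<close>
  define v0 where "v0 x = indicator {0..} x * v x" for x
  define A where "A x = (\<integral>y. max (x - y) 0 \<partial>increment)" for x
  define J where "J = (\<integral>j. j \<partial>(steady_state M Ds r))"
  define c0 where "c0 = mean_period * (\<integral>y. U_integral (- y) \<partial>increment)"
  define V where "V x = h * mean_period * U_integral x - (p + h) * max x 0" for x
  \<comment> \<open>v0 and V solve the equation with constants that differ by exactly c. As
    \<open>mean_period * G.U\<close> solves it with forcing 1, subtracting c times this function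
    makes w harmonic.\<close>
  define c where "c = h * c0 - h * J"
  define w where "w x = v0 x - V x - c * (mean_period * G.U x)" for x
  have "v 0 = 0" and eq: "\<And>x. 0 \<le> x \<Longrightarrow> v x = cost_term M D Ds h p r x + (LINT y:{-r..x}|increment. v (x - y))"
    and meas: "v \<in> borel_measurable (restrict_space borel {0..})"
    and growth: "\<exists>C k. \<forall>x\<ge>0. \<bar>v x\<bar> \<le> C * (1 + x) ^ k"
    using v unfolding relative_value_function_def by blast+
  have [measurable]: "v0 \<in> borel_measurable borel"
    using meas by (subst (asm) borel_measurable_restrict_space_iff) (auto simp: v0_def[abs_def])
  have [measurable]: "V \<in> borel_measurable borel"
    unfolding V_def by measurable
  obtain C k where Ck: "\<And>x. 0 \<le> x \<Longrightarrow> \<bar>v x\<bar> \<le> C * (1 + x) ^ k" using growth by blast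
  have "0 \<le> C" using Ck[of 0] by simp
  have int_v0: "integrable increment (\<lambda>y. v0 (x - y))" if "0 \<le> x" for x
  proof (rule integrable_increment_shift[where B = "C * (1 + (x + r)) ^ k"])
    fix z assume "z \<le> x + r"
    show "\<bar>v0 z\<bar> \<le> C * (1 + (x + r)) ^ k"
    proof (cases "0 \<le> z")
      case True
      have "C * (1 + z) ^ k \<le> C * (1 + (x + r)) ^ k"
        using True \<open>z \<le> x + r\<close> \<open>0 \<le> C\<close> by (intro mult_left_mono power_mono) auto
      then show ?thesis using Ck[OF True] True by (simp add: v0_def)
    next
      case False
      then show ?thesis using \<open>0 \<le> C\<close> that order_nonneg by (simp add: v0_def)
    qed
  qed measurable
  have int_max: "integrable increment (\<lambda>y. max (x - y) 0)" for x
    using F.increment_integrable by (auto intro!: Bochner_Integration.integrable_max)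
  have int_V: "integrable increment (\<lambda>y. V (x - y))" for x
    unfolding V_def using int_max[of x] integrable_U_integral[of x] by simp
  have v0_eq: "v0 x = (h + p) * A x - p * x - h * J + (\<integral>y. v0 (x - y) \<partial>increment)" if "0 \<le> x" for x
  proof -
    have "(LINT y:{-r..x}|increment. v (x - y)) = (\<integral>y. v0 (x - y) \<partial>increment)"
      unfolding set_lebesgue_integral_def
    proof (rule integral_cong_AE)
      show "AE y in increment. indicator {-r..x} y *\<^sub>R v (x - y) = v0 (x - y)"
        using F.lower by eventually_elim (auto simp: v0_def indicator_def)
      have "(\<lambda>y. indicator {-r..x} y *\<^sub>R v (x - y)) = (\<lambda>y. indicator {-r..x} y * v0 (x - y))"
        by (auto simp: v0_def indicator_def)
      then show "(\<lambda>y. indicator {-r..x} y *\<^sub>R v (x - y)) \<in> borel_measurable increment" by simp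
    qed measurable
    then show ?thesis
      using eq[OF that] that by (simp add: v0_def cost_term_eq A_def J_def)
  qed
  have V_eq: "V x = - p * x - h * c0 + (h + p) * A x + (\<integral>y. V (x - y) \<partial>increment)" if "0 \<le> x" for x
  proof -
    have "(\<integral>y. V (x - y) \<partial>increment) = h * mean_period * (\<integral>y. U_integral (x - y) \<partial>increment) - (p + h) * A x"
      unfolding V_def A_def using int_max[of x] integrable_U_integral[of x] by simp
    moreover have "V x = h * (mean_period * U_integral x) - (p + h) * x"
      using that by (simp add: V_def)
    ultimately show ?thesis
      unfolding U_integral_equation[OF that] c0_def by (simp add: algebra_simps)
  qed
  have w_zero: "w x = 0" for x
  proof -
    obtain C1 where C1: "0 \<le> C1" "\<And>x. 0 \<le> x \<Longrightarrow> (1 + x) ^ k \<le> C1 * exp (F.rate * x)"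
      using power_le_exp[OF F.rate_pos] by blast
    obtain C2 where C2: "0 \<le> C2" "\<And>x. 0 \<le> x \<Longrightarrow> (1 + x) ^ 2 \<le> C2 * exp (F.rate * x)"
      using power_le_exp[OF F.rate_pos] by blast
    define B where "B = 1 / G.mean + G.excess_bound"
    have "0 \<le> G.excess_bound" using G.abs_excess_le[of 0] by linarith
    then have "0 \<le> B" using G.mean_pos by (simp add: B_def)
    have U_le: "G.U x \<le> B * (1 + x)" if "0 \<le> x" for x
    proof -
      have "G.U x = G.excess x + x / G.mean" using that by (simp add: G.excess_def)
      also have "\<dots> \<le> G.excess_bound + x / G.mean"
        using G.abs_excess_le[of x] by linarith
      also have "\<dots> \<le> B * (1 + x)"
        using that G.mean_pos \<open>0 \<le> G.excess_bound\<close> by (simp add: B_def algebra_simps add_divide_distrib)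
      finally show ?thesis .
    qed
    have UI_le: "U_integral x \<le> B * (1 + x)\<^sup>2" if "0 \<le> x" for x
    proof -
      have "ennreal (U_integral x) \<le> ennreal (G.U x * x)"
        using G.renewal_integral_le[of x] that G.U_nonneg
        by (simp add: renewal_integral_eq G.renewal_eq_U ennreal_mult)
      then have "U_integral x \<le> G.U x * x"
        using that G.U_nonneg by (subst (asm) ennreal_le_iff) auto
      also have "\<dots> \<le> (B * (1 + x)) * (1 + x)"
        using U_le[OF that] that \<open>0 \<le> B\<close> G.U_nonneg by (intro mult_mono) auto
      finally show ?thesis by (simp add: power2_eq_square mult.assoc)
    qed
    have sq: "1 + x \<le> (1 + x)\<^sup>2" if "0 \<le> x" for x :: real
      using that by (simp add: power2_eq_square algebra_simps)
    show ?thesis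
    proof (rule F.harmonic_zero[of w "C * C1 + (\<bar>h * mean_period\<bar> * B + \<bar>p + h\<bar> + \<bar>c * mean_period\<bar> * B) * C2"])
      fix x :: real assume "0 \<le> x"
      have int_U: "integrable increment (\<lambda>y. c * (mean_period * G.U (x - y)))"
        using integrable_U_increment[of x] by simp
      have "(\<integral>y. w (x - y) \<partial>increment)
        = (\<integral>y. v0 (x - y) \<partial>increment) - (\<integral>y. V (x - y) \<partial>increment) - c * (\<integral>y. mean_period * G.U (x - y) \<partial>increment)"
        unfolding w_def using int_v0[OF \<open>0 \<le> x\<close>] int_V[of x] int_U by simp
      then show "w x = (\<integral>y. w (x - y) \<partial>increment)"
        unfolding w_def[of x] v0_eq[OF \<open>0 \<le> x\<close>] V_eq[OF \<open>0 \<le> x\<close>] U_increment_equation[OF \<open>0 \<le> x\<close>]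
        by (simp add: c_def algebra_simps)
      have "\<bar>v0 x\<bar> \<le> C * (1 + x) ^ k" using Ck[OF \<open>0 \<le> x\<close>] \<open>0 \<le> x\<close> by (simp add: v0_def)
      also have "\<dots> \<le> C * (C1 * exp (F.rate * x))"
        using C1(2)[OF \<open>0 \<le> x\<close>] \<open>0 \<le> C\<close> by (rule mult_left_mono)
      finally have 1: "\<bar>v0 x\<bar> \<le> C * C1 * exp (F.rate * x)" by (simp add: mult.assoc)
      have "\<bar>h * mean_period * U_integral x\<bar> \<le> \<bar>h * mean_period\<bar> * (B * (1 + x)\<^sup>2)"
        unfolding abs_mult[of "h * mean_period"] using UI_le[OF \<open>0 \<le> x\<close>] U_integral_nonneg[of x]
        by (intro mult_left_mono) auto
      moreover have "\<bar>(p + h) * max x 0\<bar> \<le> \<bar>p + h\<bar> * (1 + x)\<^sup>2"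
        unfolding abs_mult using sq[OF \<open>0 \<le> x\<close>] \<open>0 \<le> x\<close> by (intro mult_left_mono) auto
      moreover have "\<bar>c * (mean_period * G.U x)\<bar> \<le> \<bar>c * mean_period\<bar> * (B * (1 + x)\<^sup>2)"
      proof -
        have "G.U x \<le> B * (1 + x)\<^sup>2"
          using U_le[OF \<open>0 \<le> x\<close>] mult_left_mono[OF sq[OF \<open>0 \<le> x\<close>] \<open>0 \<le> B\<close>] by linarith
        then have "\<bar>c * mean_period\<bar> * \<bar>G.U x\<bar> \<le> \<bar>c * mean_period\<bar> * (B * (1 + x)\<^sup>2)"
          using G.U_nonneg[of x] by (intro mult_left_mono) auto
        then show ?thesis by (simp add: abs_mult mult.assoc)
      qed
      ultimately have "\<bar>V x\<bar> + \<bar>c * (mean_period * G.U x)\<bar> \<le> (\<bar>h * mean_period\<bar> * B + \<bar>p + h\<bar> + \<bar>c * mean_period\<bar> * B) * (1 + x)\<^sup>2"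
        unfolding V_def by (simp add: algebra_simps) linarith
      also have "\<dots> \<le> (\<bar>h * mean_period\<bar> * B + \<bar>p + h\<bar> + \<bar>c * mean_period\<bar> * B) * (C2 * exp (F.rate * x))"
        using C2(2)[OF \<open>0 \<le> x\<close>] \<open>0 \<le> B\<close> by (intro mult_left_mono) auto
      finally have 2: "\<bar>V x\<bar> + \<bar>c * (mean_period * G.U x)\<bar> \<le> (\<bar>h * mean_period\<bar> * B + \<bar>p + h\<bar> + \<bar>c * mean_period\<bar> * B) * C2 * exp (F.rate * x)"
        by (simp only: mult.assoc)
      have "\<bar>w x\<bar> \<le> \<bar>v0 x\<bar> + (\<bar>V x\<bar> + \<bar>c * (mean_period * G.U x)\<bar>)"
        unfolding w_def by linarith
      also have "\<dots> \<le> C * C1 * exp (F.rate * x) + (\<bar>h * mean_period\<bar> * B + \<bar>p + h\<bar> + \<bar>c * mean_period\<bar> * B) * C2 * exp (F.rate * x)"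
        by (rule add_mono[OF 1 2])
      finally show "\<bar>w x\<bar> \<le> (C * C1 + (\<bar>h * mean_period\<bar> * B + \<bar>p + h\<bar> + \<bar>c * mean_period\<bar> * B) * C2) * exp (F.rate * x)"
        by (simp only: distrib_right)
    next
      fix x :: real assume "x < 0"
      then show "w x = 0" by (simp add: w_def v0_def V_def U_integral_neg G.U_neg)
    qed
  qed
  \<comment> \<open>At 0 both v and V vanish, so only this term of w is left.\<close>
  have "c * (mean_period * G.U 0) = 0"
    using w_zero[of 0] \<open>v 0 = 0\<close> by (simp add: w_def v0_def V_def U_integral_neg)
  then have "c = 0"
    using mean_period_pos G.U_ge_1[of 0] by auto
  then show ?thesis
    using w_zero[of x] \<open>0 \<le> x\<close> by (simp add: w_def v0_def V_def)
qed

lemma AE_step: "(AE w in M. P (Ds t w - r)) \<longleftrightarrow> (AE y in increment. P y)" if "Measurable.pred borel P"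
  using that unfolding distr_step[of t, symmetric] by (subst AE_distr_iff) auto

text \<open>A lattice for the ladder heights would be one for D - r, and the shift allowed in
  \<open>lattice_rv\<close> absorbs r.\<close>

lemma ladder_nonarithmetic:
  assumes "\<not> lattice_rv M D" "0 < d"
  shows "\<not> (AE z in ladder. \<exists>k::int. z = d * of_int k)"
proof
  assume "AE z in ladder. \<exists>k::int. z = d * of_int k"
  from increment_lattice[OF \<open>0 < d\<close> this] have "AE w in M. \<exists>k::int. D w - r = d * of_int k"
    by (subst (asm) AE_increment) auto
  then have "AE w in M. \<exists>k::int. D w = r + d * of_int k"
    by (rule eventually_mono) (auto simp: algebra_simps)
  then show False using assms unfolding lattice_rv_def by blast
qed

lemma ladder_integer:
  assumes "AE w in M. D w - r \<in> \<int>"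
  shows "AE z in ladder. z \<in> \<int>"
proof -
  have [measurable]: "Measurable.pred borel (\<lambda>y::real. y \<in> \<int>)"
    by (rule pred_sets2[OF borel_closed[OF closed_Ints]]) simp
  have "AE y in increment. y \<in> \<int>" using assms by (subst AE_increment) auto
  then have "AE w in M. Ds t w - r \<in> \<int>" for t
    using AE_step[of "\<lambda>y. y \<in> \<int>" t] by simp
  then have "AE w in M. \<forall>t. Ds t w - r \<in> \<int>"
    by (subst AE_all_countable) simp
  then have "AE w in M. ladder_height Ds r w \<in> \<int>"
    by (rule eventually_mono) (auto simp: ladder_height_def walk_def intro: Ints_sum)
  then show ?thesis by (subst AE_ladder) auto
qed

end

theorem theorem3:
  fixes M :: "'a measure" and D :: "'a \<Rightarrow> real" and Ds :: "nat \<Rightarrow> 'a \<Rightarrow> real"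
    and h p r :: real and v g :: "real \<Rightarrow> real"
  assumes "prob_space M"
    and "D \<in> borel_measurable M"
    and "AE w in M. 0 \<le> D w"
    and "cdf (distr M borel D) 0 = 0"
    and "integrable M (\<lambda>w. (D w)\<^sup>2)"
    and "0 < prob_space.variance M D"
    and "prob_space.indep_vars M (\<lambda>_. borel) Ds UNIV"
    and "\<And>t. distr M borel (Ds t) = distr M borel D"
    and "0 < h" and "0 \<le> p"
    and "0 \<le> r" and "r < prob_space.expectation M D"
    and "relative_value_function M D Ds h p r v"
    and "\<And>x. 0 \<le> x \<Longrightarrow> renewal_plus M Ds r x = x / mu_plus M Ds r + kappa M D Ds r + g x"
  shows "(\<forall>x\<ge>0. v x = b_coeff M D h r *
            ((x - xi_tilde M D Ds h p r)\<^sup>2 - (xi_tilde M D Ds h p r)\<^sup>2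
              + 2 * mu_plus M Ds r * (LBINT y:{0..x}. g y)))
       \<and> (\<forall>x\<ge>0. \<bar>g x\<bar> \<le> kappa M D Ds r)
       \<and> (\<not> lattice_rv M D \<longrightarrow> (g \<longlongrightarrow> 0) at_top)
       \<and> (unit_span M (\<lambda>w. D w - r) \<longrightarrow> (\<lambda>n::nat. g (real n)) \<longlonglongrightarrow> 0)"
proof -
  interpret demand_walk M D Ds r
    using assms by (intro demand_walk.intro demand_walk_axioms.intro) auto
  let ?\<mu> = "mu_plus M Ds r" and ?\<kappa> = "kappa M D Ds r" and ?\<xi> = "xi_tilde M D Ds h p r"
  have \<mu>: "?\<mu> = F.drift * mean_period" by (simp add: mu_plus_eq mean_eq)
  have drift: "0 < F.drift" using F.drift_pos by (simp add: F.drift_def)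
  \<comment> \<open>All claims about g thereby become claims about the excess.\<close>
  have g: "g x = G.excess x - ?\<kappa>" if "0 \<le> x" for x
    using assms(14)[OF that] that by (simp add: renewal_plus_eq G.excess_def mu_plus_eq)
  have "v x = b_coeff M D h r * ((x - ?\<xi>)\<^sup>2 - ?\<xi>\<^sup>2 + 2 * ?\<mu> * (LBINT y:{0..x}. g y))" if "0 \<le> x" for x
  proof -
    have "(LBINT y:{0..x}. g y) = (LBINT y:{0..x}. G.U y - (y / ?\<mu> + ?\<kappa>))"
      by (intro set_lebesgue_integral_cong) (auto simp: g G.excess_def mu_plus_eq)
    also have "\<dots> = (LBINT y:{0..x}. G.U y) - (LBINT y:{0..x}. y / ?\<mu> + ?\<kappa>)"
      by (intro set_integral_diff U_integrable borel_integrable_atLeastAtMost' continuous_intros)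
        (use G.mean_pos mu_plus_eq in auto)
    also have "(LBINT y:{0..x}. y / ?\<mu> + ?\<kappa>) = (x\<^sup>2 / (2 * ?\<mu>) + ?\<kappa> * x) - (0\<^sup>2 / (2 * ?\<mu>) + ?\<kappa> * 0)"
      unfolding set_lebesgue_integral_def real_scaleR_def mult.commute[of "indicator _ _"]
      using \<open>0 \<le> x\<close> G.mean_pos mu_plus_eq
      by (intro integral_FTC_Icc_real) (auto intro!: derivative_eq_intros continuous_intros)
    finally have int: "(LBINT y:{0..x}. g y) = U_integral x - x\<^sup>2 / (2 * ?\<mu>) - ?\<kappa> * x"
      by (simp add: U_integral_eq)
    have "2 * ?\<mu> * (LBINT y:{0..x}. g y) = 2 * ?\<mu> * U_integral x - x\<^sup>2 - 2 * ?\<mu> * ?\<kappa> * x"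
      using G.mean_pos unfolding int by (simp add: mu_plus_eq right_diff_distrib)
    moreover have "?\<xi> = F.drift * (p / h + 1) - ?\<mu> * ?\<kappa>"
      by (simp add: xi_tilde_def drift_eq)
    moreover have "(x - z)\<^sup>2 - z\<^sup>2 = x\<^sup>2 - 2 * x * z" for z
      by (simp add: power2_diff)
    \<comment> \<open>The square of x cancels, and so do the terms in \<kappa>; the latter is why
      \<xi> contains the product of \<mu> and \<kappa>.\<close>
    ultimately have "(x - ?\<xi>)\<^sup>2 - ?\<xi>\<^sup>2 + 2 * ?\<mu> * (LBINT y:{0..x}. g y)
        = 2 * ?\<mu> * U_integral x - 2 * x * (F.drift * (p / h + 1))"
      by (simp only: right_diff_distrib) (simp add: ac_simps)
    \<comment> \<open>Wald's identity turns \<mu> divided by the drift into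
      \<open>mean_period\<close>.\<close>
    also have "b_coeff M D h r * \<dots> = h * mean_period * U_integral x - (p + h) * x"
      using drift \<open>0 < h\<close> by (simp add: b_coeff_def drift_eq[symmetric] \<mu> field_simps)
    finally show ?thesis
      using relative_value_eq[OF assms(13) that] by simp
  qed
  moreover have "\<bar>g x\<bar> \<le> ?\<kappa>" if "0 \<le> x" for x
  proof -
    \<comment> \<open>Lorden's bound is twice the non-lattice \<kappa>, and the lattice \<kappa> is
      larger. The excess therefore lies between 0 and 2 \<kappa>, within \<kappa> of the
      midpoint.\<close>
    have "G.second_moment / G.mean\<^sup>2 \<le> 2 * ?\<kappa>"
      using G.mean_pos by (auto simp: kappa_eq add_divide_distrib distrib_left)
    then show ?thesis
      using G.excess_nonneg[of x] G.excess_le[of x] by (simp add: g[OF that] abs_le_iff)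
  qed
  moreover have "(g \<longlongrightarrow> 0) at_top" if "\<not> lattice_rv M D"
  proof -
    have "((\<lambda>x. G.excess x - ?\<kappa>) \<longlongrightarrow> G.second_moment / (2 * G.mean\<^sup>2) - ?\<kappa>) at_top"
      by (intro tendsto_diff G.excess_limit ladder_nonarithmetic that tendsto_const)
    then have "((\<lambda>x. G.excess x - ?\<kappa>) \<longlongrightarrow> 0) at_top"
      using that by (simp add: kappa_eq)
    then show ?thesis
      by (rule Lim_transform_eventually) (use g in \<open>auto intro!: eventually_mono[OF eventually_ge_at_top[of 0]]\<close>)
  qed
  moreover have "(\<lambda>n. g (real n)) \<longlonglongrightarrow> 0" if span: "unit_span M (\<lambda>w. D w - r)"
  proof -
    have int: "AE w in M. D w - r \<in> \<int>" using span by (simp add: unit_span_def)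
    then have "AE w in M. \<exists>k::int. D w = r + 1 * of_int k"
      by (rule eventually_mono) (auto elim!: Ints_cases simp: algebra_simps)
    then have lattice: "lattice_rv M D"
      unfolding lattice_rv_def by (intro exI[of _ r] exI[of _ 1]) auto
    \<comment> \<open>The unit span is assumed for D - r; a coarser lattice of the ladder heights
      would carry D - r as well.\<close>
    have "d \<le> 1" if "0 < d" "AE z in ladder. \<exists>k::int. z = d * of_int k" for d
    proof -
      have "AE w in M. \<exists>k::int. D w - r = d * of_int k"
        using increment_lattice[OF that] by (subst (asm) AE_increment) auto
      then show ?thesis using span that(1) by (simp add: unit_span_def)
    qed
    then have "(\<lambda>n. G.excess (real n)) \<longlonglongrightarrow> (G.second_moment + G.mean) / (2 * G.mean\<^sup>2)"
      by (intro G.excess_lattice_limit ladder_integer int)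
    from tendsto_diff[OF this tendsto_const[of ?\<kappa>]] show ?thesis
      using lattice by (simp add: g kappa_eq)
  qed
  ultimately show ?thesis by blast
qed

end
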